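(* Let $\alpha \in (1,2)$ and let $\mu_\alpha$ be a non-degenerate symmetric $\alpha$-stable probability measure on $\mathbb{R}^d$, $d \geq 1$, with positive Lebesgue density $p_\alpha$. Then, for all Borel sets $E\subset\mathbb{R}^d$ with $\mathcal{L}_d(E)<+\infty$, $$\mathcal{L}_d(E)^{\frac{d-(\alpha-1)}{d}} \leq C^1_{\alpha,d}\, \mathcal{P}_{\mathrm{frac}}(E), \qquad \mathcal{L}_d(E)^{\frac{d-1}{d}} \leq C^2_{\alpha,d}\, \mathcal{P}_{\mathrm{cl}}(E),$$ where $C^1_{\alpha,d}$ and $C^2_{\alpha,d}$ are given by $$C^1_{\alpha,d} = \left(\frac{1}{2(\alpha-1)} (2d)^{\frac{\alpha-1}{d+ \alpha-1}} + \left(\frac{1}{2d}\right)^{\frac{d}{d+\alpha-1}}\right)^{\frac{d+\alpha-1}{d}} 2^{\frac{\alpha-1}{\alpha}} \|p_\alpha\|_{\infty}^{\frac{\alpha-1}{d}} \|\nabla(p_\alpha)\|_{L^1(\mathbb{R}^d,dx)},$$ $$C^2_{\alpha,d} = \left( \frac{1}{2} (2d)^{\frac{1}{d+1}}+\frac{1}{(2d)^{\frac{d}{d+1}}}\right)^{\frac{d+1}{d}}2^{\frac{1}{\alpha}} \|p_\alpha\|_{\infty}^{\frac{1}{d}}\, \mathbb{E} |Y_\alpha|,$$ and where $Y_\alpha$ is an $\alpha$-stable random variable with characteristic function given by $\mathbb{E} \exp\left(i \xi Y_\alpha\right) = \exp \left(- |\xi|^\alpha\right)$, for all $\xi \in 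\mathbb{R}$.
   Context: $\|\cdot\|$ and $\langle\cdot;\cdot\rangle$ are the Euclidean norm and inner product on $\mathbb{R}^d$, $\mathbb{S}^{d-1}$ is the Euclidean unit sphere, $\mathcal{L}_d$ is $d$-dimensional Lebesgue measure, $\|\cdot\|_\infty$ is the supremum norm. A symmetric $\alpha$-stable L\'evy measure on $\mathbb{R}^d$ is a measure of the form $\nu_\alpha(B)=\int_{\mathbb{S}^{d-1}}\int_0^{+\infty} \mathbf{1}_B(ry)\,\frac{dr}{r^{\alpha+1}}\,\sigma(dy)$, where $\sigma$ is a finite positive symmetric ($\sigma(B)=\sigma(-B)$) Borel measure on $\mathbb{S}^{d-1}$. Its spectral measure is $\lambda_1 = -\cos(\alpha\pi/2)\frac{\Gamma(2-\alpha)}{\alpha(\alpha-1)}\sigma$, and it is non-degenerate if $\inf_{y\in\mathbb{S}^{d-1}}\int_{\mathbb{S}^{d-1}}|\langle y;x\rangle|^\alpha\lambda_1(dx)>0$. Set $\sigma_\alpha(\xi)=\left(\int_{\mathbb{S}^{d-1}}|\langle y;\xi\rangle|^\alpha\lambda_1(dy)\right)^{1/\alpha}$ (a norm on $\mathbb{R}^d$). The associated non-degenerate symmetric $\alpha$-stable probability measure $\mu_\alpha$ is characterized by $\int_{\mathbb{R}^d}e^{i\langle y;\xi\rangle}\mu_\alpha(dy)=\exp(-\sigma_\alpha(\xi)^\alpha)$, $\xi\in\mathbb{R}^d$. Set $P_t^\alpha(f)(x)=\int_{\mathbb{R}^d}f(x+t^{1/\alpha}y)\mu_\alpha(dy)$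 and $D^{\alpha-1}(f)(x)=\int_{\mathbb{R}^d}(f(x+u)-f(x))\,u\,\nu_\alpha(du)$. For a Borel set $E$ with $\mathcal{L}_d(E)<+\infty$, $$\mathcal{P}_{\mathrm{cl}}(E)=\lim_{t\to0^+}\|\sigma_\alpha(\nabla P_t^\alpha(\mathbf{1}_E))\|_{L^1(\mathbb{R}^d,dx)},\qquad \mathcal{P}_{\mathrm{frac}}(E)=\lim_{t\to0^+}\|D^{\alpha-1}P_t^\alpha(\mathbf{1}_E)\|_{L^1(\mathbb{R}^d,dx)};$$ both limits exist in $[0,+\infty]$. The $L^1$ norm of an $\mathbb{R}^d$-valued function is the $L^1$ norm of its Euclidean norm. *)

theory Defs
  imports "HOL-Probability.Probability"
begin

text \<open>The space \<open>\<real>\<^sup>d\<close> is an arbitrary Euclidean space \<open>'a\<close> with \<open>d = DIM('a)\<close>.  Measures on the unit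
  sphere live on the Borel sigma-algebra of the sphere itself, not on that of the ambient space.\<close>

definition symmetric_sphere_measure :: "'a::euclidean_space measure \<Rightarrow> bool" where
  "symmetric_sphere_measure \<sigma> \<longleftrightarrow>
     sets \<sigma> = sets (restrict_space borel (sphere 0 1)) \<and> finite_measure \<sigma> \<and>
     (\<forall>B\<in>sets \<sigma>. emeasure \<sigma> (uminus ` B) = emeasure \<sigma> B)"

definition stable_levy_measure :: "real \<Rightarrow> 'a::euclidean_space measure \<Rightarrow> 'a measure" where
  "stable_levy_measure \<alpha> \<sigma> = measure_of UNIV (sets borel)
     (\<lambda>B. \<integral>\<^sup>+y. (\<integral>\<^sup>+r\<in>{0<..}. indicator B (r *\<^sub>R y) * ennreal (1 / r powr (\<alpha> + 1)) \<partial>lborel) \<partial>\<sigma>)"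

lemma sets_stable_levy_measure [simp, measurable_cong]:
  "sets (stable_levy_measure \<alpha> \<sigma>) = sets borel"
  using sets.sigma_sets_eq[of "borel :: 'a measure"] by (simp add: stable_levy_measure_def)

lemma space_stable_levy_measure [simp]: "space (stable_levy_measure \<alpha> \<sigma>) = UNIV"
  by (simp add: stable_levy_measure_def space_measure_of_conv)

text \<open>\<^const>\<open>measure_of\<close> returns the null measure if the set function is not countably additive;
  the next lemma excludes this.\<close>

lemma emeasure_stable_levy_measure:
  fixes \<sigma> :: "'a::euclidean_space measure"
  assumes "symmetric_sphere_measure \<sigma>" and "B \<in> sets borel"
  shows "emeasure (stable_levy_measure \<alpha> \<sigma>) B =
    (\<integral>\<^sup>+y. (\<integral>\<^sup>+r\<in>{0<..}. indicator B (r *\<^sub>R y) * ennreal (1 / r powr (\<alpha> + 1)) \<partial>lborel) \<partial>\<sigma>)"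
proof -
  let ?g = "\<lambda>(B :: 'a set) y r. indicator B (r *\<^sub>R y) * ennreal (1 / r powr (\<alpha> + 1)) * indicator {0<..} r"
  let ?G = "\<lambda>B. \<integral>\<^sup>+y. (\<integral>\<^sup>+r. ?g B y r \<partial>lborel) \<partial>\<sigma>"
  have S [measurable_cong]: "sets \<sigma> = sets (restrict_space borel (sphere 0 1))"
    using assms(1) by (simp add: symmetric_sphere_measure_def)
  have id: "(\<lambda>y. y) \<in> borel_measurable \<sigma>"
    using measurable_restrict_space1[OF measurable_ident, of borel "sphere 0 1"]
    by (simp add: measurable_cong_sets[OF S refl] id_def)
  have [measurable]: "(\<lambda>z. snd z *\<^sub>R fst z) \<in> borel_measurable (\<sigma> \<Otimes>\<^sub>M lborel)"
    using measurable_compose[OF measurable_fst id] by measurable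
  have m2: "(\<lambda>z. ?g A (fst z) (snd z)) \<in> borel_measurable (\<sigma> \<Otimes>\<^sub>M lborel)"
    if [measurable]: "A \<in> sets borel" for A :: "'a set"
    by measurable
  have m1: "(\<lambda>y. \<integral>\<^sup>+r. ?g A y r \<partial>lborel) \<in> borel_measurable \<sigma>"
    if "A \<in> sets borel" for A :: "'a set"
    using lborel.borel_measurable_nn_integral_fst[OF m2[OF that]] by simp
  have m0: "?g A y \<in> borel_measurable lborel" if [measurable]: "A \<in> sets borel" for A :: "'a set" and y
  proof -
    have "(\<lambda>r. r *\<^sub>R y) \<in> borel_measurable borel"
      by (intro borel_measurable_continuous_onI continuous_intros)
    from measurable_compose[OF this borel_measurable_indicator[OF that]]
    have [measurable]: "(\<lambda>r. indicator A (r *\<^sub>R y) :: ennreal) \<in> borel_measurable borel" .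
    have "?g A y \<in> borel_measurable borel"
      by measurable
    then show ?thesis by simp
  qed
  have "countably_additive (sets borel) ?G"
  proof (rule countably_additiveI)
    fix A :: "nat \<Rightarrow> 'a set"
    assume A: "range A \<subseteq> sets borel" and disj: "disjoint_family A"
    have "(\<Sum>i. ?G (A i)) = (\<integral>\<^sup>+y. (\<Sum>i. \<integral>\<^sup>+r. ?g (A i) y r \<partial>lborel) \<partial>\<sigma>)"
      using A by (intro nn_integral_suminf[symmetric] m1) auto
    also have "\<dots> = (\<integral>\<^sup>+y. (\<integral>\<^sup>+r. (\<Sum>i. ?g (A i) y r) \<partial>lborel) \<partial>\<sigma>)"
      using A by (intro nn_integral_cong nn_integral_suminf[symmetric] m0) auto
    also have "(\<lambda>y r. \<Sum>i. ?g (A i) y r) = ?g (\<Union>i. A i)"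
      by (simp add: suminf_indicator[OF disj, symmetric])
    finally show "(\<Sum>i. ?G (A i)) = ?G (\<Union>i. A i)" .
  qed
  moreover have "positive (sets borel) ?G"
    by (simp add: positive_def)
  ultimately show ?thesis
    unfolding stable_levy_measure_def using assms(2) sets.sigma_sets_eq[of "borel :: 'a measure"]
    by (subst emeasure_measure_of[OF refl]) auto
qed

definition spectral_measure :: "real \<Rightarrow> 'a::euclidean_space measure \<Rightarrow> 'a measure" where
  "spectral_measure \<alpha> \<sigma> =
     scale_measure (ennreal (- cos (\<alpha> * pi / 2) * (Gamma (2 - \<alpha>) / (\<alpha> * (\<alpha> - 1))))) \<sigma>"

definition nondegenerate :: "real \<Rightarrow> 'a::euclidean_space measure \<Rightarrow> bool" where
  "nondegenerate \<alpha> \<sigma> \<longleftrightarrow>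
     (INF y\<in>sphere 0 1. \<integral>x. \<bar>y \<bullet> x\<bar> powr \<alpha> \<partial>(spectral_measure \<alpha> \<sigma>)) > 0"

definition stable_norm :: "real \<Rightarrow> 'a::euclidean_space measure \<Rightarrow> 'a \<Rightarrow> real" where
  "stable_norm \<alpha> \<sigma> \<xi> = (\<integral>y. \<bar>y \<bullet> \<xi>\<bar> powr \<alpha> \<partial>(spectral_measure \<alpha> \<sigma>)) powr (1 / \<alpha>)"

definition nondegenerate_stable_law ::
    "real \<Rightarrow> 'a::euclidean_space measure \<Rightarrow> 'a measure \<Rightarrow> bool" where
  "nondegenerate_stable_law \<alpha> \<sigma> \<mu> \<longleftrightarrow>
     symmetric_sphere_measure \<sigma> \<and> nondegenerate \<alpha> \<sigma> \<and>
     prob_space \<mu> \<and> sets \<mu> = sets borel \<and>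
     (\<forall>\<xi>. (CLINT y|\<mu>. iexp (y \<bullet> \<xi>)) = complex_of_real (exp (- (stable_norm \<alpha> \<sigma> \<xi> powr \<alpha>))))"

definition stable_semigroup ::
    "real \<Rightarrow> 'a::euclidean_space measure \<Rightarrow> real \<Rightarrow> ('a \<Rightarrow> real) \<Rightarrow> 'a \<Rightarrow> real" where
  "stable_semigroup \<alpha> \<mu> t f x = (\<integral>y. f (x + (t powr (1 / \<alpha>)) *\<^sub>R y) \<partial>\<mu>)"

definition frac_gradient ::
    "real \<Rightarrow> 'a::euclidean_space measure \<Rightarrow> ('a \<Rightarrow> real) \<Rightarrow> 'a \<Rightarrow> 'a" where
  "frac_gradient \<alpha> \<sigma> f x = (\<integral>u. (f (x + u) - f x) *\<^sub>R u \<partial>(stable_levy_measure \<alpha> \<sigma>))"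

definition gradient :: "('a::euclidean_space \<Rightarrow> real) \<Rightarrow> 'a \<Rightarrow> 'a" where
  "gradient f x = (THE D. GDERIV f x :> D)"

definition L1_norm :: "('a::euclidean_space \<Rightarrow> 'b::real_normed_vector) \<Rightarrow> ennreal" where
  "L1_norm f = (\<integral>\<^sup>+x. ennreal (norm (f x)) \<partial>lborel)"

text \<open>The limits below are taken in \<open>[0,\<infinity>]\<close>.\<close>

definition perimeter_cl ::
    "real \<Rightarrow> 'a::euclidean_space measure \<Rightarrow> 'a measure \<Rightarrow> 'a set \<Rightarrow> ennreal" where
  "perimeter_cl \<alpha> \<sigma> \<mu> E = Lim (at_right 0)
     (\<lambda>t. L1_norm (\<lambda>x. stable_norm \<alpha> \<sigma> (gradient (stable_semigroup \<alpha> \<mu> t (indicat_real E)) x)))"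

definition perimeter_frac ::
    "real \<Rightarrow> 'a::euclidean_space measure \<Rightarrow> 'a measure \<Rightarrow> 'a set \<Rightarrow> ennreal" where
  "perimeter_frac \<alpha> \<sigma> \<mu> E = Lim (at_right 0)
     (\<lambda>t. L1_norm (frac_gradient \<alpha> \<sigma> (stable_semigroup \<alpha> \<mu> t (indicat_real E))))"

text \<open>In the two constants \<open>p\<close> is the density of the stable law and \<open>EY\<close> the first absolute moment of
  the one-dimensional stable variable.\<close>

definition const_frac :: "real \<Rightarrow> ('a::euclidean_space \<Rightarrow> real) \<Rightarrow> ennreal" where
  "const_frac \<alpha> p = (let d = real DIM('a) in
     ennreal ((1 / (2 * (\<alpha> - 1)) * (2 * d) powr ((\<alpha> - 1) / (d + \<alpha> - 1))
                 + (1 / (2 * d)) powr (d / (d + \<alpha> - 1))) powr ((d + \<alpha> - 1) / d)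
              * 2 powr ((\<alpha> - 1) / \<alpha>) * (SUP x. \<bar>p x\<bar>) powr ((\<alpha> - 1) / d))
     * L1_norm (gradient p))"

definition const_cl :: "real \<Rightarrow> ('a::euclidean_space \<Rightarrow> real) \<Rightarrow> real \<Rightarrow> ennreal" where
  "const_cl \<alpha> p EY = (let d = real DIM('a) in
     ennreal ((1 / 2 * (2 * d) powr (1 / (d + 1)) + 1 / (2 * d) powr (d / (d + 1))) powr ((d + 1) / d)
              * 2 powr (1 / \<alpha>) * (SUP x. \<bar>p x\<bar>) powr (1 / d) * EY))"

end

(*
The characteristic function of the stable law decays like exp (-c |xi|^alpha), so p and every
P_t 1_E are Fourier integrals: P_t 1_E has symbol exp (-t psi) times the transform of 1_E, where
psi = stable_norm^alpha.  The gradient and D^(alpha-1) act as vector multipliers, and the multiplier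
tau of the latter satisfies i <xi, tau xi> = - alpha psi xi, because
int_0^infinity sin r / r^alpha dr is alpha times the constant relating sigma to the spectral measure.
Hence P_(s+t) averages P_s against mu together with its two gradients, so by convexity both L^1 norms
decrease in t and each limit at 0+ dominates every value at positive time.

With f = P_epsilon 1_E one has
  |P_t f - f|_1 <= t^(1/alpha) E|Y| |stable_norm (grad f)|_1
by integrating along segments (<X, v> has the law of stable_norm v times Y), and
  |P_t f - f|_1 <= t^((alpha-1)/alpha) / (alpha - 1) |grad p|_1 |D^(alpha-1) f|_1
by integrating d/ds P_s f = (1/alpha) div D^(alpha-1) P_s f in time and moving the divergence onto the
kernel.  On the other hand, up to an error that vanishes with epsilon,
  |P_t f - f|_1 >= 2 (|E| - int_E P_t f) >= 2 (|E| - t^(-d/alpha) |p|_sup |E|^2),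
and optimising over t gives both inequalities, even without the factors 2^((alpha-1)/alpha) and
2^(1/alpha).
*)

theory Submission
  imports Defs
begin

subsection \<open>Affine changes of variables\<close>

text \<open>Two obstacles shape the argument. An indicator function has no gradient, so every
  estimate is made for P_\<epsilon> 1_E with a bound independent of \<epsilon>, and \<epsilon> tends
  to 0 only in the integral of P_\<epsilon> 1_E over E, where continuity of translations suffices.
  Moreover the L^1 norm of \<nabla>p enters the first constant as an extended number. If it is
  finite, \<nabla>p can be transformed and convolved; if it is infinite, the claim is that infinity
  times the perimeter is infinite, and since 0 times infinity is 0 in \<open>ennreal\<close> this
  requires the perimeter to be positive.

  Convexity of the stable norm is obtained from probability: it is E|<X, v>| divided by E|Y|, a
  mixture of moduli of linear forms. The multiplier of D^(\<alpha>-1) is never computed; a linear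
  growth bound, continuity, reflection symmetry and its component along \<xi> are enough. The factor
  2 in the lower bound comes from testing P_\<epsilon> 1_E - P_(\<epsilon>+t) 1_E against 2 1_E - 1,
  which has modulus one, using that the semigroup preserves mass.\<close>

lemma nn_integral_lborel_affine:
  fixes t :: "'a::euclidean_space"
  assumes [measurable]: "f \<in> borel_measurable borel" and "c \<noteq> 0"
  shows "(\<integral>\<^sup>+x. f x \<partial>lborel) = ennreal (\<bar>c\<bar> ^ DIM('a)) * (\<integral>\<^sup>+x. f (t + c *\<^sub>R x) \<partial>lborel)"
  by (subst lborel_affine[OF \<open>c \<noteq> 0\<close>, of t])
     (simp add: nn_integral_density nn_integral_distr nn_integral_cmult)

lemma integral_lborel_affine:
  fixes t :: "'a::euclidean_space" and f :: "'a \<Rightarrow> 'b::{banach, second_countable_topology}"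
  assumes [measurable]: "f \<in> borel_measurable borel" and "c \<noteq> 0"
  shows "(\<integral>x. f x \<partial>lborel) = (\<bar>c\<bar> ^ DIM('a)) *\<^sub>R (\<integral>x. f (t + c *\<^sub>R x) \<partial>lborel)"
  by (subst lborel_affine[OF \<open>c \<noteq> 0\<close>, of t])
     (simp add: integral_density integral_distr)

lemma integrable_lborel_affine:
  fixes t :: "'a::euclidean_space" and f :: "'a \<Rightarrow> 'b::{banach, second_countable_topology}"
  assumes "integrable lborel f" and "c \<noteq> 0"
  shows "integrable lborel (\<lambda>x. f (t + c *\<^sub>R x))"
proof -
  have [measurable]: "f \<in> borel_measurable borel"
    using assms(1) by auto
  have "integrable (density (distr lborel borel (\<lambda>x. t + c *\<^sub>R x)) (\<lambda>_. \<bar>c\<bar>^DIM('a))) f"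
    using assms(1) by (subst lborel_affine[OF \<open>c \<noteq> 0\<close>, of t, symmetric])
  then have "integrable lborel (\<lambda>x. \<bar>c\<bar>^DIM('a) *\<^sub>R f (t + c *\<^sub>R x))"
    by (simp add: integrable_density integrable_distr_eq)
  from integrable_scaleR_right[OF this, of "1 / \<bar>c\<bar>^DIM('a)"] show ?thesis
    using \<open>c \<noteq> 0\<close> by simp
qed

lemma nn_integral_lborel_translate:
  fixes t :: "'a::euclidean_space"
  assumes "f \<in> borel_measurable borel"
  shows "(\<integral>\<^sup>+x. f (x + t) \<partial>lborel) = (\<integral>\<^sup>+x. f x \<partial>lborel)"
  using nn_integral_lborel_affine[OF assms, of 1 t] by (simp add: add.commute)

lemma integral_lborel_translate:
  fixes t :: "'a::euclidean_space" and f :: "'a \<Rightarrow> 'b::{banach, second_countable_topology}"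
  assumes "f \<in> borel_measurable borel"
  shows "(\<integral>x. f (x + t) \<partial>lborel) = (\<integral>x. f x \<partial>lborel)"
  using integral_lborel_affine[OF assms, of 1 t] by (simp add: add.commute)

lemma integrable_lborel_translate:
  fixes t :: "'a::euclidean_space" and f :: "'a \<Rightarrow> 'b::{banach, second_countable_topology}"
  assumes "integrable lborel f"
  shows "integrable lborel (\<lambda>x. f (x + t))"
  using integrable_lborel_affine[OF assms, of 1 t] by (simp add: add.commute)

subsection \<open>The Fourier transform and its inversion\<close>

text \<open>Sign and normalisation are chosen so that the transform of a density is its
  characteristic function; the factor (2 pi)^(-d) and a reflection then sit in the inversion
  formula.\<close>

definition fourier :: "('a::euclidean_space \<Rightarrow> complex) \<Rightarrow> 'a \<Rightarrow> complex" where
  "fourier m x = (CLINT \<xi>|lborel. iexp (x \<bullet> \<xi>) * m \<xi>)"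

lemma integrable_iexp_mult:
  assumes "integrable M m" and "g \<in> borel_measurable M"
  shows "integrable M (\<lambda>\<xi>. iexp (g \<xi>) * m \<xi> :: complex)"
proof -
  have [measurable]: "m \<in> borel_measurable M" "g \<in> borel_measurable M" using assms by auto
  show ?thesis
    by (rule Bochner_Integration.integrable_bound[OF assms(1)]) (auto simp: norm_mult)
qed

lemma (in pair_sigma_finite) integrable_pair_mult:
  fixes f :: "'a \<Rightarrow> real" and g :: "'b \<Rightarrow> real"
  assumes "integrable M1 f" and "integrable M2 g"
  shows "integrable (M1 \<Otimes>\<^sub>M M2) (\<lambda>(x, y). f x * g y)"
proof -
  have [measurable]: "f \<in> borel_measurable M1" "g \<in> borel_measurable M2" using assms by auto
  show ?thesis
    using assms by (intro Fubini_integrable) (auto simp: abs_mult)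
qed

lemma borel_measurable_fourier [measurable]:
  assumes [measurable]: "m \<in> borel_measurable borel"
  shows "fourier m \<in> borel_measurable borel"
  unfolding fourier_def by measurable

lemma norm_fourier_le:
  assumes "integrable lborel m"
  shows "norm (fourier m x) \<le> (\<integral>\<xi>. norm (m \<xi>) \<partial>lborel)"
  unfolding fourier_def
  by (rule order_trans[OF integral_norm_bound]) (simp add: norm_mult)

lemma continuous_fourier:
  assumes "integrable lborel m"
  shows "continuous_on UNIV (fourier m)"
proof -
  have "isCont (fourier m) x" for x
  proof -
    have [measurable]: "m \<in> borel_measurable borel" using assms by auto
    have "(\<lambda>y. CLINT \<xi>|lborel. iexp (y \<bullet> \<xi>) * m \<xi>) \<midarrow>x\<rightarrow> (CLINT \<xi>|lborel. iexp (x \<bullet> \<xi>) * m \<xi>)"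
      unfolding tendsto_at_iff_sequentially comp_def
    proof (intro allI impI)
      fix X :: "nat \<Rightarrow> 'a" assume X: "X \<longlonglongrightarrow> x"
      show "(\<lambda>n. CLINT \<xi>|lborel. iexp (X n \<bullet> \<xi>) * m \<xi>) \<longlonglongrightarrow> (CLINT \<xi>|lborel. iexp (x \<bullet> \<xi>) * m \<xi>)"
        by (rule integral_dominated_convergence[where w="\<lambda>\<xi>. norm (m \<xi>)"])
           (use assms in \<open>auto intro!: tendsto_intros X AE_I2 simp: norm_mult\<close>)
    qed
    then show ?thesis unfolding isCont_def fourier_def .
  qed
  then show ?thesis by (simp add: continuous_at_imp_continuous_on)
qed

section \<open>Gaussian regularisation and Fourier inversion\<close>

definition gauss :: "'a::euclidean_space \<Rightarrow> real" where
  "gauss x = exp (- (norm x)\<^sup>2 / 2)"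

lemma gauss_prod: "gauss (x::'a::euclidean_space) = (\<Prod>b\<in>Basis. exp (- (x \<bullet> b)\<^sup>2 / 2))"
proof -
  have "(norm x)\<^sup>2 = (\<Sum>b\<in>Basis. (x \<bullet> b)\<^sup>2)"
    unfolding power2_norm_eq_inner euclidean_inner[of x x] by (simp add: power2_eq_square)
  then show ?thesis
    by (simp add: gauss_def exp_sum[symmetric] sum_negf sum_divide_distrib)
qed

lemma borel_measurable_gauss [measurable]: "gauss \<in> borel_measurable borel"
  unfolding gauss_def by measurable

lemma gauss_pos: "0 < gauss x" and gauss_le_1: "gauss x \<le> 1"
  by (auto simp: gauss_def)

text \<open>Both facts are those known for the standard normal law, with the normalisation
  \<open>1 / sqrt (2 * pi)\<close> removed.\<close>

lemma gauss_1d: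
  shows "integrable lborel (\<lambda>x::real. exp (- x\<^sup>2 / 2))"
    and "(CLBINT x. iexp (t * x) * complex_of_real (exp (- x\<^sup>2 / 2))) = complex_of_real (sqrt (2 * pi) * exp (- t\<^sup>2 / 2))"
proof -
  have i: "integrable lborel std_normal_density"
    by (rule integrable_normal_density) simp
  have s: "std_normal_density x = exp (- x\<^sup>2 / 2) / sqrt (2 * pi)" for x
    by (simp add: normal_density_def)
  show "integrable lborel (\<lambda>x::real. exp (- x\<^sup>2 / 2))"
    using integrable_mult_right[OF i, of "sqrt (2*pi)"] by (simp add: s)
  have "complex_of_real (exp (- t\<^sup>2 / 2)) = (CLINT x|density lborel (\<lambda>x. ennreal (std_normal_density x)). iexp (t * x))"
    using char_std_normal_distribution[THEN fun_cong, of t] by (simp add: char_def)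
  also have "\<dots> = (CLBINT x. std_normal_density x *\<^sub>R iexp (t * x))"
    by (rule integral_density) auto
  also have "\<dots> = (CLBINT x. (1 / sqrt (2*pi)) * (iexp (t * x) * complex_of_real (exp (- x\<^sup>2 / 2))))"
    by (intro Bochner_Integration.integral_cong) (auto simp: s scaleR_conv_of_real)
  also have "\<dots> = (1 / sqrt (2*pi)) * (CLBINT x. iexp (t * x) * complex_of_real (exp (- x\<^sup>2 / 2)))"
    by (rule integral_mult_right_zero)
  finally show "(CLBINT x. iexp (t * x) * complex_of_real (exp (- x\<^sup>2 / 2))) = complex_of_real (sqrt (2 * pi) * exp (- t\<^sup>2 / 2))"
    by (simp add: field_simps)
qed

text \<open>Lebesgue measure is the image of the product of its coordinate measures, so products
  over the basis factor.\<close>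

lemma
  fixes f :: "'a::euclidean_space \<Rightarrow> real \<Rightarrow> 'c::{real_normed_field,banach,second_countable_topology}"
  assumes int: "\<And>b. b \<in> Basis \<Longrightarrow> integrable lborel (f b)"
  shows integrable_lborel_prod: "integrable lborel (\<lambda>x. \<Prod>b\<in>Basis. f b (x \<bullet> b))" (is ?A)
    and integral_lborel_prod: "(\<integral>x. (\<Prod>b\<in>Basis. f b (x \<bullet> b)) \<partial>lborel) = (\<Prod>b\<in>Basis. (\<integral>x. f b x \<partial>lborel))" (is ?B)
proof -
  interpret product_sigma_finite "\<lambda>_::'a. lborel :: real measure" ..
  have [measurable]: "\<And>b. b \<in> Basis \<Longrightarrow> f b \<in> borel_measurable borel" using int by auto
  show ?A
    by (subst lborel_eq, subst integrable_distr_eq)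
       (auto intro!: product_integrable_prod int)
  show ?B
    by (subst lborel_eq, subst integral_distr)
       (auto intro!: product_integral_prod int)
qed

lemma integrable_gauss: "integrable lborel (gauss :: 'a::euclidean_space \<Rightarrow> real)"
  unfolding gauss_prod[abs_def] by (rule integrable_lborel_prod) (rule gauss_1d)

lemma fourier_gauss:
  fixes w :: "'a::euclidean_space"
  shows "fourier (\<lambda>x. complex_of_real (gauss x)) w = complex_of_real (sqrt (2 * pi) ^ DIM('a) * gauss w)"
proof -
  have "fourier (\<lambda>x. complex_of_real (gauss x)) w =
      (CLINT x|lborel. (\<Prod>b\<in>Basis. iexp ((w \<bullet> b) * (x \<bullet> b)) * complex_of_real (exp (- (x \<bullet> b)\<^sup>2 / 2))))"
    unfolding fourier_def
  proof (intro Bochner_Integration.integral_cong refl)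
    fix x
    have "iexp (w \<bullet> x) = (\<Prod>b\<in>Basis. iexp ((w \<bullet> b) * (x \<bullet> b)))"
      by (simp add: euclidean_inner[of w x] sum_distrib_left exp_sum[symmetric])
    then show "iexp (w \<bullet> x) * complex_of_real (gauss x) =
       (\<Prod>b\<in>Basis. iexp ((w \<bullet> b) * (x \<bullet> b)) * complex_of_real (exp (- (x \<bullet> b)\<^sup>2 / 2)))"
      by (simp add: gauss_prod prod.distrib)
  qed
  also have "\<dots> = (\<Prod>b\<in>Basis. CLBINT x. iexp ((w \<bullet> b) * x) * complex_of_real (exp (- x\<^sup>2 / 2)))"
    by (rule integral_lborel_prod[where f="\<lambda>b x. iexp ((w \<bullet> b) * x) * complex_of_real (exp (- x\<^sup>2 / 2))"])
       (intro integrable_iexp_mult integrable_of_real gauss_1d, simp)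
  also have "\<dots> = complex_of_real (sqrt (2 * pi) ^ DIM('a) * gauss w)"
    unfolding gauss_1d(2) by (simp add: gauss_prod prod.distrib)
  finally show ?thesis .
qed

lemma integral_gauss: "(\<integral>x. gauss (x::'a::euclidean_space) \<partial>lborel) = sqrt (2 * pi) ^ DIM('a)"
proof -
  have "complex_of_real (\<integral>x. gauss (x::'a) \<partial>lborel) = fourier (\<lambda>x. complex_of_real (gauss x)) (0::'a)"
    by (simp add: fourier_def)
  also have "\<dots> = complex_of_real (sqrt (2 * pi) ^ DIM('a))"
    by (subst fourier_gauss) (simp add: gauss_def)
  finally show ?thesis by (rule of_real_eq_iff[THEN iffD1])
qed

text \<open>The Gaussian factor makes the double integral absolutely convergent. After exchanging
  the integrals the inner one is again a Gaussian, concentrated at \<eta> on the scale \<delta>, and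
  \<xi> = \<eta> + \<delta> z turns the outer one into a Gaussian average of
  \<open>h\<close>.\<close>

lemma fourier_regularised:
  fixes h :: "'a::euclidean_space \<Rightarrow> complex"
  assumes h: "integrable lborel h" and \<delta>: "0 < \<delta>"
  shows "fourier (\<lambda>x. fourier h x * gauss (\<delta> *\<^sub>R x)) (- \<eta>) =
    sqrt (2 * pi) ^ DIM('a) * (CLINT z|lborel. h (\<eta> + \<delta> *\<^sub>R z) * gauss z)"
proof -
  have [measurable]: "h \<in> borel_measurable borel" using h by auto
  let ?K = "\<lambda>x \<xi>. iexp (x \<bullet> (\<xi> - \<eta>)) * (h \<xi> * complex_of_real (gauss (\<delta> *\<^sub>R x)))"
  have g: "integrable lborel (\<lambda>x::'a. gauss (\<delta> *\<^sub>R x))"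
    using integrable_lborel_affine[OF integrable_gauss, of \<delta> 0] \<delta> by simp
  have int: "integrable (lborel \<Otimes>\<^sub>M lborel) (\<lambda>(x, \<xi>). ?K x \<xi>)"
  proof (rule Bochner_Integration.integrable_bound)
    show "integrable (lborel \<Otimes>\<^sub>M lborel) (\<lambda>(x :: 'a, \<xi>). gauss (\<delta> *\<^sub>R x) * norm (h \<xi>))"
      by (rule lborel_pair.integrable_pair_mult[OF g integrable_norm[OF h]])
  qed (auto intro!: AE_I2 simp: norm_mult abs_mult abs_of_pos[OF gauss_pos])
  have "fourier (\<lambda>x. fourier h x * gauss (\<delta> *\<^sub>R x)) (- \<eta>) = (CLINT x|lborel. CLINT \<xi>|lborel. ?K x \<xi>)"
    unfolding fourier_def[of "\<lambda>x. fourier h x * _ x"]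
  proof (intro Bochner_Integration.integral_cong refl)
    fix x
    have "iexp (- \<eta> \<bullet> x) * (fourier h x * gauss (\<delta> *\<^sub>R x)) =
        (iexp (- \<eta> \<bullet> x) * gauss (\<delta> *\<^sub>R x)) * (CLINT \<xi>|lborel. iexp (x \<bullet> \<xi>) * h \<xi>)"
      by (simp add: fourier_def)
    also have "\<dots> = (CLINT \<xi>|lborel. (iexp (- \<eta> \<bullet> x) * gauss (\<delta> *\<^sub>R x)) * (iexp (x \<bullet> \<xi>) * h \<xi>))"
      by (rule integral_mult_right_zero[symmetric])
    also have "\<dots> = (CLINT \<xi>|lborel. ?K x \<xi>)"
      by (intro Bochner_Integration.integral_cong refl)
         (simp add: inner_diff_right right_diff_distrib exp_diff exp_minus inner_commute divide_inverse)
    finally show "iexp (- \<eta> \<bullet> x) * (fourier h x * gauss (\<delta> *\<^sub>R x)) = (CLINT \<xi>|lborel. ?K x \<xi>)" .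
  qed
  also have "\<dots> = (CLINT \<xi>|lborel. CLINT x|lborel. ?K x \<xi>)"
    by (rule lborel_pair.Fubini_integral[symmetric]) (rule int)
  also have "\<dots> = (CLINT \<xi>|lborel. (1 / \<delta> ^ DIM('a) * sqrt (2 * pi) ^ DIM('a)) * (h \<xi> * gauss ((1 / \<delta>) *\<^sub>R (\<xi> - \<eta>))))"
  proof (intro Bochner_Integration.integral_cong refl)
    fix \<xi>
    have "(CLINT x|lborel. ?K x \<xi>) = (1 / \<delta> ^ DIM('a)) *\<^sub>R (CLINT x|lborel. ?K ((1 / \<delta>) *\<^sub>R x) \<xi>)"
      using \<delta> by (subst integral_lborel_affine[of _ "1/\<delta>" 0]) (auto simp: power_one_over)
    also have "(CLINT x|lborel. ?K ((1 / \<delta>) *\<^sub>R x) \<xi>) =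
       (CLINT x|lborel. h \<xi> * (iexp ((1 / \<delta>) *\<^sub>R (\<xi> - \<eta>) \<bullet> x) * gauss x))"
      using \<delta> by (intro Bochner_Integration.integral_cong) (auto simp: inner_commute)
    also have "\<dots> = h \<xi> * fourier (\<lambda>x. complex_of_real (gauss x)) ((1 / \<delta>) *\<^sub>R (\<xi> - \<eta>))"
      unfolding fourier_def by (rule integral_mult_right_zero)
    finally show "(CLINT x|lborel. ?K x \<xi>) =
      (1 / \<delta> ^ DIM('a) * sqrt (2 * pi) ^ DIM('a)) * (h \<xi> * gauss ((1 / \<delta>) *\<^sub>R (\<xi> - \<eta>)))"
      by (simp add: fourier_gauss scaleR_conv_of_real)
  qed
  also have "\<dots> = (1 / \<delta> ^ DIM('a) * sqrt (2 * pi) ^ DIM('a)) * (CLINT \<xi>|lborel. h \<xi> * gauss ((1 / \<delta>) *\<^sub>R (\<xi> - \<eta>)))"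
    by (rule integral_mult_right_zero)
  also have "(CLINT \<xi>|lborel. h \<xi> * gauss ((1 / \<delta>) *\<^sub>R (\<xi> - \<eta>))) =
     \<delta> ^ DIM('a) *\<^sub>R (CLINT z|lborel. h (\<eta> + \<delta> *\<^sub>R z) * gauss z)"
    using \<delta> by (subst integral_lborel_affine[of _ \<delta> \<eta>]) auto
  finally show ?thesis
    using \<delta> by (simp add: scaleR_conv_of_real)
qed

text \<open>Only the transform side passes to the limit here, dominated by
  \<open>norm (fourier h \<xi>)\<close>. What the Gaussian averages of \<open>h\<close> do depends
  on the regularity of \<open>h\<close> and is settled in the inversion theorems.\<close>

lemma fourier_regularised_tendsto:
  fixes h :: "'a::euclidean_space \<Rightarrow> complex"
  assumes "integrable lborel h" and "integrable lborel (fourier h)"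
  shows "(\<lambda>n. CLINT z|lborel. h (\<eta> + (1 / Suc n) *\<^sub>R z) * gauss z) \<longlonglongrightarrow>
    fourier (fourier h) (- \<eta>) / sqrt (2 * pi) ^ DIM('a)"
proof -
  have [measurable]: "h \<in> borel_measurable borel" using assms by auto
  have "(\<lambda>n. fourier (\<lambda>x. fourier h x * gauss ((1 / Suc n) *\<^sub>R x)) (- \<eta>)) \<longlonglongrightarrow> fourier (fourier h) (- \<eta>)"
    unfolding fourier_def[of "fourier h"] fourier_def[of "\<lambda>x. fourier h x * _ x"]
  proof (rule integral_dominated_convergence[where w="\<lambda>\<xi>. norm (fourier h \<xi>)"])
    show "AE x in lborel. (\<lambda>n. iexp (- \<eta> \<bullet> x) * (fourier h x * complex_of_real (gauss ((1 / real (Suc n)) *\<^sub>R x))))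
        \<longlonglongrightarrow> iexp (- \<eta> \<bullet> x) * fourier h x"
    proof (rule AE_I2)
      fix x :: 'a
      have "(\<lambda>n. gauss ((1 / real (Suc n)) *\<^sub>R x)) \<longlonglongrightarrow> exp (- (norm (0 *\<^sub>R x))\<^sup>2 / 2)"
        unfolding gauss_def by (intro tendsto_intros LIMSEQ_Suc[OF lim_1_over_n]) simp
      from tendsto_mult[OF tendsto_const tendsto_mult[OF tendsto_const tendsto_of_real[OF this]], of "iexp (- \<eta> \<bullet> x)" "fourier h x"]
      show "(\<lambda>n. iexp (- \<eta> \<bullet> x) * (fourier h x * complex_of_real (gauss ((1 / real (Suc n)) *\<^sub>R x))))
        \<longlonglongrightarrow> iexp (- \<eta> \<bullet> x) * fourier h x" by simp
    qed
    show "AE x in lborel. norm (iexp (- \<eta> \<bullet> x) * (fourier h x * complex_of_real (gauss ((1 / real (Suc n)) *\<^sub>R x)))) \<le> norm (fourier h x)" for n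
      by (auto simp: norm_mult abs_of_pos[OF gauss_pos] intro!: mult_left_le gauss_le_1)
  qed (use assms in auto)
  then have "(\<lambda>n. sqrt (2 * pi) ^ DIM('a) * (CLINT z|lborel. h (\<eta> + (1 / Suc n) *\<^sub>R z) * gauss z)) \<longlonglongrightarrow> fourier (fourier h) (- \<eta>)"
    by (subst (asm) fourier_regularised[OF assms(1)]) auto
  moreover have "complex_of_real (sqrt (2 * pi) ^ DIM('a)) \<noteq> 0"
    by (simp del: of_real_power)
  ultimately show ?thesis
    by (auto dest: tendsto_divide[OF _ tendsto_const[of "complex_of_real (sqrt (2 * pi) ^ DIM('a))"]] simp del: of_real_power)
qed

lemma sqrt_2pi_power2: "sqrt (2 * pi) ^ n * sqrt (2 * pi) ^ n = (2 * pi) ^ n"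
  by (subst power_mult_distrib[symmetric]) simp

text \<open>Continuity at \<eta> and the majorant \<open>B * gauss z\<close> identify the limit of
  the Gaussian averages as \<open>h \<eta>\<close> times the Gaussian mass. That mass and the
  constant from the transform side are the two factors that make up (2 pi)^d.\<close>

theorem fourier_inversion_bounded:
  fixes h :: "'a::euclidean_space \<Rightarrow> complex"
  assumes h: "integrable lborel h" "integrable lborel (fourier h)"
    and cont: "isCont h \<eta>" and bd: "\<And>x. norm (h x) \<le> B"
  shows "h \<eta> = fourier (fourier h) (- \<eta>) / (2 * pi) ^ DIM('a)"
proof -
  have [measurable]: "h \<in> borel_measurable borel" using assms by auto
  have "(\<lambda>n. CLINT z|lborel. h (\<eta> + (1 / Suc n) *\<^sub>R z) * gauss z) \<longlonglongrightarrow> (CLINT z|lborel. h \<eta> * gauss (z::'a))"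
  proof (rule integral_dominated_convergence[where w="\<lambda>z. B * gauss z"])
    show "AE z in lborel. (\<lambda>n. h (\<eta> + (1 / real (Suc n)) *\<^sub>R z) * gauss z) \<longlonglongrightarrow> h \<eta> * gauss z"
    proof (rule AE_I2)
      fix z
      have "(\<lambda>n. \<eta> + (1 / real (Suc n)) *\<^sub>R z) \<longlonglongrightarrow> \<eta> + 0 *\<^sub>R z"
        by (intro tendsto_intros LIMSEQ_Suc[OF lim_1_over_n])
      then have "(\<lambda>n. h (\<eta> + (1 / real (Suc n)) *\<^sub>R z)) \<longlonglongrightarrow> h \<eta>"
        using isCont_tendsto_compose[OF cont] by simp
      then show "(\<lambda>n. h (\<eta> + (1 / real (Suc n)) *\<^sub>R z) * gauss z) \<longlonglongrightarrow> h \<eta> * gauss z"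
        by (intro tendsto_intros)
    qed
    show "AE z in lborel. norm (h (\<eta> + (1 / real (Suc n)) *\<^sub>R z) * complex_of_real (gauss z)) \<le> B * gauss z" for n
      by (auto simp: norm_mult abs_of_pos[OF gauss_pos] intro!: mult_right_mono bd less_imp_le[OF gauss_pos])
  qed (use integrable_gauss in auto)
  from LIMSEQ_unique[OF this fourier_regularised_tendsto[OF h]]
  have "h \<eta> * sqrt (2 * pi) ^ DIM('a) = fourier (fourier h) (- \<eta>) / sqrt (2 * pi) ^ DIM('a)"
    by (simp only: integral_mult_right_zero integral_complex_of_real integral_gauss)
  then have "h \<eta> * (sqrt (2 * pi) ^ DIM('a) * sqrt (2 * pi) ^ DIM('a)) = fourier (fourier h) (- \<eta>)"
    by (simp add: field_simps)
  then have "h \<eta> * (2 * pi) ^ DIM('a) = fourier (fourier h) (- \<eta>)"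
    by (metis sqrt_2pi_power2 of_real_mult)
  then show ?thesis by (simp add: field_simps)
qed

text \<open>For a continuous density, Fatou's lemma along the Gaussian regularisations yields the
  a priori bound that the inversion theorem needs.\<close>

theorem fourier_inversion_density:
  fixes p :: "'a::euclidean_space \<Rightarrow> real"
  assumes int: "integrable lborel p" "integrable lborel (fourier (\<lambda>x. complex_of_real (p x)))"
    and cont: "continuous_on UNIV p" and nn: "\<And>x. 0 \<le> p x"
  shows "complex_of_real (p \<eta>) = fourier (fourier (\<lambda>x. complex_of_real (p x))) (- \<eta>) / (2 * pi) ^ DIM('a)"
    and "bdd_above (range p)"
proof -
  let ?h = "\<lambda>x. complex_of_real (p x)"
  let ?B = "(\<integral>x. norm (fourier ?h x) \<partial>lborel) / sqrt (2 * pi) ^ DIM('a)"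
  have [measurable]: "p \<in> borel_measurable borel" using int by auto
  have h: "integrable lborel ?h" using int by auto
  have p: "isCont p x" for x using cont by (simp add: continuous_on_eq_continuous_at)
  \<comment> \<open>The averages \<open>?I n\<close> are nonnegative, so their limit equals its own
    modulus, which is at most the L^1 norm of the transform up to the constant; Fatou carries this
    bound to \<open>p \<eta>\<close>.\<close>
  have le: "p \<eta> * sqrt (2 * pi) ^ DIM('a) \<le> ?B" for \<eta>
  proof -
    let ?I = "\<lambda>n. \<integral>z. p (\<eta> + (1 / Suc n) *\<^sub>R z) * gauss z \<partial>lborel"
    have "(\<lambda>n. complex_of_real (?I n)) \<longlonglongrightarrow> fourier (fourier ?h) (- \<eta>) / sqrt (2 * pi) ^ DIM('a)"
      using fourier_regularised_tendsto[OF h int(2), of \<eta>]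
      by (simp only: of_real_mult[symmetric] integral_complex_of_real)
    from tendsto_norm[OF this]
    have lim: "?I \<longlonglongrightarrow> norm (fourier (fourier ?h) (- \<eta>)) / sqrt (2 * pi) ^ DIM('a)"
    proof -
      have "0 \<le> ?I n" for n
        by (intro integral_nonneg_AE AE_I2 mult_nonneg_nonneg nn less_imp_le[OF gauss_pos])
      then have "norm (complex_of_real (?I n)) = ?I n" for n
        by (simp only: norm_of_real abs_of_nonneg)
      then show ?thesis
        using \<open>(\<lambda>n. norm (complex_of_real (?I n))) \<longlonglongrightarrow> _\<close>
        by (simp add: norm_divide norm_power del: of_real_mult integral_complex_of_real)
    qed
    have I: "integrable lborel (\<lambda>z. p (\<eta> + (1 / Suc n) *\<^sub>R z) * gauss z)" for n
      using integrable_lborel_affine[OF int(1), of "1 / Suc n" \<eta>]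
      by (rule Bochner_Integration.integrable_bound)
         (auto simp: abs_mult nn abs_of_pos[OF gauss_pos] intro!: mult_left_le gauss_le_1)
    have "ennreal (p \<eta> * sqrt (2 * pi) ^ DIM('a)) = (\<integral>\<^sup>+z. ennreal (p \<eta> * gauss (z::'a)) \<partial>lborel)"
      using integrable_gauss
      by (subst nn_integral_eq_integral) (auto simp: integral_gauss nn less_imp_le[OF gauss_pos])
    also have "\<dots> = (\<integral>\<^sup>+z. liminf (\<lambda>n. ennreal (p (\<eta> + (1 / Suc n) *\<^sub>R z) * gauss (z::'a))) \<partial>lborel)"
    proof (intro nn_integral_cong)
      fix z :: 'a
      have "(\<lambda>n. \<eta> + (1 / real (Suc n)) *\<^sub>R z) \<longlonglongrightarrow> \<eta> + 0 *\<^sub>R z"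
        by (intro tendsto_intros LIMSEQ_Suc[OF lim_1_over_n])
      then have "(\<lambda>n. p (\<eta> + (1 / real (Suc n)) *\<^sub>R z)) \<longlonglongrightarrow> p \<eta>"
        using isCont_tendsto_compose[OF p] by simp
      then have "(\<lambda>n. ennreal (p (\<eta> + (1 / Suc n) *\<^sub>R z) * gauss z)) \<longlonglongrightarrow> ennreal (p \<eta> * gauss z)"
        by (intro tendsto_intros tendsto_ennrealI)
      then show "ennreal (p \<eta> * gauss z) = liminf (\<lambda>n. ennreal (p (\<eta> + (1 / Suc n) *\<^sub>R z) * gauss z))"
        by (simp add: lim_imp_Liminf)
    qed
    also have "\<dots> \<le> liminf (\<lambda>n. \<integral>\<^sup>+z. ennreal (p (\<eta> + (1 / Suc n) *\<^sub>R z) * gauss z) \<partial>lborel)"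
      by (rule nn_integral_liminf) auto
    also have "\<dots> = liminf (\<lambda>n. ennreal (?I n))"
      by (subst nn_integral_eq_integral[OF I]) (auto simp: nn less_imp_le[OF gauss_pos])
    also have "\<dots> = ennreal (norm (fourier (fourier ?h) (- \<eta>)) / sqrt (2 * pi) ^ DIM('a))"
      by (intro lim_imp_Liminf tendsto_ennrealI lim) simp
    also have "\<dots> \<le> ennreal ?B"
      by (intro ennreal_leI divide_right_mono norm_fourier_le int) auto
    finally show ?thesis
      by (subst (asm) ennreal_le_iff) (auto intro!: divide_nonneg_nonneg integral_nonneg_AE)
  qed
  then have bd: "p x \<le> ?B / sqrt (2 * pi) ^ DIM('a)" for x
    using le[of x] by (subst pos_le_divide_eq) auto
  then show "bdd_above (range p)" by (rule bdd_aboveI2)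
  show "complex_of_real (p \<eta>) = fourier (fourier ?h) (- \<eta>) / (2 * pi) ^ DIM('a)"
    by (rule fourier_inversion_bounded[OF h int(2)])
       (use bd nn p in \<open>auto intro!: continuous_intros\<close>)
qed

subsection \<open>Integrals over the half-line\<close>

lemma set_integrable_powr_0_1:
  assumes "- 1 < (a::real)" shows "set_integrable lborel {0<..1} (\<lambda>r. r powr a)"
proof -
  have "(\<lambda>r. r powr a) absolutely_integrable_on {0..1}"
    using has_integral_powr_from_0[OF assms, of 1] by (intro nonnegative_absolutely_integrable_1) auto
  then have "(\<lambda>r. r powr a) absolutely_integrable_on {0<..1}"
    by (rule set_integrable_subset) auto
  then show ?thesis
    by (simp add: set_integrable_def integrable_completion)
qed

lemma set_integrable_powr_1_inf:
  assumes "(a::real) < - 1" shows "set_integrable lborel {1<..} (\<lambda>r. r powr a)"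
proof -
  have "(\<lambda>r. r powr a) absolutely_integrable_on {1..}"
    using has_integral_powr_to_inf[OF assms, of 1] by (intro nonnegative_absolutely_integrable_1) auto
  then have "(\<lambda>r. r powr a) absolutely_integrable_on {1<..}"
    by (rule set_integrable_subset) auto
  then show ?thesis
    by (simp add: set_integrable_def integrable_completion)
qed

text \<open>Comparison with one power near 0 and another at infinity; it serves the sine integral,
  the moment of Y and the Levy measure.\<close>

lemma set_integrable_half_line:
  fixes f :: "real \<Rightarrow> real"
  assumes [measurable]: "f \<in> borel_measurable borel" and "- 1 < a" "b < - 1"
    and near: "\<And>r. 0 < r \<Longrightarrow> r \<le> 1 \<Longrightarrow> \<bar>f r\<bar> \<le> K * r powr a"
    and far: "\<And>r. 1 < r \<Longrightarrow> \<bar>f r\<bar> \<le> K * r powr b"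
  shows "set_integrable lborel {0<..} f"
proof -
  let ?g = "\<lambda>r. K * (indicator {0<..1} r *\<^sub>R r powr a) + K * (indicator {1<..} r *\<^sub>R r powr b)"
  have "integrable lborel ?g"
    using set_integrable_powr_0_1[OF assms(2)] set_integrable_powr_1_inf[OF assms(3)]
    by (auto simp: set_integrable_def)
  then show ?thesis
    unfolding set_integrable_def
  proof (rule Bochner_Integration.integrable_bound)
    show "AE r in lborel. norm (indicator {0<..} r *\<^sub>R f r) \<le> norm (?g r)"
    proof (rule AE_I2)
      fix r :: real
      consider "r \<le> 0" | "0 < r" "r \<le> 1" | "1 < r" by linarith
      then show "norm (indicator {0<..} r *\<^sub>R f r) \<le> norm (?g r)"
        by cases (use near[of r] far[of r] in \<open>auto simp: indicator_def\<close>)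
    qed
  qed auto
qed

text \<open>A rescaling of Euler's integral. Read backwards it represents s^(-a) as a mixture of
  exponentials, which is how the power of r is removed from the sine integral.\<close>

lemma Gamma_scaled:
  assumes "0 < (s::real)" "0 < (a::real)"
  shows "set_integrable lborel {0<..} (\<lambda>r. r powr (a - 1) * exp (- (r * s)))"
    and "(LINT r:{0<..}|lborel. r powr (a - 1) * exp (- (r * s))) = Gamma a * s powr (- a)"
proof -
  let ?f = "\<lambda>r. indicator {0<..} r * (r powr (a - 1) * exp (- r))"
  have nn: "(\<integral>\<^sup>+r. ennreal (?f r) \<partial>lborel) = ennreal (Gamma a)"
    unfolding Gamma_conv_nn_integral_real[OF assms(2)]
  proof (rule nn_integral_cong_AE)
    have "AE r in lborel. r \<noteq> (0::real)" by (rule AE_lborel_singleton)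
    then show "AE r in lborel. ennreal (?f r) = ennreal (indicator {0..} r * r powr (a - 1) / exp r)"
      by eventually_elim (auto simp: indicator_def exp_minus field_simps)
  qed
  have G: "0 \<le> Gamma a" using Gamma_real_pos[OF assms(2)] by simp
  have 1: "has_bochner_integral lborel ?f (Gamma a)"
    by (rule has_bochner_integral_nn_integral[OF _ _ G nn]) auto
  have "has_bochner_integral lborel (\<lambda>x. ?f (0 + s * x)) (Gamma a /\<^sub>R \<bar>s\<bar>)"
    using assms(1) by (intro lborel_has_bochner_integral_real_affine_iff[THEN iffD1, of s] 1) auto
  moreover have "?f (0 + s * x) = s powr (a - 1) * (indicator {0<..} x *\<^sub>R (x powr (a - 1) * exp (- (x * s))))" for x
    using assms(1) by (auto simp: indicator_def powr_mult zero_less_mult_iff mult_ac)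
  ultimately have "has_bochner_integral lborel
      (\<lambda>x. s powr (a - 1) * (indicator {0<..} x *\<^sub>R (x powr (a - 1) * exp (- (x * s))))) (Gamma a / s)"
    using assms(1) by (simp add: field_simps)
  from has_bochner_integral_mult_right[OF this, of "s powr (1 - a)"]
  have 2: "has_bochner_integral lborel
      (\<lambda>x. indicator {0<..} x *\<^sub>R (x powr (a - 1) * exp (- (x * s)))) (s powr (1 - a) * (Gamma a / s))"
    using assms(1) by (simp add: mult.assoc[symmetric] powr_add[symmetric])
  moreover have "s powr (1 - a) * (Gamma a / s) = Gamma a * s powr (- a)"
    using assms(1) by (simp add: powr_diff powr_minus field_simps)
  ultimately show "set_integrable lborel {0<..} (\<lambda>r. r powr (a - 1) * exp (- (r * s)))"
    and "(LINT r:{0<..}|lborel. r powr (a - 1) * exp (- (r * s))) = Gamma a * s powr (- a)"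
    by (auto simp: set_integrable_def set_lebesgue_integral_def has_bochner_integral_iff)
qed

section \<open>The sine integral and its Gamma constant\<close>

lemma laplace_sin:
  assumes "0 < (s::real)"
  shows "(LINT r:{0<..}|lborel. sin r * exp (- (r * s))) = 1 / (1 + s\<^sup>2)"
proof -
  let ?f = "\<lambda>r. sin r * exp (- (r * s))"
  let ?F = "\<lambda>r. - (exp (- (r * s)) * (s * sin r + cos r)) / (1 + s\<^sup>2)"
  have pos: "1 + s\<^sup>2 \<noteq> 0" by (metis add_pos_nonneg less_irrefl zero_le_power2 zero_less_one)
  have pos': "0 < 1 + s\<^sup>2" by (simp add: add_pos_nonneg)
  have e: "einterval 0 \<infinity> = {0::real<..}" by (auto simp: einterval_def)
  have int: "set_integrable lborel {0<..} ?f"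
    using Gamma_scaled(1)[OF assms, of 1] unfolding set_integrable_def
    by (rule Bochner_Integration.integrable_bound)
       (auto simp: abs_mult indicator_def intro!: mult_left_le_one_le)
  have "(LBINT r=0..\<infinity>. ?f r) = 0 - (- 1 / (1 + s\<^sup>2))"
  proof (rule interval_integral_FTC_integrable)
    fix x :: real
    have "(?F has_real_derivative ?f x) (at x)"
      using pos by (auto intro!: derivative_eq_intros simp: divide_simps)
                   (simp add: algebra_simps power2_eq_square)
    then show "(?F has_vector_derivative ?f x) (at x)"
      by (rule has_real_derivative_iff_has_vector_derivative[THEN iffD1])
    show "isCont ?f x" by (intro continuous_intros)
    show "set_integrable lborel (einterval 0 \<infinity>) ?f" unfolding e by (rule int)
    have "isCont ?F 0" using pos by (intro continuous_intros) auto
    then have "(?F \<longlongrightarrow> ?F 0) (at_right 0)"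
      by (auto simp: isCont_def intro: tendsto_within_subset[where S=UNIV])
    then show "((?F \<circ> real_of_ereal) \<longlongrightarrow> - 1 / (1 + s\<^sup>2)) (at_right 0)"
      unfolding zero_ereal_def by (subst ereal_tendsto_simps1) simp_all
    have "((\<lambda>r. exp (- (r * s))) \<longlongrightarrow> 0) at_top"
      using assms by real_asymp
    then have lim: "((\<lambda>r. (s + 1) * exp (- (r * s)) / (1 + s\<^sup>2)) \<longlongrightarrow> (s + 1) * 0 / (1 + s\<^sup>2)) at_top"
      using pos by (intro tendsto_intros)
    have "(?F \<longlongrightarrow> 0) at_top"
    proof (rule Lim_null_comparison[OF always_eventually])
      show "\<forall>r. norm (?F r) \<le> (s + 1) * exp (- (r * s)) / (1 + s\<^sup>2)"
      proof
        fix r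
        have "\<bar>s * sin r + cos r\<bar> \<le> s * 1 + 1"
          using assms by (intro order_trans[OF abs_triangle_ineq] add_mono)
            (auto simp: abs_mult intro!: mult_left_le)
        then have "\<bar>s * sin r + cos r\<bar> * exp (- (r * s)) \<le> (s + 1) * exp (- (r * s))"
          by (intro mult_right_mono) auto
        then show "norm (?F r) \<le> (s + 1) * exp (- (r * s)) / (1 + s\<^sup>2)"
          using pos' by (simp add: abs_mult mult.commute divide_right_mono)
      qed
    qed (use lim in simp)
    then show "((?F \<circ> real_of_ereal) \<longlongrightarrow> 0) (at_left \<infinity>)"
      by (subst ereal_tendsto_simps1) simp_all
  qed simp
  then show ?thesis
    unfolding zero_ereal_def interval_integral_to_infinity_eq by simp
qed

lemma Gamma_reflection_real: "Gamma x * Gamma (1 - x) = pi / sin (pi * x)" for x :: real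
proof -
  have "complex_of_real (Gamma x * Gamma (1 - x)) = complex_of_real (pi / sin (pi * x))"
    using Gamma_reflection_complex[of "complex_of_real x"]
    by (simp add: Gamma_complex_of_real[symmetric] sin_of_real[symmetric])
  then show ?thesis by (simp only: of_real_eq_iff)
qed

text \<open>The substitution x = s^2 / (1 + s^2) gives half of the Beta integral at \<alpha>/2 and 1
  - \<alpha>/2, which the reflection formula evaluates.\<close>

lemma beta_half_line:
  assumes "0 < (\<alpha>::real)" "\<alpha> < 2"
  shows "set_integrable lborel {0<..} (\<lambda>s. s powr (\<alpha> - 1) / (1 + s\<^sup>2))"
    and "(LINT s:{0<..}|lborel. s powr (\<alpha> - 1) / (1 + s\<^sup>2)) = pi / (2 * sin (pi * \<alpha> / 2))"
proof -
  let ?a = "\<alpha> / 2" and ?b = "1 - \<alpha> / 2"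
  let ?g = "\<lambda>s::real. s\<^sup>2 / (1 + s\<^sup>2)"
  let ?g' = "\<lambda>s::real. 2 * s / (1 + s\<^sup>2)\<^sup>2"
  let ?h = "\<lambda>x::real. x powr (?a - 1) * (1 - x) powr (?b - 1)"
  have pos: "0 < 1 + s\<^sup>2" for s :: real by (simp add: add_pos_nonneg)
  have img: "?g ` {0<..} = {0<..<1}"
  proof (intro equalityI subsetI)
    fix x assume "x \<in> ?g ` {0<..}"
    then show "x \<in> {0<..<1}" using pos by auto
  next
    fix x :: real assume "x \<in> {0<..<1}"
    then have "x = ?g (sqrt (x / (1 - x)))" "sqrt (x / (1 - x)) \<in> {0<..}"
      by (auto simp: field_simps)
    then show "x \<in> ?g ` {0<..}" by blast
  qed
  have inj: "inj_on ?g {0<..}"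
  proof (rule inj_onI)
    fix s t :: real assume "s \<in> {0<..}" "t \<in> {0<..}" and eq: "?g s = ?g t"
    have "s\<^sup>2 * (1 + t\<^sup>2) = t\<^sup>2 * (1 + s\<^sup>2)"
      using eq pos[of s] pos[of t] by (simp add: frac_eq_eq)
    then have "s\<^sup>2 = t\<^sup>2" by (simp add: algebra_simps)
    then show "s = t" using \<open>s \<in> _\<close> \<open>t \<in> _\<close> by (simp add: power2_eq_iff)
  qed
  have der: "(?g has_field_derivative ?g' s) (at s within {0<..})" for s
    using pos[of s] by (auto intro!: derivative_eq_intros simp: power2_eq_square) (simp add: algebra_simps)
  have H: "(?h has_integral Beta ?a ?b) {0..1}" using assms by (intro has_integral_Beta_real) auto
  then have H': "(?h has_integral Beta ?a ?b) {0<..<1}"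
    by (simp add: has_integral_Icc_iff_Ioo)
  have "?h absolutely_integrable_on {0<..<1} \<and> integral {0<..<1} ?h = Beta ?a ?b"
    using H' by (intro conjI nonnegative_absolutely_integrable_1) (auto simp: integral_unique)
  then have C: "(\<lambda>s. \<bar>?g' s\<bar> * ?h (?g s)) absolutely_integrable_on {0<..} \<and>
      integral {0<..} (\<lambda>s. \<bar>?g' s\<bar> * ?h (?g s)) = Beta ?a ?b"
    using has_absolute_integral_change_of_variables_1'[OF _ der inj, of ?h "Beta ?a ?b"]
    unfolding img by simp
  have eq: "\<bar>?g' s\<bar> * ?h (?g s) = 2 * (s powr (\<alpha> - 1) / (1 + s\<^sup>2))" if "s \<in> {0<..}" for s
  proof -
    have s: "0 < s" using that by simp
    define P where "P = 1 + s\<^sup>2"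
    have P: "0 < P" using pos[of s] by (simp add: P_def)
    have "1 - ?g s = 1 / P" using P by (simp add: P_def field_simps)
    then have "?h (?g s) = (s\<^sup>2) powr (?a - 1) / P powr (?a - 1) * (1 / P powr (?b - 1))"
      using P s by (simp add: powr_divide flip: P_def)
    also have "P powr (?a - 1) = P powr (- 1) * P powr ?a" using P by (simp add: powr_diff powr_minus_divide)
    also have "P powr (?b - 1) = P powr - ?a" by simp
    also have "(s\<^sup>2) powr (?a - 1) = s powr (\<alpha> - 2)"
    proof -
      have "s\<^sup>2 = s powr 2" using s by simp
      then have "(s\<^sup>2) powr (?a - 1) = s powr (2 * (?a - 1))" by (simp only: powr_powr)
      then show ?thesis by (simp add: algebra_simps)
    qed
    also have "\<bar>?g' s\<bar> * (s powr (\<alpha> - 2) / (P powr (- 1) * P powr ?a) * (1 / P powr - ?a)) =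
        2 * ((s powr 1 * s powr (\<alpha> - 2)) / P)"
    proof -
      have "\<bar>?g' s\<bar> = 2 * s / (P * P)" using s by (simp add: P_def power2_eq_square)
      moreover have "P powr ?a \<noteq> 0" using P by simp
      ultimately show ?thesis using P s by (simp add: powr_minus_divide)
    qed
    also have "s powr 1 * s powr (\<alpha> - 2) = s powr (\<alpha> - 1)"
      by (subst powr_add[symmetric]) simp
    finally show ?thesis by (simp add: P_def)
  qed
  have A: "(\<lambda>s. 2 * (s powr (\<alpha> - 1) / (1 + s\<^sup>2))) absolutely_integrable_on {0<..}"
    using C[THEN conjunct1] by (rule set_integrable_cong[THEN iffD1, OF refl refl eq, rotated])
  have I: "integral {0<..} (\<lambda>s. 2 * (s powr (\<alpha> - 1) / (1 + s\<^sup>2))) = Beta ?a ?b"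
    using C[THEN conjunct2] by (subst (asm) Henstock_Kurzweil_Integration.integral_cong[OF eq])
  have S2: "set_integrable lborel {0<..} (\<lambda>s. 2 * (s powr (\<alpha> - 1) / (1 + s\<^sup>2)))"
    using A by (simp add: set_integrable_def integrable_completion)
  from set_integrable_mult_right[of "1/2", OF S2]
  show "set_integrable lborel {0<..} (\<lambda>s. s powr (\<alpha> - 1) / (1 + s\<^sup>2))"
    by simp
  have "2 * (LINT s:{0<..}|lborel. s powr (\<alpha> - 1) / (1 + s\<^sup>2)) = Beta ?a ?b"
    using set_borel_integral_eq_integral(2)[OF S2] I by (simp only: set_integral_mult_right)
  also have "Beta ?a ?b = Gamma ?a * Gamma (1 - ?a)"
    by (simp add: Beta_def)
  also have "\<dots> = pi / sin (pi * ?a)"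
    by (rule Gamma_reflection_real)
  finally have "2 * (LINT s:{0<..}|lborel. s powr (\<alpha> - 1) / (1 + s\<^sup>2)) = pi / sin (pi * ?a)" .
  then show "(LINT s:{0<..}|lborel. s powr (\<alpha> - 1) / (1 + s\<^sup>2)) = pi / (2 * sin (pi * \<alpha> / 2))"
    by (simp add: field_simps)
qed

text \<open>Writing Gamma \<alpha> r^(-\<alpha>) as the Laplace integral of s^(\<alpha>-1) and
  exchanging the integrals leaves the Laplace transform of the sine, and then the Beta-type integral
  above. Convergence at 0 uses |sin r| <= r and \<alpha> < 2, at infinity \<alpha> > 1.\<close>

lemma sin_powr_integral:
  assumes "1 < (\<alpha>::real)" "\<alpha> < 2"
  shows "set_integrable lborel {0<..} (\<lambda>r. sin r * r powr (- \<alpha>))"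
    and "(LINT r:{0<..}|lborel. sin r * r powr (- \<alpha>)) = - cos (\<alpha> * pi / 2) * (Gamma (2 - \<alpha>) / (\<alpha> - 1))"
proof -
  show I: "set_integrable lborel {0<..} (\<lambda>r. sin r * r powr (- \<alpha>))"
  proof (rule set_integrable_half_line[where K=1 and a="1 - \<alpha>" and b="- \<alpha>"])
    fix r :: real assume r: "0 < r" "r \<le> 1"
    have "\<bar>sin r\<bar> * r powr (- \<alpha>) \<le> r powr 1 * r powr (- \<alpha>)"
      using r abs_sin_x_le_abs_x[of r] by (intro mult_right_mono) auto
    then show "\<bar>sin r * r powr (- \<alpha>)\<bar> \<le> 1 * r powr (1 - \<alpha>)"
      unfolding powr_add[symmetric] by (simp add: abs_mult)
  qed (use assms in \<open>auto simp: abs_mult intro!: mult_left_le_one_le\<close>)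
  let ?h = "\<lambda>r s. indicator {0<..} r *\<^sub>R (indicator {0<..} s *\<^sub>R (sin r * (s powr (\<alpha> - 1) * exp (- (s * r))))) :: real"
  \<comment> \<open>For fixed r only \<open>sin r\<close> carries a sign, so the integral of the
    modulus is the modulus of the integral; Fubini is thereby reduced to the absolute convergence
    already shown.\<close>
  have inner: "(LINT s|lborel. ?h r s) = Gamma \<alpha> * (indicator {0<..} r *\<^sub>R (sin r * r powr (- \<alpha>)))"
    and inner_int: "integrable lborel (?h r)"
    and inner_abs: "(LINT s|lborel. norm (?h r s)) = Gamma \<alpha> * norm (indicator {0<..} r *\<^sub>R (sin r * r powr (- \<alpha>)))" for r
  proof -
    have G: "set_integrable lborel {0<..} (\<lambda>s. s powr (\<alpha> - 1) * exp (- (s * r)))"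
      "(LINT s:{0<..}|lborel. s powr (\<alpha> - 1) * exp (- (s * r))) = Gamma \<alpha> * r powr (- \<alpha>)" if "0 < r"
      using Gamma_scaled[of r \<alpha>] that assms by auto
    have e: "?h r s = (indicator {0<..} r * sin r) * (indicator {0<..} s *\<^sub>R (s powr (\<alpha> - 1) * exp (- (s * r))))"
      and e': "norm (?h r s) = (indicator {0<..} r * \<bar>sin r\<bar>) * (indicator {0<..} s *\<^sub>R (s powr (\<alpha> - 1) * exp (- (s * r))))" for s
      by (auto simp: indicator_def abs_mult)
    show "(LINT s|lborel. ?h r s) = Gamma \<alpha> * (indicator {0<..} r *\<^sub>R (sin r * r powr (- \<alpha>)))"
      unfolding e integral_mult_right_zero
      using G(2) by (cases "0 < r") (auto simp: set_lebesgue_integral_def)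
    show "(LINT s|lborel. norm (?h r s)) = Gamma \<alpha> * norm (indicator {0<..} r *\<^sub>R (sin r * r powr (- \<alpha>)))"
      unfolding e' integral_mult_right_zero
      using G(2) by (cases "0 < r") (auto simp: set_lebesgue_integral_def abs_mult)
    show "integrable lborel (?h r)"
      unfolding e using G(1) by (cases "0 < r") (auto simp: set_integrable_def)
  qed
  have int: "integrable (lborel \<Otimes>\<^sub>M lborel) (\<lambda>(r, s). ?h r s)"
  proof (rule lborel_pair.Fubini_integrable)
    show "integrable lborel (\<lambda>r. LINT s|lborel. norm (case (r, s) of (r, s) \<Rightarrow> ?h r s))"
      unfolding prod.case inner_abs
      using I unfolding set_integrable_def by (intro integrable_mult_right integrable_norm)
    show "AE r in lborel. integrable lborel (\<lambda>s. case (r, s) of (r, s) \<Rightarrow> ?h r s)"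
      unfolding prod.case using inner_int by simp
  qed measurable
  have "Gamma \<alpha> * (LINT r:{0<..}|lborel. sin r * r powr (- \<alpha>)) = (LINT r|lborel. LINT s|lborel. ?h r s)"
    unfolding inner set_lebesgue_integral_def by simp
  also have "\<dots> = (LINT s|lborel. LINT r|lborel. ?h r s)"
    by (rule lborel_pair.Fubini_integral[symmetric]) (rule int)
  also have "\<dots> = (LINT s:{0<..}|lborel. s powr (\<alpha> - 1) / (1 + s\<^sup>2))"
    unfolding set_lebesgue_integral_def
  proof (intro Bochner_Integration.integral_cong refl)
    fix s :: real
    have "?h r s = (indicator {0<..} s * s powr (\<alpha> - 1)) * (indicator {0<..} r *\<^sub>R (sin r * exp (- (r * s))))" for r
      by (simp add: indicator_def mult_ac)
    then have "(LINT r|lborel. ?h r s) =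
        (indicator {0<..} s * s powr (\<alpha> - 1)) * (LINT r:{0<..}|lborel. sin r * exp (- (r * s)))"
      unfolding set_lebesgue_integral_def by (simp only: integral_mult_right_zero)
    then show "(LINT r|lborel. ?h r s) = indicator {0<..} s *\<^sub>R (s powr (\<alpha> - 1) / (1 + s\<^sup>2))"
      using laplace_sin[of s] by (cases "0 < s") simp_all
  qed
  also have "\<dots> = pi / (2 * sin (pi * \<alpha> / 2))"
    using assms by (intro beta_half_line) auto
  finally have 1: "Gamma \<alpha> * (LINT r:{0<..}|lborel. sin r * r powr (- \<alpha>)) = pi / (2 * sin (pi * \<alpha> / 2))" .
  have G: "Gamma \<alpha> \<noteq> 0" using Gamma_real_pos[of \<alpha>] assms by linarith
  have R: "Gamma \<alpha> * Gamma (1 - \<alpha>) = pi / sin (pi * \<alpha>)"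
    by (rule Gamma_reflection_real)
  have "Gamma (1 - \<alpha> + 1) = (1 - \<alpha>) * Gamma (1 - \<alpha>)"
  proof (intro Gamma_plus1 notI)
    assume "1 - \<alpha> \<in> \<int>\<^sub>\<le>\<^sub>0"
    then obtain n where "1 - \<alpha> = real_of_int n" by (auto elim!: nonpos_Ints_cases)
    then have "real_of_int n < real_of_int 0" "real_of_int (- 1) < real_of_int n"
      using assms by simp_all
    then show False unfolding of_int_less_iff by linarith
  qed
  then have G2: "Gamma (2 - \<alpha>) = (1 - \<alpha>) * Gamma (1 - \<alpha>)" by (simp add: algebra_simps)
  have c: "cos (pi * \<alpha> / 2) < 0"
  proof -
    have "0 < sin (pi * \<alpha> / 2 - pi / 2)" using assms by (intro sin_gt_zero) (auto simp: field_simps)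
    then show ?thesis by (simp add: sin_diff)
  qed
  have s: "sin (pi * \<alpha>) = 2 * sin (pi * \<alpha> / 2) * cos (pi * \<alpha> / 2)"
    using sin_double[of "pi * \<alpha> / 2"] by simp
  have s0: "sin (pi * \<alpha> / 2) \<noteq> 0" using assms sin_gt_zero[of "pi * \<alpha> / 2"] by auto
  \<comment> \<open>The two values are compared after multiplication by Gamma \<alpha>: reflection
    at \<alpha> produces sin (pi \<alpha>), and the double angle formula cancels the cosine.\<close>
  have "Gamma \<alpha> * (- cos (\<alpha> * pi / 2) * (Gamma (2 - \<alpha>) / (\<alpha> - 1))) = cos (pi * \<alpha> / 2) * (Gamma \<alpha> * Gamma (1 - \<alpha>))"
    using assms unfolding G2 by (simp add: field_simps)
  also have "\<dots> = pi / (2 * sin (pi * \<alpha> / 2))"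
    unfolding R s using c s0 by simp
  finally have 2: "Gamma \<alpha> * (- cos (\<alpha> * pi / 2) * (Gamma (2 - \<alpha>) / (\<alpha> - 1))) = pi / (2 * sin (pi * \<alpha> / 2))" .
  show "(LINT r:{0<..}|lborel. sin r * r powr (- \<alpha>)) = - cos (\<alpha> * pi / 2) * (Gamma (2 - \<alpha>) / (\<alpha> - 1))"
    by (rule mult_left_cancel[OF G, THEN iffD1, OF trans[OF 1 2[symmetric]]])
qed

subsection \<open>One-dimensional stable variables\<close>

text \<open>Integrability is read off the characteristic function through
  \<open>\<integral> (1 - cos (t y)) / t\<^sup>2 dt \<ge> c \<bar>y\<bar>\<close>.\<close>

lemma stable_1d_integrable:
  assumes "prob_space N" and [measurable]: "Y \<in> borel_measurable N"
    and char: "\<And>t. char (distr N borel Y) t = complex_of_real (exp (- (\<bar>t\<bar> powr \<alpha>)))"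
    and \<alpha>: "1 < \<alpha>" "\<alpha> < 2"
  shows "integrable N Y" and "0 < prob_space.expectation N (\<lambda>\<omega>. \<bar>Y \<omega>\<bar>)"
proof -
  interpret N: prob_space N by fact
  interpret pair_sigma_finite N lborel ..
  let ?k = "\<lambda>y t::real. indicator {0<..} t * ((1 - cos (t * y)) / t\<^sup>2)"
  have Re: "(\<integral>\<omega>. cos (t * Y \<omega>) \<partial>N) = exp (- (\<bar>t\<bar> powr \<alpha>))" for t
  proof -
    have "char (distr N borel Y) t = (CLINT \<omega>|N. iexp (t * Y \<omega>))"
      unfolding char_def by (subst integral_distr) auto
    moreover have "integrable N (\<lambda>\<omega>. iexp (t * Y \<omega>))"
      by (rule N.integrable_const_bound[where B=1]) auto
    ultimately have "Re (char (distr N borel Y) t) = (\<integral>\<omega>. Re (iexp (t * Y \<omega>)) \<partial>N)"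
      by simp
    then show ?thesis unfolding char by (simp add: Re_exp)
  qed
  have cosint: "integrable N (\<lambda>\<omega>. cos (t * Y \<omega>))" for t
    by (rule N.integrable_const_bound[where B=1]) auto
  have k0: "0 \<le> ?k y t" for y t by (auto simp: indicator_def)
  have "(\<integral>\<^sup>+\<omega>. \<integral>\<^sup>+t. ennreal (?k (Y \<omega>) t) \<partial>lborel \<partial>N) = (\<integral>\<^sup>+t. \<integral>\<^sup>+\<omega>. ennreal (?k (Y \<omega>) t) \<partial>N \<partial>lborel)"
    by (rule Fubini'[symmetric]) measurable
  also have "\<dots> = (\<integral>\<^sup>+t. ennreal (indicator {0<..} t * ((1 - exp (- (\<bar>t\<bar> powr \<alpha>))) / t\<^sup>2)) \<partial>lborel)"
  proof (intro nn_integral_cong)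
    fix t :: real
    have "(\<integral>\<^sup>+\<omega>. ennreal (?k (Y \<omega>) t) \<partial>N) = ennreal (\<integral>\<omega>. ?k (Y \<omega>) t \<partial>N)"
      using cosint by (intro nn_integral_eq_integral) (auto intro!: k0)
    also have "(\<integral>\<omega>. ?k (Y \<omega>) t \<partial>N) = indicator {0<..} t * ((1 - exp (- (\<bar>t\<bar> powr \<alpha>))) / t\<^sup>2)"
      using cosint by (simp add: Re N.prob_space)
    finally show "(\<integral>\<^sup>+\<omega>. ennreal (?k (Y \<omega>) t) \<partial>N) = \<dots>" .
  qed
  also have "\<dots> < \<infinity>"
  proof -
    \<comment> \<open>Near 0 the inequality 1 - exp (-x) <= x leaves t^(\<alpha>-2), which is
      integrable because \<alpha> > 1; at infinity the numerator is at most 1.\<close>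
    have "set_integrable lborel {0<..} (\<lambda>t. (1 - exp (- (\<bar>t\<bar> powr \<alpha>))) / t\<^sup>2)"
    proof (rule set_integrable_half_line[where K=1 and a="\<alpha> - 2" and b="- 2"])
      fix t :: real assume t: "0 < t"
      have "\<bar>1 - exp (- (\<bar>t\<bar> powr \<alpha>))\<bar> \<le> t powr \<alpha>"
        using exp_ge_add_one_self[of "- (t powr \<alpha>)"] t by auto
      then have "\<bar>1 - exp (- (\<bar>t\<bar> powr \<alpha>))\<bar> / t\<^sup>2 \<le> t powr \<alpha> / t powr 2"
        using t by (auto intro!: divide_right_mono)
      then show "\<bar>(1 - exp (- (\<bar>t\<bar> powr \<alpha>))) / t\<^sup>2\<bar> \<le> 1 * t powr (\<alpha> - 2)"
        by (simp add: powr_diff)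
    next
      fix t :: real assume t: "1 < t"
      have "\<bar>1 - exp (- (\<bar>t\<bar> powr \<alpha>))\<bar> / t\<^sup>2 \<le> 1 / t\<^sup>2"
        by (intro divide_right_mono) auto
      then show "\<bar>(1 - exp (- (\<bar>t\<bar> powr \<alpha>))) / t\<^sup>2\<bar> \<le> 1 * t powr (- 2)"
        using t by (simp add: powr_minus_divide)
    qed (use \<alpha> in auto)
    then have "integrable lborel (\<lambda>t. indicator {0<..} t * ((1 - exp (- (\<bar>t\<bar> powr \<alpha>))) / t\<^sup>2))"
      unfolding set_integrable_def by simp
    then show ?thesis
      by (subst nn_integral_eq_integral) (auto simp: indicator_def)
  qed
  finally have fin: "(\<integral>\<^sup>+\<omega>. \<integral>\<^sup>+t. ennreal (?k (Y \<omega>) t) \<partial>lborel \<partial>N) < \<infinity>" .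
  have low: "ennreal ((1 - cos 1) / 4) * ennreal \<bar>y\<bar> \<le> (\<integral>\<^sup>+t. ennreal (?k y t) \<partial>lborel)" for y
  proof (cases "y = 0")
    case False
    \<comment> \<open>On this interval 1 <= t|y| <= 2 < pi, so the cosine is at most cos 1, and
      1/t^2 >= y^2/4. The length 1/|y| leaves one factor |y|.\<close>
    let ?J = "{1 / \<bar>y\<bar>..2 / \<bar>y\<bar>}"
    have c1: "cos 1 \<le> (1::real)" by simp
    have "(1 - cos 1) / 4 * \<bar>y\<bar> = (1 - cos 1) / 4 * y\<^sup>2 * (1 / \<bar>y\<bar>)"
      using False by (cases "0 < y") (auto simp: power2_eq_square)
    then have "ennreal ((1 - cos 1) / 4) * ennreal \<bar>y\<bar> = ennreal ((1 - cos 1) / 4 * y\<^sup>2) * ennreal (1 / \<bar>y\<bar>)"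
      using c1 by (simp only: ennreal_mult[symmetric] zero_le_divide_1_iff abs_ge_zero mult_nonneg_nonneg
            divide_nonneg_nonneg zero_le_power2 zero_le_numeral diff_ge_0_iff_ge)
    also have "ennreal (1 / \<bar>y\<bar>) = emeasure lborel ?J"
      using False by (subst emeasure_lborel_Icc) (auto simp: field_simps)
    also have "ennreal ((1 - cos 1) / 4 * y\<^sup>2) * emeasure lborel ?J =
        (\<integral>\<^sup>+t. ennreal ((1 - cos 1) / 4 * y\<^sup>2) * indicator ?J t \<partial>lborel)"
      by (subst nn_integral_cmult_indicator) auto
    also have "\<dots> \<le> (\<integral>\<^sup>+t. ennreal (?k y t) \<partial>lborel)"
    proof (intro nn_integral_mono)
      fix t :: real
      show "ennreal ((1 - cos 1) / 4 * y\<^sup>2) * indicator ?J t \<le> ennreal (?k y t)"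
      proof (cases "t \<in> ?J")
        case True
        then have t: "0 < t" using False by (auto intro: less_le_trans[of 0 "1 / \<bar>y\<bar>"])
        from True have ty: "1 \<le> t * \<bar>y\<bar>" "t * \<bar>y\<bar> \<le> 2" using False by (auto simp: field_simps)
        have "cos (t * y) = cos (t * \<bar>y\<bar>)" by (simp add: abs_if)
        also have "\<dots> \<le> cos 1" using ty pi_gt3 by (intro cos_monotone_0_pi_le) auto
        finally have 1: "1 - cos 1 \<le> 1 - cos (t * y)" by simp
        have "(t * \<bar>y\<bar>)\<^sup>2 \<le> 2\<^sup>2" using ty by (intro power_mono) auto
        then have 2: "y\<^sup>2 / 4 \<le> 1 / t\<^sup>2" using t by (simp add: field_simps power_mult_distrib)
        have "(1 - cos 1) * (y\<^sup>2 / 4) \<le> (1 - cos (t * y)) * (1 / t\<^sup>2)"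
          using 1 2 by (intro mult_mono) auto
        then show ?thesis using True t by (simp add: ennreal_leI)
      qed simp
    qed
    finally show ?thesis .
  qed simp
  have c1: "cos 1 < (1::real)" using cos_monotone_0_pi[of 0 1] pi_gt3 by simp
  have "ennreal ((1 - cos 1) / 4) * (\<integral>\<^sup>+\<omega>. ennreal \<bar>Y \<omega>\<bar> \<partial>N) = (\<integral>\<^sup>+\<omega>. ennreal ((1 - cos 1) / 4) * ennreal \<bar>Y \<omega>\<bar> \<partial>N)"
    by (rule nn_integral_cmult[symmetric]) measurable
  also have "\<dots> \<le> (\<integral>\<^sup>+\<omega>. \<integral>\<^sup>+t. ennreal (?k (Y \<omega>) t) \<partial>lborel \<partial>N)"
    by (intro nn_integral_mono low)
  also note fin
  finally have "(\<integral>\<^sup>+\<omega>. ennreal \<bar>Y \<omega>\<bar> \<partial>N) < \<infinity>"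
    using c1 by (auto simp: ennreal_mult_less_top)
  then show I: "integrable N Y" by (simp add: integrable_iff_bounded)
  show "0 < N.expectation (\<lambda>\<omega>. \<bar>Y \<omega>\<bar>)"
  proof (rule ccontr)
    \<comment> \<open>A vanishing mean would make Y zero almost surely, so that cos Y has mean 1
      instead of exp (-1).\<close>
    assume "\<not> 0 < N.expectation (\<lambda>\<omega>. \<bar>Y \<omega>\<bar>)"
    moreover have "0 \<le> N.expectation (\<lambda>\<omega>. \<bar>Y \<omega>\<bar>)" by simp
    ultimately have "N.expectation (\<lambda>\<omega>. \<bar>Y \<omega>\<bar>) = 0" by linarith
    then have "AE \<omega> in N. \<bar>Y \<omega>\<bar> = 0"
      using I by (subst (asm) integral_nonneg_eq_0_iff_AE) auto
    then have "(\<integral>\<omega>. cos (1 * Y \<omega>) \<partial>N) = (\<integral>\<omega>. 1 \<partial>N)"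
      by (intro integral_cong_AE) auto
    then show False unfolding Re by (simp add: N.prob_space)
  qed
qed

subsection \<open>Multipliers, convolutions and gradients\<close>

lemma norm_iexp_minus_1_le: "norm (iexp t - 1) \<le> \<bar>t\<bar>" and norm_iexp_minus_1_le_2: "norm (iexp t - 1) \<le> 2"
proof -
  show "norm (iexp t - 1) \<le> \<bar>t\<bar>" using iexp_approx1[of t 0] by simp
  show "norm (iexp t - 1) \<le> 2" using norm_triangle_ineq4[of "iexp t" 1] by simp
qed

text \<open>Averaging a family of Fourier integrals over a parameter amounts to averaging the
  multipliers. The parameter will be a translation, a point of the Levy measure in polar form, or a
  time.\<close>

lemma (in sigma_finite_measure) fourier_Fubini:
  fixes K :: "'a \<Rightarrow> 'b::euclidean_space \<Rightarrow> complex"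
  assumes K: "integrable (M \<Otimes>\<^sub>M lborel) (\<lambda>(u, \<xi>). K u \<xi>)"
  shows "integrable M (\<lambda>u. Re (fourier (K u) x))"
    and "integrable lborel (\<lambda>\<xi>. CLINT u|M. K u \<xi>)"
    and "(\<integral>u. Re (fourier (K u) x) \<partial>M) = Re (fourier (\<lambda>\<xi>. CLINT u|M. K u \<xi>) x)"
proof -
  interpret pair_sigma_finite M "lborel :: 'b measure" ..
  have [measurable]: "(\<lambda>(u, \<xi>). K u \<xi>) \<in> borel_measurable (M \<Otimes>\<^sub>M lborel)" using K by auto
  have I: "integrable (M \<Otimes>\<^sub>M lborel) (\<lambda>(u, \<xi>). iexp (x \<bullet> \<xi>) * K u \<xi>)"
    using K by (rule Bochner_Integration.integrable_bound) (auto simp: norm_mult split_beta')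
  have F: "integrable M (\<lambda>u. fourier (K u) x)"
    unfolding fourier_def by (rule integrable_fst[OF I])
  then show "integrable M (\<lambda>u. Re (fourier (K u) x))" by simp
  show "integrable lborel (\<lambda>\<xi>. CLINT u|M. K u \<xi>)"
    by (rule integrable_snd[OF K])
  have "(CLINT u|M. fourier (K u) x) = (CLINT \<xi>|lborel. CLINT u|M. iexp (x \<bullet> \<xi>) * K u \<xi>)"
    unfolding fourier_def by (rule Fubini_integral[OF I, symmetric])
  then have "(CLINT u|M. fourier (K u) x) = fourier (\<lambda>\<xi>. CLINT u|M. K u \<xi>) x"
    by (simp add: fourier_def integral_mult_right_zero)
  then show "(\<integral>u. Re (fourier (K u) x) \<partial>M) = Re (fourier (\<lambda>\<xi>. CLINT u|M. K u \<xi>) x)"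
    using integral_Re[OF F] by simp
qed

lemma fourier_shift: "fourier m (x + y) = fourier (\<lambda>\<xi>. iexp (y \<bullet> \<xi>) * m \<xi>) x"
  by (simp add: fourier_def inner_add_left distrib_left exp_add mult_ac)

lemma fourier_sum:
  assumes "\<And>b. b \<in> A \<Longrightarrow> integrable lborel (M b)"
  shows "fourier (\<lambda>\<xi>. \<Sum>b\<in>A. M b \<xi>) x = (\<Sum>b\<in>A. fourier (M b) x)"
  unfolding fourier_def sum_distrib_left
  by (rule Bochner_Integration.integral_sum) (auto intro!: integrable_iexp_mult assms)

text \<open>Functions are carried below as real parts of Fourier integrals; this shows that nothing
  is lost, which matters when a vanishing function is to force a vanishing multiplier.\<close>

lemma fourier_hermitian_real:
  assumes m: "integrable lborel m" and herm: "\<And>\<xi>. m (- \<xi>) = cnj (m \<xi>)"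
  shows "Im (fourier m x) = 0"
proof -
  have [measurable]: "m \<in> borel_measurable borel" using m by auto
  have "fourier m x = (CLINT \<xi>|lborel. iexp (x \<bullet> - \<xi>) * m (- \<xi>))"
    unfolding fourier_def by (subst integral_lborel_affine[of _ "- 1" 0]) auto
  also have "\<dots> = (CLINT \<xi>|lborel. cnj (iexp (x \<bullet> \<xi>) * m \<xi>))"
    by (intro Bochner_Integration.integral_cong) (auto simp: herm exp_cnj)
  also have "\<dots> = cnj (fourier m x)"
    unfolding fourier_def by (rule Bochner_Integration.integral_cnj)
  finally show ?thesis by (metis Reals_cnj_iff complex_is_Real_iff)
qed

text \<open>The scale \<tau> covers two uses: \<tau> = -1 is the ordinary convolution, and \<tau> =
  s^(1/\<alpha>) the average along a rescaled kernel. Fubini holds because the modulus of the kernel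
  is a product of integrable functions.\<close>

lemma fourier_convolution:
  fixes k :: "'a::euclidean_space \<Rightarrow> real"
  assumes k: "integrable lborel k" and m: "integrable lborel m"
  shows "integrable lborel (\<lambda>y. k y * Re (fourier m (x + \<tau> *\<^sub>R y)))"
    and "integrable lborel (\<lambda>\<xi>. m \<xi> * fourier (\<lambda>y. complex_of_real (k y)) (\<tau> *\<^sub>R \<xi>))"
    and "(\<integral>y. k y * Re (fourier m (x + \<tau> *\<^sub>R y)) \<partial>lborel) =
      Re (fourier (\<lambda>\<xi>. m \<xi> * fourier (\<lambda>y. complex_of_real (k y)) (\<tau> *\<^sub>R \<xi>)) x)"
proof -
  have [measurable]: "k \<in> borel_measurable borel" "m \<in> borel_measurable borel" using k m by auto
  let ?K = "\<lambda>y \<xi>. complex_of_real (k y) * (iexp ((\<tau> *\<^sub>R y) \<bullet> \<xi>) * m \<xi>)"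
  have I: "integrable (lborel \<Otimes>\<^sub>M lborel) (\<lambda>(y, \<xi>). ?K y \<xi>)"
    by (rule Bochner_Integration.integrable_bound
          [OF lborel_pair.integrable_pair_mult[OF integrable_norm[OF k] integrable_norm[OF m]]])
       (auto simp: norm_mult)
  have 1: "Re (fourier (?K y) x) = k y * Re (fourier m (x + \<tau> *\<^sub>R y))" for y
  proof -
    have "fourier (?K y) x = (CLINT \<xi>|lborel. complex_of_real (k y) * (iexp (x \<bullet> \<xi>) * (iexp ((\<tau> *\<^sub>R y) \<bullet> \<xi>) * m \<xi>)))"
      unfolding fourier_def by (intro Bochner_Integration.integral_cong) (auto simp: mult_ac)
    also have "\<dots> = complex_of_real (k y) * fourier m (x + \<tau> *\<^sub>R y)"
      unfolding fourier_shift unfolding fourier_def by (rule integral_mult_right_zero)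
    finally show ?thesis by simp
  qed
  have 2: "(CLINT y|lborel. ?K y \<xi>) = m \<xi> * fourier (\<lambda>y. complex_of_real (k y)) (\<tau> *\<^sub>R \<xi>)" for \<xi>
  proof -
    have "(CLINT y|lborel. ?K y \<xi>) = (CLINT y|lborel. m \<xi> * (iexp ((\<tau> *\<^sub>R \<xi>) \<bullet> y) * k y))"
      by (intro Bochner_Integration.integral_cong) (auto simp: mult_ac inner_commute)
    then show ?thesis unfolding fourier_def by (simp only: integral_mult_right_zero)
  qed
  note F = lborel.fourier_Fubini(1)[OF I, where x=x, unfolded 1] lborel.fourier_Fubini(2)[OF I, unfolded 2]
    lborel.fourier_Fubini(3)[OF I, where x=x, unfolded 1 2]
  show "integrable lborel (\<lambda>y. k y * Re (fourier m (x + \<tau> *\<^sub>R y)))" by (rule F(1))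
  show "integrable lborel (\<lambda>\<xi>. m \<xi> * fourier (\<lambda>y. complex_of_real (k y)) (\<tau> *\<^sub>R \<xi>))" by (rule F(2))
  show "(\<integral>y. k y * Re (fourier m (x + \<tau> *\<^sub>R y)) \<partial>lborel) =
      Re (fourier (\<lambda>\<xi>. m \<xi> * fourier (\<lambda>y. complex_of_real (k y)) (\<tau> *\<^sub>R \<xi>)) x)" by (rule F(3))
qed

lemma gradient_eqI:
  assumes "GDERIV f x :> D"
  shows "gradient f x = D"
  unfolding gradient_def
proof (rule the_equality)
  fix D' assume "GDERIV f x :> D'"
  then have "(\<lambda>h. h \<bullet> D') = (\<lambda>h. h \<bullet> D)"
    using assms unfolding gderiv_def by (rule has_derivative_unique)
  then show "D' = D" by (metis inner_commute vector_eq_ldot)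
qed fact

lemma le_1_square: "x \<le> 1 + x\<^sup>2" for x :: real
  using zero_le_power2[of "x - 1 / 2"] by (simp add: power2_eq_square algebra_simps)

text \<open>The Taylor bound |exp(is) - 1 - is| <= s^2/2, integrated against \<open>m\<close>,
  controls the remainder by the second moment times \<open>(norm h)\<^sup>2\<close>; no
  differentiation under the integral is involved.\<close>

lemma
  fixes m :: "'a::euclidean_space \<Rightarrow> complex"
  assumes m: "integrable lborel m" and m2: "integrable lborel (\<lambda>\<xi>. (norm \<xi>)\<^sup>2 * norm (m \<xi>))"
  shows integrable_fourier_gradient: "integrable lborel (\<lambda>\<xi>. \<i> * complex_of_real (\<xi> \<bullet> v) * m \<xi>)"
    and gderiv_fourier: "GDERIV (\<lambda>x. Re (fourier m x)) x :>
      (\<Sum>b\<in>Basis. Re (fourier (\<lambda>\<xi>. \<i> * complex_of_real (\<xi> \<bullet> b) * m \<xi>) x) *\<^sub>R b)"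
proof -
  have [measurable]: "m \<in> borel_measurable borel" using m by auto
  have i: "integrable lborel (\<lambda>\<xi>. \<i> * complex_of_real (\<xi> \<bullet> v) * m \<xi>)" for v
  proof (rule Bochner_Integration.integrable_bound)
    show "integrable lborel (\<lambda>\<xi>. norm v * (norm (m \<xi>) + (norm \<xi>)\<^sup>2 * norm (m \<xi>)))"
      using m m2 by auto
    show "AE \<xi> in lborel. norm (\<i> * complex_of_real (\<xi> \<bullet> v) * m \<xi>)
        \<le> norm (norm v * (norm (m \<xi>) + (norm \<xi>)\<^sup>2 * norm (m \<xi>)))"
    proof (rule AE_I2)
      fix \<xi> :: 'a
      have "norm \<xi> \<le> 1 + (norm \<xi>)\<^sup>2"
        by (rule le_1_square)
      then have "norm \<xi> * norm v * norm (m \<xi>) \<le> (1 + (norm \<xi>)\<^sup>2) * norm v * norm (m \<xi>)"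
        by (intro mult_right_mono) auto
      moreover have "\<bar>\<xi> \<bullet> v\<bar> * norm (m \<xi>) \<le> norm \<xi> * norm v * norm (m \<xi>)"
        by (intro mult_right_mono Cauchy_Schwarz_ineq2) auto
      ultimately show "norm (\<i> * complex_of_real (\<xi> \<bullet> v) * m \<xi>)
        \<le> norm (norm v * (norm (m \<xi>) + (norm \<xi>)\<^sup>2 * norm (m \<xi>)))"
        by (simp add: norm_mult algebra_simps)
    qed
  qed auto
  then show "integrable lborel (\<lambda>\<xi>. \<i> * complex_of_real (\<xi> \<bullet> v) * m \<xi>)" .
  let ?g = "\<lambda>v. fourier (\<lambda>\<xi>. \<i> * complex_of_real (\<xi> \<bullet> v) * m \<xi>) x"
  let ?D = "\<Sum>b\<in>Basis. Re (?g b) *\<^sub>R b"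
  let ?C = "(\<integral>\<xi>. (norm \<xi>)\<^sup>2 * norm (m \<xi>) \<partial>lborel) / 2"
  have gD: "Re (?g h) = h \<bullet> ?D" for h
  proof -
    have "?g h = (CLINT \<xi>|lborel. (\<Sum>b\<in>Basis. complex_of_real (h \<bullet> b) * (iexp (x \<bullet> \<xi>) * (\<i> * complex_of_real (\<xi> \<bullet> b) * m \<xi>))))"
      unfolding fourier_def
    proof (intro Bochner_Integration.integral_cong refl)
      fix \<xi> :: 'a
      have "complex_of_real (\<xi> \<bullet> h) = (\<Sum>b\<in>Basis. complex_of_real (h \<bullet> b) * complex_of_real (\<xi> \<bullet> b))"
        by (simp add: euclidean_inner[of \<xi> h] mult.commute)
      then show "iexp (x \<bullet> \<xi>) * (\<i> * complex_of_real (\<xi> \<bullet> h) * m \<xi>) =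
        (\<Sum>b\<in>Basis. complex_of_real (h \<bullet> b) * (iexp (x \<bullet> \<xi>) * (\<i> * complex_of_real (\<xi> \<bullet> b) * m \<xi>)))"
        by (simp add: sum_distrib_left sum_distrib_right mult_ac)
    qed
    also have "\<dots> = (\<Sum>b\<in>Basis. complex_of_real (h \<bullet> b) * ?g b)"
      unfolding fourier_def
      by (subst Bochner_Integration.integral_sum)
         (auto intro!: sum.cong integrable_mult_right integrable_iexp_mult i simp del: integrable_mult_right_iff)
    finally show ?thesis by (simp add: inner_sum_right mult.commute)
  qed
  have bound: "\<bar>Re (fourier m (x + h)) - Re (fourier m x) - h \<bullet> ?D\<bar> \<le> ?C * (norm h)\<^sup>2" for h
  proof -
    have eq: "fourier m (x + h) - fourier m x - ?g h =
      (CLINT \<xi>|lborel. iexp (x \<bullet> \<xi>) * ((iexp (h \<bullet> \<xi>) - 1 - \<i> * complex_of_real (h \<bullet> \<xi>)) * m \<xi>))"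
    proof -
      have 1: "integrable lborel (\<lambda>\<xi>. iexp (x \<bullet> \<xi>) * (iexp (h \<bullet> \<xi>) * m \<xi>))"
        by (intro integrable_iexp_mult m) simp_all
      have 2: "integrable lborel (\<lambda>\<xi>. iexp (x \<bullet> \<xi>) * m \<xi>)"
        by (intro integrable_iexp_mult m) simp_all
      have 3: "integrable lborel (\<lambda>\<xi>. iexp (x \<bullet> \<xi>) * (\<i> * complex_of_real (\<xi> \<bullet> h) * m \<xi>))"
        by (intro integrable_iexp_mult i) simp_all
      show ?thesis
        unfolding fourier_shift unfolding fourier_def Bochner_Integration.integral_diff[OF 1 2, symmetric]
          Bochner_Integration.integral_diff[OF Bochner_Integration.integrable_diff[OF 1 2] 3, symmetric]
        by (intro Bochner_Integration.integral_cong refl) (simp add: algebra_simps inner_commute[of h])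
    qed
    have "norm (fourier m (x + h) - fourier m x - ?g h) \<le>
      (\<integral>\<xi>. norm (iexp (x \<bullet> \<xi>) * ((iexp (h \<bullet> \<xi>) - 1 - \<i> * complex_of_real (h \<bullet> \<xi>)) * m \<xi>)) \<partial>lborel)"
      unfolding eq by (rule integral_norm_bound)
    also have "\<dots> \<le> (\<integral>\<xi>. (norm h)\<^sup>2 / 2 * ((norm \<xi>)\<^sup>2 * norm (m \<xi>)) \<partial>lborel)"
    proof (rule integral_mono_AE')
      show "integrable lborel (\<lambda>\<xi>. (norm h)\<^sup>2 / 2 * ((norm \<xi>)\<^sup>2 * norm (m \<xi>)))" using m2 by auto
      show "AE \<xi> in lborel. norm (iexp (x \<bullet> \<xi>) * ((iexp (h \<bullet> \<xi>) - 1 - \<i> * complex_of_real (h \<bullet> \<xi>)) * m \<xi>))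
        \<le> (norm h)\<^sup>2 / 2 * ((norm \<xi>)\<^sup>2 * norm (m \<xi>))"
      proof (rule AE_I2)
        fix \<xi> :: 'a
        have "norm (iexp (h \<bullet> \<xi>) - 1 - \<i> * complex_of_real (h \<bullet> \<xi>)) \<le> \<bar>h \<bullet> \<xi>\<bar>\<^sup>2 / 2"
          using iexp_approx1[of "h \<bullet> \<xi>" 1] by (simp add: numeral_2_eq_2 algebra_simps)
        also have "\<dots> \<le> (norm h * norm \<xi>)\<^sup>2 / 2"
          by (intro divide_right_mono power_mono Cauchy_Schwarz_ineq2) auto
        finally have "norm (iexp (h \<bullet> \<xi>) - 1 - \<i> * complex_of_real (h \<bullet> \<xi>)) * norm (m \<xi>) \<le> (norm h * norm \<xi>)\<^sup>2 / 2 * norm (m \<xi>)"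
          by (intro mult_right_mono) auto
        then show "norm (iexp (x \<bullet> \<xi>) * ((iexp (h \<bullet> \<xi>) - 1 - \<i> * complex_of_real (h \<bullet> \<xi>)) * m \<xi>))
        \<le> (norm h)\<^sup>2 / 2 * ((norm \<xi>)\<^sup>2 * norm (m \<xi>))"
          by (simp add: norm_mult power_mult_distrib)
      qed
    qed auto
    also have "\<dots> = ?C * (norm h)\<^sup>2" by simp
    finally have "norm (fourier m (x + h) - fourier m x - ?g h) \<le> ?C * (norm h)\<^sup>2" .
    moreover have "Re (fourier m (x + h)) - Re (fourier m x) - h \<bullet> ?D = Re (fourier m (x + h) - fourier m x - ?g h)"
      by (simp only: gD[symmetric] minus_complex.sel)
    ultimately show ?thesis
      using abs_Re_le_cmod[of "fourier m (x + h) - fourier m x - ?g h"] by linarith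
  qed
  show "GDERIV (\<lambda>x. Re (fourier m x)) x :> ?D"
    unfolding gderiv_def has_derivative_at
  proof (intro conjI)
    show "bounded_linear (\<lambda>h. h \<bullet> ?D)" by (rule bounded_linear_inner_left)
    show "(\<lambda>h. norm (Re (fourier m (x + h)) - Re (fourier m x) - h \<bullet> ?D) / norm h) \<midarrow>0\<rightarrow> 0"
    proof (rule Lim_null_comparison[OF always_eventually])
      show "\<forall>h. norm (norm (Re (fourier m (x + h)) - Re (fourier m x) - h \<bullet> ?D) / norm h) \<le> ?C * norm h"
      proof
        fix h :: 'a
        have "norm (Re (fourier m (x + h)) - Re (fourier m x) - h \<bullet> ?D) / norm h \<le> ?C * (norm h)\<^sup>2 / norm h"
          using bound[of h] by (intro divide_right_mono) auto
        then show "norm (norm (Re (fourier m (x + h)) - Re (fourier m x) - h \<bullet> ?D) / norm h) \<le> ?C * norm h"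
          by (cases "h = 0") (auto simp: power2_eq_square)
      qed
      have "(\<lambda>h::'a. ?C * norm h) \<midarrow>0\<rightarrow> ?C * norm (0::'a)" by (intro tendsto_intros)
      then show "(\<lambda>h::'a. ?C * norm h) \<midarrow>0\<rightarrow> 0" by simp
    qed
  qed
qed

text \<open>Integration by parts without boundary terms: the increment
  \<open>h (x + b) - h x\<close> integrates to 0 by translation invariance, while Fubini applied to
  its integral along the segment yields the integral of \<open>h'\<close>.\<close>

lemma integral_directional_derivative:
  fixes h h' :: "'a::euclidean_space \<Rightarrow> complex"
  assumes h: "integrable lborel h" and h': "integrable lborel h'"
    and der: "\<And>x. ((\<lambda>s. h (x + s *\<^sub>R b)) has_vector_derivative h' x) (at 0)"
    and cont: "continuous_on UNIV h'"
  shows "(CLINT x|lborel. h' x) = 0"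
proof -
  have [measurable]: "h \<in> borel_measurable borel" "h' \<in> borel_measurable borel" using h h' by auto
  have der': "((\<lambda>s. h (x + s *\<^sub>R b)) has_vector_derivative h' (x + s *\<^sub>R b)) (at s)" for x s
  proof -
    have "((\<lambda>r. h ((x + s *\<^sub>R b) + r *\<^sub>R b)) \<circ> (\<lambda>r. r - s) has_vector_derivative 1 *\<^sub>R h' (x + s *\<^sub>R b)) (at s)"
      by (rule vector_diff_chain_at) (auto intro!: derivative_eq_intros der)
    then show ?thesis by (simp add: comp_def algebra_simps)
  qed
  let ?k = "\<lambda>(s::real) x. indicator {0..1} s *\<^sub>R h' (x + s *\<^sub>R b)"
  have ftc: "(\<integral>s. ?k s x \<partial>lborel) = h (x + b) - h x" for x
  proof -
    have "continuous_on {0..1} (\<lambda>s. h' (x + s *\<^sub>R b))"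
      by (rule continuous_on_compose2[OF cont]) (auto intro!: continuous_intros)
    from integral_FTC_Icc[OF zero_le_one has_vector_derivative_at_within[OF der'] this] show ?thesis by simp
  qed
  have "integrable (lborel \<Otimes>\<^sub>M lborel) (\<lambda>(s, x). ?k s x)"
  proof (rule lborel_pair.Fubini_integrable)
    have eq: "(\<integral>x. norm (case (s, x) of (s, x) \<Rightarrow> ?k s x) \<partial>lborel) = indicator {0..1} s *\<^sub>R (\<integral>x. norm (h' x) \<partial>lborel)" for s
      using integral_lborel_translate[of "\<lambda>x. norm (h' x)"] by simp
    show "integrable lborel (\<lambda>s. \<integral>x. norm (case (s, x) of (s, x) \<Rightarrow> ?k s x) \<partial>lborel)"
      unfolding eq by simp
    show "AE s in lborel. integrable lborel (\<lambda>x. case (s, x) of (s, x) \<Rightarrow> ?k s x)"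
      using integrable_lborel_translate[OF h'] by (intro AE_I2) auto
  qed measurable
  from lborel_pair.Fubini_integral[OF this]
  have "(CLINT x|lborel. h (x + b) - h x) = (CLINT s|lborel. \<integral>x. ?k s x \<partial>lborel)"
    unfolding ftc .
  also have "\<dots> = (CLINT x|lborel. h' x)"
    by (simp add: integral_lborel_translate)
  also have "(CLINT x|lborel. h (x + b) - h x) = 0"
    using h integrable_lborel_translate[OF h] by (simp add: integral_lborel_translate)
  finally show ?thesis by simp
qed

subsection \<open>The symbol of the fractional gradient\<close>

lemma sum_Basis_inner_complex:
  "(\<Sum>b\<in>Basis. complex_of_real (x \<bullet> b) * (c * complex_of_real (y \<bullet> b))) = c * complex_of_real (y \<bullet> x)"
  by (simp add: euclidean_inner[of y x] sum_distrib_left mult_ac)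

locale stable_levy =
  fixes \<alpha> :: real and \<sigma> :: "'a::euclidean_space measure"
  assumes \<alpha>: "1 < \<alpha>" "\<alpha> < 2" and sym: "symmetric_sphere_measure \<sigma>"
begin

lemma sets_\<sigma>: "sets \<sigma> = sets (restrict_space borel (sphere 0 1))"
  using sym by (simp add: symmetric_sphere_measure_def)

lemma space_\<sigma>: "space \<sigma> = sphere 0 1"
  using sets_eq_imp_space_eq[OF sets_\<sigma>] by (simp add: space_restrict_space)

lemma norm_\<sigma>: "y \<in> space \<sigma> \<Longrightarrow> norm y = 1"
  by (simp add: space_\<sigma>)

sublocale \<sigma>: finite_measure \<sigma>
  using sym by (simp add: symmetric_sphere_measure_def)

lemma measurable_id_\<sigma> [measurable]: "(\<lambda>y. y) \<in> borel_measurable \<sigma>"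
  using measurable_restrict_space1[OF measurable_ident, of borel "sphere 0 1"]
  by (simp add: measurable_cong_sets[OF sets_\<sigma> refl] id_def)

lemma measurable_uminus_\<sigma> [measurable]: "uminus \<in> \<sigma> \<rightarrow>\<^sub>M \<sigma>"
proof -
  have "uminus \<in> \<sigma> \<rightarrow>\<^sub>M restrict_space borel (sphere 0 1)"
    by (rule measurable_restrict_space2) (auto simp: space_\<sigma> intro!: borel_measurable_uminus measurable_id_\<sigma>)
  then show ?thesis by (simp add: measurable_cong_sets[OF refl sets_\<sigma>])
qed

lemma distr_uminus_\<sigma>: "distr \<sigma> \<sigma> uminus = \<sigma>"
proof (rule measure_eqI)
  fix A assume "A \<in> sets (distr \<sigma> \<sigma> uminus)"
  then have A: "A \<in> sets \<sigma>" by simp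
  have "uminus -` A \<inter> space \<sigma> = uminus ` A"
  proof (intro equalityI subsetI)
    fix x assume "x \<in> uminus -` A \<inter> space \<sigma>"
    then have "- x \<in> A" by simp
    then show "x \<in> uminus ` A" by (metis image_eqI minus_minus)
  next
    fix x assume "x \<in> uminus ` A"
    then show "x \<in> uminus -` A \<inter> space \<sigma>"
      using sets.sets_into_space[OF A] by (auto simp: space_\<sigma>)
  qed
  then show "emeasure (distr \<sigma> \<sigma> uminus) A = emeasure \<sigma> A"
    using A sym by (simp add: emeasure_distr symmetric_sphere_measure_def)
qed simp

section \<open>Polar coordinates for the Levy measure\<close>

definition radial :: "real measure" where
  "radial = density lborel (\<lambda>r. ennreal (indicator {0<..} r * r powr (- \<alpha> - 1)))"

lemma sets_radial [simp, measurable_cong]: "sets radial = sets borel"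
  by (simp add: radial_def)

lemma space_radial [simp]: "space radial = UNIV"
  by (simp add: radial_def)

sublocale radial: sigma_finite_measure radial
  unfolding radial_def
  by (subst sigma_finite_measure.sigma_finite_iff_density_finite[OF sigma_finite_lborel]) auto

sublocale polar: pair_sigma_finite \<sigma> radial ..

abbreviation polar :: "('a \<times> real) measure" where
  "polar \<equiv> \<sigma> \<Otimes>\<^sub>M radial"

lemma sigma_finite_polar: "sigma_finite_measure polar"
  by (rule sigma_finite_pair_measure) unfold_locales

definition ray :: "'a \<times> real \<Rightarrow> 'a" where
  "ray z = snd z *\<^sub>R fst z"

lemma measurable_ray [measurable]: "ray \<in> borel_measurable polar"
  unfolding ray_def
  by (intro borel_measurable_scaleR measurable_compose[OF measurable_fst measurable_id_\<sigma>]) measurable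

lemma integral_radial:
  fixes f :: "real \<Rightarrow> 'b::{banach,second_countable_topology}"
  assumes [measurable]: "f \<in> borel_measurable borel"
  shows "(\<integral>r. f r \<partial>radial) = (LINT r:{0<..}|lborel. r powr (- \<alpha> - 1) *\<^sub>R f r)"
    and "integrable radial f \<longleftrightarrow> set_integrable lborel {0<..} (\<lambda>r. r powr (- \<alpha> - 1) *\<^sub>R f r)"
  by (auto simp: radial_def integral_density integrable_density set_lebesgue_integral_def set_integrable_def
      intro!: Bochner_Integration.integral_cong arg_cong[where f="integrable lborel"])

text \<open>As the image of a product of two sigma-finite measures, the Levy measure becomes
  accessible to Fubini.\<close>

lemma stable_levy_measure_eq: "stable_levy_measure \<alpha> \<sigma> = distr polar borel ray"
proof (rule measure_eqI)
  fix A assume "A \<in> sets (stable_levy_measure \<alpha> \<sigma>)"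
  then have A [measurable]: "A \<in> sets borel" by simp
  have "emeasure (distr polar borel ray) A = (\<integral>\<^sup>+z. indicator A (ray z) \<partial>polar)"
    by (subst nn_integral_indicator[symmetric], simp, subst nn_integral_distr) auto
  also have "\<dots> = (\<integral>\<^sup>+y. \<integral>\<^sup>+r. indicator A (r *\<^sub>R y) \<partial>radial \<partial>\<sigma>)"
    by (subst radial.nn_integral_fst[symmetric]) (auto simp: ray_def)
  also have "\<dots> = (\<integral>\<^sup>+y. (\<integral>\<^sup>+r\<in>{0<..}. indicator A (r *\<^sub>R y) * ennreal (1 / r powr (\<alpha> + 1)) \<partial>lborel) \<partial>\<sigma>)"
  proof (intro nn_integral_cong)
    fix y
    have [measurable]: "(\<lambda>r::real. indicator A (r *\<^sub>R y) :: ennreal) \<in> borel_measurable borel"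
      by (rule measurable_compose[OF _ borel_measurable_indicator[OF A]]) measurable
    show "(\<integral>\<^sup>+r. indicator A (r *\<^sub>R y) \<partial>radial) = (\<integral>\<^sup>+r\<in>{0<..}. indicator A (r *\<^sub>R y) * ennreal (1 / r powr (\<alpha> + 1)) \<partial>lborel)"
      unfolding radial_def
      by (subst nn_integral_density)
         (auto intro!: nn_integral_cong simp: indicator_def powr_minus_divide[symmetric])
  qed
  finally show "emeasure (stable_levy_measure \<alpha> \<sigma>) A = emeasure (distr polar borel ray) A"
    by (simp add: emeasure_stable_levy_measure[OF sym A])
qed simp

text \<open>The common majorant for integrands that are quadratic at the origin and linear at
  infinity; its integrability is where 1 < \<alpha> < 2 enters.\<close>

definition weight :: "'a \<Rightarrow> real" where
  "weight u = min (norm u) ((norm u)\<^sup>2)"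

lemma weight_nonneg: "0 \<le> weight u"
  by (simp add: weight_def)

lemma measurable_weight [measurable]: "weight \<in> borel_measurable borel"
  unfolding weight_def by measurable

lemma integrable_weight: "integrable polar (\<lambda>z. weight (ray z))"
proof -
  have w: "weight (ray (y, r)) = min r (r\<^sup>2)" if "y \<in> space \<sigma>" "0 < r" for y r
    using that norm_\<sigma>[of y] by (simp add: weight_def ray_def)
  have S: "set_integrable lborel {0<..} (\<lambda>r. r powr (- \<alpha> - 1) *\<^sub>R min r (r\<^sup>2))"
  proof (rule set_integrable_half_line[where K=1 and a="1 - \<alpha>" and b="- \<alpha>"])
    fix r :: real assume r: "0 < r"
    have "r powr (- \<alpha> - 1) * r\<^sup>2 = r powr (- \<alpha> - 1) * r powr 2" using r by simp
    also have "\<dots> = r powr (1 - \<alpha>)" by (subst powr_add[symmetric]) simp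
    finally have 1: "r powr (- \<alpha> - 1) * r\<^sup>2 = r powr (1 - \<alpha>)" .
    have "r powr (- \<alpha> - 1) * min r (r\<^sup>2) \<le> r powr (- \<alpha> - 1) * r\<^sup>2"
      by (intro mult_left_mono) auto
    then show "\<bar>r powr (- \<alpha> - 1) *\<^sub>R min r (r\<^sup>2)\<bar> \<le> 1 * r powr (1 - \<alpha>)"
      using r 1 by (simp add: abs_mult)
  next
    fix r :: real assume r: "1 < r"
    have "r powr (- \<alpha> - 1) * r = r powr (- \<alpha> - 1) * r powr 1" using r by simp
    also have "\<dots> = r powr (- \<alpha>)" by (subst powr_add[symmetric]) simp
    finally have 1: "r powr (- \<alpha> - 1) * r = r powr (- \<alpha>)" .
    have "r powr (- \<alpha> - 1) * min r (r\<^sup>2) \<le> r powr (- \<alpha> - 1) * r"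
      by (intro mult_left_mono) auto
    then show "\<bar>r powr (- \<alpha> - 1) *\<^sub>R min r (r\<^sup>2)\<bar> \<le> 1 * r powr (- \<alpha>)"
      using r 1 by (simp add: abs_mult)
  qed (use \<alpha> in auto)
  have m: "(\<lambda>r. weight (ray (y, r))) \<in> borel_measurable borel" for y
    unfolding ray_def by simp
  have eq: "set_integrable lborel {0<..} (\<lambda>r. r powr (- \<alpha> - 1) *\<^sub>R weight (ray (y, r)))" if "y \<in> space \<sigma>" for y
    using S by (rule set_integrable_cong[THEN iffD1, OF refl refl, rotated]) (use w that in auto)
  have val: "(\<integral>r. weight (ray (y, r)) \<partial>radial) = (LINT r:{0<..}|lborel. r powr (- \<alpha> - 1) *\<^sub>R min r (r\<^sup>2))" if "y \<in> space \<sigma>" for y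
    unfolding integral_radial(1)[OF m]
    by (rule set_lebesgue_integral_cong) (use w that in auto)
  show ?thesis
  proof (rule polar.Fubini_integrable)
    show "AE y in \<sigma>. integrable radial (\<lambda>r. weight (ray (y, r)))"
      using eq by (intro AE_I2) (simp add: integral_radial(2)[OF m])
    have "integrable \<sigma> (\<lambda>y. LINT r:{0<..}|lborel. r powr (- \<alpha> - 1) *\<^sub>R min r (r\<^sup>2))" by simp
    then show "integrable \<sigma> (\<lambda>y. \<integral>r. norm (weight (ray (y, r))) \<partial>radial)"
      by (rule Bochner_Integration.integrable_cong[THEN iffD1, OF refl, rotated])
         (use val in \<open>auto simp: abs_of_nonneg weight_nonneg\<close>)
  qed measurable
qed

text \<open>The component along \<open>b\<close> of the multiplier of D^(\<alpha>-1).\<close>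

definition levy_symbol :: "'a \<Rightarrow> 'a \<Rightarrow> complex" where
  "levy_symbol b \<xi> = (CLINT z|polar. (iexp (ray z \<bullet> \<xi>) - 1) * complex_of_real (ray z \<bullet> b))"

text \<open>The bound 2 for the modulus of exp(it) - 1 is used on large u and the bound |t| on small
  u; the factor \<open>1 + norm \<xi>\<close> accommodates both.\<close>

lemma norm_levy_integrand:
  "norm ((iexp (u \<bullet> \<xi>) - 1) * complex_of_real (u \<bullet> b)) \<le> 2 * norm b * (1 + norm \<xi>) * weight u"
proof -
  have 1: "norm ((iexp (u \<bullet> \<xi>) - 1) * complex_of_real (u \<bullet> b)) \<le> norm (iexp (u \<bullet> \<xi>) - 1) * (norm u * norm b)"
    by (simp add: norm_mult mult_left_mono Cauchy_Schwarz_ineq2)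
  have "norm (iexp (u \<bullet> \<xi>) - 1) * norm u \<le> 2 * (1 + norm \<xi>) * weight u"
  proof (cases "1 \<le> norm u")
    case True
    then have "weight u = norm u"
      using mult_left_mono[of 1 "norm u" "norm u"] by (simp add: weight_def power2_eq_square)
    moreover have "norm (iexp (u \<bullet> \<xi>) - 1) * norm u \<le> 2 * norm u"
      by (intro mult_right_mono norm_iexp_minus_1_le_2) auto
    moreover have "2 * norm u \<le> 2 * (1 + norm \<xi>) * norm u" by (intro mult_right_mono) auto
    ultimately show ?thesis by simp
  next
    case False
    then have w: "weight u = (norm u)\<^sup>2" by (simp add: weight_def power2_eq_square mult_left_le)
    have "norm (iexp (u \<bullet> \<xi>) - 1) * norm u \<le> (norm u * norm \<xi>) * norm u"
      by (intro mult_right_mono order_trans[OF norm_iexp_minus_1_le] Cauchy_Schwarz_ineq2) auto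
    also have "\<dots> = norm \<xi> * (norm u)\<^sup>2" by (simp add: power2_eq_square)
    also have "\<dots> \<le> 2 * (1 + norm \<xi>) * (norm u)\<^sup>2" by (intro mult_right_mono) auto
    finally show ?thesis unfolding w .
  qed
  then have "norm (iexp (u \<bullet> \<xi>) - 1) * norm u * norm b \<le> 2 * (1 + norm \<xi>) * weight u * norm b"
    by (intro mult_right_mono) auto
  with 1 show ?thesis by (simp add: mult_ac)
qed

lemma integrable_levy_integrand:
  "integrable polar (\<lambda>z. (iexp (ray z \<bullet> \<xi>) - 1) * complex_of_real (ray z \<bullet> b))"
proof (rule Bochner_Integration.integrable_bound)
  show "integrable polar (\<lambda>z. 2 * norm b * (1 + norm \<xi>) * weight (ray z))"
    using integrable_weight by auto
  show "AE z in polar. norm ((iexp (ray z \<bullet> \<xi>) - 1) * complex_of_real (ray z \<bullet> b))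
      \<le> norm (2 * norm b * (1 + norm \<xi>) * weight (ray z))"
    unfolding real_norm_def by (intro AE_I2 order_trans[OF norm_levy_integrand abs_ge_self])
qed measurable

lemma norm_levy_symbol_le:
  "norm (levy_symbol b \<xi>) \<le> 2 * norm b * (1 + norm \<xi>) * (\<integral>z. weight (ray z) \<partial>polar)"
proof -
  have "norm (levy_symbol b \<xi>) \<le> (\<integral>z. 2 * norm b * (1 + norm \<xi>) * weight (ray z) \<partial>polar)"
    unfolding levy_symbol_def
    by (rule order_trans[OF integral_norm_bound integral_mono_AE'])
       (use integrable_weight in \<open>auto intro!: norm_levy_integrand AE_I2 mult_nonneg_nonneg weight_nonneg\<close>)
  then show ?thesis by simp
qed

lemma continuous_levy_symbol: "continuous_on UNIV (levy_symbol b)"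
proof -
  have "isCont (levy_symbol b) \<xi>" for \<xi>
    unfolding isCont_def tendsto_at_iff_sequentially comp_def
  proof (intro allI impI)
    fix X :: "nat \<Rightarrow> 'a" assume X: "X \<longlonglongrightarrow> \<xi>"
    obtain R where R: "norm (X n) \<le> R" for n
      using convergent_imp_bounded[OF X] by (auto simp: bounded_iff)
    show "(\<lambda>n. levy_symbol b (X n)) \<longlonglongrightarrow> levy_symbol b \<xi>"
      unfolding levy_symbol_def
    proof (rule integral_dominated_convergence[where w="\<lambda>z. 2 * norm b * (1 + R) * weight (ray z)"])
      show "integrable polar (\<lambda>z. 2 * norm b * (1 + R) * weight (ray z))"
        using integrable_weight by auto
      show "AE z in polar. norm ((iexp (ray z \<bullet> X n) - 1) * complex_of_real (ray z \<bullet> b))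
          \<le> 2 * norm b * (1 + R) * weight (ray z)" for n
        using R[of n] by (intro AE_I2 order_trans[OF norm_levy_integrand])
          (auto intro!: mult_right_mono mult_left_mono weight_nonneg)
    qed (auto intro!: AE_I2 tendsto_intros X)
  qed
  then show ?thesis by (simp add: continuous_at_imp_continuous_on)
qed

lemma measurable_levy_symbol [measurable]: "levy_symbol b \<in> borel_measurable borel"
  by (rule borel_measurable_continuous_onI) (rule continuous_levy_symbol)

text \<open>Fubini exchanges the Levy integral with the Fourier integral. The first moment of
  \<open>m\<close> pays for the linear growth of the symbol.\<close>

lemma
  assumes m: "integrable lborel m" and m1: "integrable lborel (\<lambda>\<xi>. norm \<xi> * norm (m \<xi>))"
  shows integrable_levy_symbol_mult: "integrable lborel (\<lambda>\<xi>. levy_symbol b \<xi> * m \<xi>)"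
    and frac_gradient_fourier: "frac_gradient \<alpha> \<sigma> (\<lambda>x. Re (fourier m x)) x =
      (\<Sum>b\<in>Basis. Re (fourier (\<lambda>\<xi>. levy_symbol b \<xi> * m \<xi>) x) *\<^sub>R b)"
proof -
  have [measurable]: "m \<in> borel_measurable borel" using m by auto
  interpret PL: pair_sigma_finite polar "lborel :: 'a measure"
    by (intro pair_sigma_finite.intro sigma_finite_polar sigma_finite_lborel)
  let ?f = "\<lambda>x. Re (fourier m x)"
  let ?K = "\<lambda>b z \<xi>. (iexp (ray z \<bullet> \<xi>) - 1) * complex_of_real (ray z \<bullet> b) * m \<xi>"
  have I: "integrable (polar \<Otimes>\<^sub>M lborel) (\<lambda>(z, \<xi>). ?K b z \<xi>)" for b
  proof (rule Bochner_Integration.integrable_bound)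
    have "integrable lborel (\<lambda>\<xi>. 2 * norm b * (norm (m \<xi>) + norm \<xi> * norm (m \<xi>)))"
      using m m1 by auto
    from PL.integrable_pair_mult[OF integrable_weight this]
    show "integrable (polar \<Otimes>\<^sub>M lborel) (\<lambda>(z, \<xi>). weight (ray z) * (2 * norm b * (norm (m \<xi>) + norm \<xi> * norm (m \<xi>))))" .
    have "norm (?K b z \<xi>) \<le> weight (ray z) * (2 * norm b * (norm (m \<xi>) + norm \<xi> * norm (m \<xi>)))" for z \<xi>
    proof -
      have "norm (?K b z \<xi>) \<le> (2 * norm b * (1 + norm \<xi>) * weight (ray z)) * norm (m \<xi>)"
        unfolding norm_mult[of _ "m \<xi>"] by (intro mult_right_mono norm_levy_integrand) auto
      then show ?thesis by (simp add: algebra_simps)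
    qed
    then show "AE x in polar \<Otimes>\<^sub>M lborel. norm (case x of (z, \<xi>) \<Rightarrow> ?K b z \<xi>) \<le>
        norm (case x of (z, \<xi>) \<Rightarrow> weight (ray z) * (2 * norm b * (norm (m \<xi>) + norm \<xi> * norm (m \<xi>))))"
      by (intro AE_I2) (auto intro: order_trans[OF _ abs_ge_self])
  qed measurable
  have 1: "Re (fourier (?K b z) x) = (?f (x + ray z) - ?f x) * (ray z \<bullet> b)" for b z
  proof -
    have "fourier (?K b z) x = (CLINT \<xi>|lborel. complex_of_real (ray z \<bullet> b) * (iexp (x \<bullet> \<xi>) * (iexp (ray z \<bullet> \<xi>) * m \<xi>) - iexp (x \<bullet> \<xi>) * m \<xi>))"
      unfolding fourier_def by (intro Bochner_Integration.integral_cong) (auto simp: algebra_simps)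
    also have "\<dots> = complex_of_real (ray z \<bullet> b) * (fourier m (x + ray z) - fourier m x)"
      unfolding fourier_shift[of m x] unfolding fourier_def integral_mult_right_zero
      by (subst Bochner_Integration.integral_diff) (auto intro!: integrable_iexp_mult m)
    finally show ?thesis by simp
  qed
  have 2: "(CLINT z|polar. ?K b z \<xi>) = levy_symbol b \<xi> * m \<xi>" for b \<xi>
    unfolding levy_symbol_def by (rule integral_mult_left_zero)
  note Fub = sigma_finite_measure.fourier_Fubini[OF sigma_finite_polar]
  note F = Fub(1)[OF I, where x=x, unfolded 1] Fub(2)[OF I, unfolded 2] Fub(3)[OF I, where x=x, unfolded 1 2]
  show "integrable lborel (\<lambda>\<xi>. levy_symbol b \<xi> * m \<xi>)" by (rule F(2))
  have eq: "(?f (x + ray z) - ?f x) *\<^sub>R ray z = (\<Sum>b\<in>Basis. ((?f (x + ray z) - ?f x) * (ray z \<bullet> b)) *\<^sub>R b)" for z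
    using euclidean_representation[of "(?f (x + ray z) - ?f x) *\<^sub>R ray z"] by simp
  have "frac_gradient \<alpha> \<sigma> ?f x = (\<integral>z. (?f (x + ray z) - ?f x) *\<^sub>R ray z \<partial>polar)"
    unfolding frac_gradient_def stable_levy_measure_eq by (rule integral_distr) measurable
  also have "\<dots> = (\<Sum>b\<in>Basis. (\<integral>z. (?f (x + ray z) - ?f x) * (ray z \<bullet> b) \<partial>polar) *\<^sub>R b)"
    unfolding eq by (subst Bochner_Integration.integral_sum) (auto intro!: sum.cong integral_scaleR_left integrable_scaleR_left F(1))
  finally show "frac_gradient \<alpha> \<sigma> ?f x = (\<Sum>b\<in>Basis. Re (fourier (\<lambda>\<xi>. levy_symbol b \<xi> * m \<xi>) x) *\<^sub>R b)"
    by (simp only: F(3))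
qed

definition kappa :: real where
  "kappa = - cos (\<alpha> * pi / 2) * (Gamma (2 - \<alpha>) / (\<alpha> * (\<alpha> - 1)))"

definition psi :: "'a \<Rightarrow> real" where
  "psi \<xi> = kappa * (\<integral>y. \<bar>y \<bullet> \<xi>\<bar> powr \<alpha> \<partial>\<sigma>)"

lemma kappa_pos: "0 < kappa"
proof -
  have "0 < sin (\<alpha> * pi / 2 - pi / 2)" using \<alpha> by (intro sin_gt_zero) (auto simp: field_simps)
  then have "0 < - cos (\<alpha> * pi / 2)" by (simp add: sin_diff)
  moreover have "0 < Gamma (2 - \<alpha>)" using \<alpha> by (intro Gamma_real_pos) auto
  ultimately show ?thesis unfolding kappa_def using \<alpha> by (intro mult_pos_pos divide_pos_pos) auto
qed

lemma psi_nonneg: "0 \<le> psi \<xi>"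
  unfolding psi_def using kappa_pos by (intro mult_nonneg_nonneg integral_nonneg_AE) auto

lemma integrable_abs_powr: "integrable \<sigma> (\<lambda>y. \<bar>y \<bullet> \<xi>\<bar> powr \<alpha>)"
proof (rule \<sigma>.integrable_const_bound[where B="norm \<xi> powr \<alpha>"])
  show "AE y in \<sigma>. norm (\<bar>y \<bullet> \<xi>\<bar> powr \<alpha>) \<le> norm \<xi> powr \<alpha>"
  proof (rule AE_I2)
    fix y assume "y \<in> space \<sigma>"
    then show "norm (\<bar>y \<bullet> \<xi>\<bar> powr \<alpha>) \<le> norm \<xi> powr \<alpha>"
      using Cauchy_Schwarz_ineq2[of y \<xi>] norm_\<sigma>[of y] \<alpha> by (auto intro!: powr_mono2)
  qed
qed measurable

lemma integral_spectral: "(\<integral>y. \<bar>y \<bullet> \<xi>\<bar> powr \<alpha> \<partial>(spectral_measure \<alpha> \<sigma>)) = psi \<xi>"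
proof -
  have "(\<integral>\<^sup>+y. ennreal (\<bar>y \<bullet> \<xi>\<bar> powr \<alpha>) \<partial>(spectral_measure \<alpha> \<sigma>)) = ennreal kappa * (\<integral>\<^sup>+y. ennreal (\<bar>y \<bullet> \<xi>\<bar> powr \<alpha>) \<partial>\<sigma>)"
    unfolding spectral_measure_def kappa_def by (rule nn_integral_scale_measure) measurable
  also have "\<dots> = ennreal (psi \<xi>)"
    using kappa_pos unfolding psi_def
    by (subst nn_integral_eq_integral[OF integrable_abs_powr]) (auto simp: ennreal_mult)
  finally have nn: "(\<integral>\<^sup>+y. ennreal (\<bar>y \<bullet> \<xi>\<bar> powr \<alpha>) \<partial>(spectral_measure \<alpha> \<sigma>)) = ennreal (psi \<xi>)" .
  have "(\<lambda>y. \<bar>y \<bullet> \<xi>\<bar> powr \<alpha>) \<in> borel_measurable (spectral_measure \<alpha> \<sigma>)"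
    unfolding spectral_measure_def measurable_cong_sets[OF sets_scale_measure refl] by measurable
  then show ?thesis
    using nn psi_nonneg[of \<xi>] by (subst integral_eq_nn_integral) auto
qed

lemma stable_norm_powr: "stable_norm \<alpha> \<sigma> \<xi> powr \<alpha> = psi \<xi>"
  using \<alpha> psi_nonneg[of \<xi>] by (simp add: stable_norm_def integral_spectral powr_powr)

lemma psi_scaleR: "psi (c *\<^sub>R \<xi>) = \<bar>c\<bar> powr \<alpha> * psi \<xi>"
  unfolding psi_def by (simp add: abs_mult powr_mult)

text \<open>Scaling by a > 0 reduces this to the sine integral, and the integrand is even in
  a.\<close>

lemma radial_sin_integral:
  "(\<integral>r. sin (r * a) * (r * a) \<partial>radial) = \<bar>a\<bar> powr \<alpha> * (- cos (\<alpha> * pi / 2) * (Gamma (2 - \<alpha>) / (\<alpha> - 1)))"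
  (is "_ = _ * ?C")
proof -
  have pos: "(\<integral>r. sin (r * a) * (r * a) \<partial>radial) = a powr \<alpha> * ?C" if a: "0 < a" for a
  proof -
    let ?g = "\<lambda>r. indicator {0<..} r *\<^sub>R (sin r * r powr (- \<alpha>)) :: real"
    have "(\<integral>r. sin (r * a) * (r * a) \<partial>radial) = (\<integral>r. a powr (\<alpha> + 1) * ?g (0 + a * r) \<partial>lborel)"
      unfolding integral_radial(1)[of "\<lambda>r. sin (r * a) * (r * a)", simplified] set_lebesgue_integral_def
    proof (intro Bochner_Integration.integral_cong refl)
      fix r :: real
      show "indicator {0<..} r *\<^sub>R (r powr (- \<alpha> - 1) * (sin (r * a) * (r * a))) = a powr (\<alpha> + 1) * ?g (0 + a * r)"
      proof (cases "0 < r")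
        case True
        have "r powr (- \<alpha> - 1) * r = r powr (- \<alpha> - 1) * r powr 1" using True by simp
        also have "\<dots> = r powr (- \<alpha>)" by (subst powr_add[symmetric]) simp
        finally have 1: "r powr (- \<alpha> - 1) * r = r powr (- \<alpha>)" .
        have "a powr (\<alpha> + 1) * a powr (- \<alpha>) = a"
          using a by (subst powr_add[symmetric]) simp
        then have "a powr (\<alpha> + 1) * (a * r) powr (- \<alpha>) = a * r powr (- \<alpha>)"
          using a True by (simp add: powr_mult)
        then have "a powr (\<alpha> + 1) * (sin (a * r) * (a * r) powr (- \<alpha>)) = sin (a * r) * (a * (r powr (- \<alpha> - 1) * r))"
          unfolding 1 by (simp add: mult_ac)
        then show ?thesis using a True by (auto simp: mult_ac)
      qed (use a in \<open>auto simp: zero_less_mult_iff\<close>)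
    qed
    also have "\<dots> = a powr (\<alpha> + 1) * (\<integral>r. ?g (0 + a * r) \<partial>lborel)" by simp
    also have "(\<integral>r. ?g (0 + a * r) \<partial>lborel) = (\<integral>r. ?g r \<partial>lborel) / a"
      using lborel_integral_real_affine[of a ?g 0] a by simp
    also have "(\<integral>r. ?g r \<partial>lborel) = ?C"
      using sin_powr_integral(2)[OF \<alpha>] by (simp add: set_lebesgue_integral_def)
    also have "a powr (\<alpha> + 1) * (?C / a) = a powr \<alpha> * ?C"
      using a by (simp add: powr_add)
    finally show ?thesis .
  qed
  consider "0 < a" | "a = 0" | "a < 0" by linarith
  then show ?thesis
  proof cases
    case 3
    then show ?thesis using pos[of "- a"] by simp
  qed (use pos in auto)
qed

text \<open>The real part has an integrand odd in the direction y, so the symmetry of \<sigma>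
  removes it. The imaginary part is, in each direction, the scaled sine integral, whose value is
  \<alpha> \<open>kappa\<close> |<y, \<xi>>|^\<alpha>.\<close>

lemma levy_symbol_inner: "(\<Sum>b\<in>Basis. complex_of_real (\<xi> \<bullet> b) * levy_symbol b \<xi>) = \<i> * complex_of_real (\<alpha> * psi \<xi>)"
proof -
  let ?G = "\<lambda>z. (iexp (ray z \<bullet> \<xi>) - 1) * complex_of_real (ray z \<bullet> \<xi>)"
  have I: "integrable polar ?G" by (rule integrable_levy_integrand)
  have "(\<Sum>b\<in>Basis. complex_of_real (\<xi> \<bullet> b) * levy_symbol b \<xi>) =
      (CLINT z|polar. \<Sum>b\<in>Basis. complex_of_real (\<xi> \<bullet> b) * ((iexp (ray z \<bullet> \<xi>) - 1) * complex_of_real (ray z \<bullet> b)))"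
    unfolding levy_symbol_def
    by (subst Bochner_Integration.integral_sum) (auto intro!: integrable_mult_right integrable_levy_integrand simp del: integrable_mult_right_iff)
  also have "\<dots> = (CLINT z|polar. ?G z)"
    by (simp only: sum_Basis_inner_complex)
  also have "\<dots> = \<i> * complex_of_real (\<alpha> * psi \<xi>)"
  proof (rule complex_eqI)
    have "Re (CLINT z|polar. ?G z) = (\<integral>z. Re (?G z) \<partial>polar)"
      by (rule integral_Re[OF I, symmetric])
    also have "\<dots> = (\<integral>y. \<integral>r. Re (?G (y, r)) \<partial>radial \<partial>\<sigma>)"
      by (rule polar.integral_fst'[OF integrable_Re[OF I], symmetric])
    also have "\<dots> = 0"
    proof -
      let ?h = "\<lambda>y. \<integral>r. Re (?G (y, r)) \<partial>radial"
      have odd: "?h (- y) = - ?h y" for y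
      proof -
        have "Re (?G (- y, r)) = - Re (?G (y, r))" for r
          by (simp add: ray_def Re_exp)
        then show ?thesis by (simp only: integral_minus)
      qed
      have m: "?h \<in> borel_measurable \<sigma>" by measurable
      have "(\<integral>y. ?h y \<partial>\<sigma>) = (\<integral>y. ?h y \<partial>(distr \<sigma> \<sigma> uminus))" by (simp only: distr_uminus_\<sigma>)
      also have "\<dots> = (\<integral>y. ?h (- y) \<partial>\<sigma>)" by (rule integral_distr[OF measurable_uminus_\<sigma> m])
      also have "\<dots> = - (\<integral>y. ?h y \<partial>\<sigma>)" unfolding odd by (rule integral_minus)
      finally show ?thesis by linarith
    qed
    finally show "Re (CLINT z|polar. ?G z) = Re (\<i> * complex_of_real (\<alpha> * psi \<xi>))" by simp
    have "Im (CLINT z|polar. ?G z) = (\<integral>z. Im (?G z) \<partial>polar)"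
      by (rule integral_Im[OF I, symmetric])
    also have "\<dots> = (\<integral>y. \<integral>r. Im (?G (y, r)) \<partial>radial \<partial>\<sigma>)"
      by (rule polar.integral_fst'[OF integrable_Im[OF I], symmetric])
    also have "\<dots> = (\<integral>y. \<bar>y \<bullet> \<xi>\<bar> powr \<alpha> * (- cos (\<alpha> * pi / 2) * (Gamma (2 - \<alpha>) / (\<alpha> - 1))) \<partial>\<sigma>)"
    proof (intro Bochner_Integration.integral_cong refl)
      fix y
      have "Im (?G (y, r)) = sin (r * (y \<bullet> \<xi>)) * (r * (y \<bullet> \<xi>))" for r
        by (simp add: ray_def Im_exp)
      then show "(\<integral>r. Im (?G (y, r)) \<partial>radial) = \<bar>y \<bullet> \<xi>\<bar> powr \<alpha> * (- cos (\<alpha> * pi / 2) * (Gamma (2 - \<alpha>) / (\<alpha> - 1)))"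
        by (simp only: radial_sin_integral)
    qed
    also have "\<dots> = \<alpha> * psi \<xi>"
      unfolding psi_def kappa_def using \<alpha> by simp
    finally show "Im (CLINT z|polar. ?G z) = Im (\<i> * complex_of_real (\<alpha> * psi \<xi>))" by simp
  qed
  finally show ?thesis .
qed

end

subsection \<open>Stable laws with a continuous density\<close>

lemma integrable_exp_abs: "0 < (c::real) \<Longrightarrow> integrable lborel (\<lambda>x. exp (- c * \<bar>x\<bar>))"
proof -
  assume c: "0 < c"
  let ?f = "\<lambda>x. indicator {0<..} x *\<^sub>R exp (- (x * c)) :: real"
  have "set_integrable lborel {0<..} (\<lambda>x. x powr (1 - 1) * exp (- (x * c)))"
    using c by (intro Gamma_scaled) auto
  then have "set_integrable lborel {0<..} (\<lambda>x. exp (- (x * c)))"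
    by (rule set_integrable_cong[THEN iffD1, OF refl refl, rotated]) auto
  then have 1: "integrable lborel ?f" by (simp add: set_integrable_def)
  have 2: "integrable lborel (\<lambda>x. ?f (0 + - 1 * x))"
    using 1 by (rule lborel_integrable_real_affine) simp
  show ?thesis
  proof (rule integrable_cong_AE_imp)
    show "integrable lborel (\<lambda>x. ?f x + ?f (0 + - 1 * x))"
      by (rule Bochner_Integration.integrable_add[OF 1 2])
    have "AE x in lborel. x \<noteq> (0::real)" by (rule AE_lborel_singleton)
    then show "AE x in lborel. ?f x + ?f (0 + - 1 * x) = exp (- c * \<bar>x\<bar>)"
      by eventually_elim (auto simp: indicator_def mult.commute)
  qed simp
qed

text \<open>The sum of the coordinate moduli is at most d times the norm, so a product of
  one-dimensional exponentials of rate c/d is a majorant.\<close>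

lemma integrable_exp_norm:
  assumes "0 < c" shows "integrable lborel (\<lambda>x::'a::euclidean_space. exp (- c * norm x))"
proof (rule Bochner_Integration.integrable_bound)
  let ?c = "c / real DIM('a)"
  show "integrable lborel (\<lambda>x::'a. \<Prod>b\<in>Basis. exp (- ?c * \<bar>x \<bullet> b\<bar>))"
    using assms by (intro integrable_lborel_prod integrable_exp_abs) simp
  show "AE x in lborel. norm (exp (- c * norm x)) \<le> norm (\<Prod>b\<in>Basis. exp (- ?c * \<bar>(x::'a) \<bullet> b\<bar>))"
  proof (rule AE_I2)
    fix x :: 'a
    have "(\<Sum>b\<in>Basis. \<bar>x \<bullet> b\<bar>) \<le> (\<Sum>b\<in>(Basis::'a set). norm x)"
      by (intro sum_mono Basis_le_norm)
    then have "?c * (\<Sum>b\<in>Basis. \<bar>x \<bullet> b\<bar>) \<le> ?c * (real DIM('a) * norm x)"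
      using assms by (intro mult_left_mono) auto
    then have "?c * (\<Sum>b\<in>Basis. \<bar>x \<bullet> b\<bar>) \<le> c * norm x" by simp
    then have "exp (- c * norm x) \<le> exp (\<Sum>b\<in>Basis. - ?c * \<bar>x \<bullet> b\<bar>)"
      by (subst exp_le_cancel_iff) (simp add: sum_distrib_left sum_negf)
    then show "norm (exp (- c * norm x)) \<le> norm (\<Prod>b\<in>Basis. exp (- ?c * \<bar>x \<bullet> b\<bar>))"
      by (simp add: exp_sum abs_of_nonneg prod_nonneg)
  qed
qed simp

text \<open>\<open>Lim\<close> is a definite description, so it says nothing before convergence is
  known. A function decreasing in t converges at 0+ to its supremum, which always exists in
  \<open>ennreal\<close>.\<close>

lemma le_Lim_at_right_antimono:
  fixes F :: "real \<Rightarrow> ennreal"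
  assumes mono: "\<And>s t. 0 < s \<Longrightarrow> 0 < t \<Longrightarrow> F (t + s) \<le> F t" and \<epsilon>: "0 < \<epsilon>"
  shows "F \<epsilon> \<le> Lim (at_right 0) F"
proof -
  have mono': "F t \<le> F s" if "0 < s" "s \<le> t" for s t
    using mono[of "t - s" s] that by (cases "s = t") auto
  have "(F \<longlongrightarrow> (SUP t\<in>{0<..}. F t)) (at_right 0)"
  proof (rule order_tendstoI)
    fix a assume "a < (SUP t\<in>{0<..}. F t)"
    then obtain t where t: "0 < t" "a < F t" by (auto simp: less_SUP_iff)
    then have "\<forall>\<^sub>F s in at_right 0. s \<in> {0<..<t}" by (intro eventually_at_right_real)
    then show "\<forall>\<^sub>F s in at_right 0. a < F s"
      by eventually_elim (use mono' t in \<open>auto intro: less_le_trans\<close>)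
  next
    fix a assume a: "(SUP t\<in>{0<..}. F t) < a"
    have "\<forall>\<^sub>F s in at_right 0. s \<in> {0<..<(1::real)}" by (intro eventually_at_right_real) simp
    then show "\<forall>\<^sub>F s in at_right 0. F s < a"
      by eventually_elim (use a in \<open>auto intro: le_less_trans[OF SUP_upper]\<close>)
  qed
  then have "Lim (at_right 0) F = (SUP t\<in>{0<..}. F t)"
    by (intro tendsto_Lim) auto
  then show ?thesis using \<epsilon> by (auto intro: SUP_upper)
qed

locale stable_law = stable_levy \<alpha> \<sigma> for \<alpha> and \<sigma> :: "'a::euclidean_space measure" +
  fixes \<mu> :: "'a measure" and p :: "'a \<Rightarrow> real"
  assumes law: "nondegenerate_stable_law \<alpha> \<sigma> \<mu>"
    and density: "\<mu> = density lborel (\<lambda>x. ennreal (p x))"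
    and cont_p: "continuous_on UNIV p" and p_pos: "\<And>x. 0 < p x"
begin

declare measurable_id_\<sigma> [measurable del] measurable_uminus_\<sigma> [measurable del]

sublocale \<mu>: prob_space \<mu>
  using law by (simp add: nondegenerate_stable_law_def)

lemma sets_\<mu> [simp, measurable_cong]: "sets \<mu> = sets borel"
  using law by (simp add: nondegenerate_stable_law_def)

lemma space_\<mu> [simp]: "space \<mu> = UNIV"
  using sets_eq_imp_space_eq[OF sets_\<mu>] by simp

lemma p_nonneg: "0 \<le> p x"
  using p_pos[of x] by simp

lemma measurable_p [measurable]: "p \<in> borel_measurable borel"
  by (rule borel_measurable_continuous_onI) (rule cont_p)

lemma integral_\<mu>:
  fixes g :: "'a \<Rightarrow> 'b::{banach,second_countable_topology}"
  assumes [measurable]: "g \<in> borel_measurable borel"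
  shows "(\<integral>y. g y \<partial>\<mu>) = (\<integral>y. p y *\<^sub>R g y \<partial>lborel)"
  unfolding density by (rule integral_density) (auto simp: p_nonneg)

lemma integrable_p: "integrable lborel p"
proof (rule integrableI_nonneg)
  have "(\<integral>\<^sup>+x. ennreal (p x) \<partial>lborel) = emeasure \<mu> (space \<mu>)"
    unfolding density by (subst emeasure_density) auto
  then show "(\<integral>\<^sup>+x. ennreal (p x) \<partial>lborel) < \<infinity>" using \<mu>.emeasure_space_1 by simp
qed (auto simp: p_nonneg)

lemma fourier_p: "fourier (\<lambda>y. complex_of_real (p y)) \<xi> = complex_of_real (exp (- psi \<xi>))"
proof -
  have "(CLINT y|\<mu>. iexp (y \<bullet> \<xi>)) = complex_of_real (exp (- psi \<xi>))"
    using law by (simp add: nondegenerate_stable_law_def stable_norm_powr)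
  then show ?thesis
    by (simp add: integral_\<mu> fourier_def scaleR_conv_of_real inner_commute mult.commute)
qed

text \<open>\<psi> is minus the logarithm of a characteristic function, and transforms of integrable
  functions are continuous.\<close>

lemma continuous_psi: "continuous_on UNIV psi"
proof -
  have "continuous_on UNIV (\<lambda>\<xi>. - ln (Re (fourier (\<lambda>y. complex_of_real (p y)) \<xi>)))"
    by (intro continuous_intros continuous_fourier integrable_of_real integrable_p) (simp add: fourier_p)
  then show ?thesis by (simp add: fourier_p)
qed

lemma measurable_psi [measurable]: "psi \<in> borel_measurable borel"
  by (rule borel_measurable_continuous_onI) (rule continuous_psi)

text \<open>Nondegeneracy is positivity of the infimum on the unit sphere; homogeneity of degree
  \<alpha> carries it to all \<xi>.\<close>

lemma psi_lower: obtains c where "0 < c" "\<And>\<xi>. c * norm \<xi> powr \<alpha> \<le> psi \<xi>"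
proof
  let ?c = "INF y\<in>sphere 0 1. psi y"
  have "(\<integral>x. \<bar>y \<bullet> x\<bar> powr \<alpha> \<partial>(spectral_measure \<alpha> \<sigma>)) = psi y" for y
    using integral_spectral[of y] by (simp add: inner_commute)
  then show "0 < ?c" using law by (simp add: nondegenerate_stable_law_def nondegenerate_def)
  fix \<xi> :: 'a
  show "?c * norm \<xi> powr \<alpha> \<le> psi \<xi>"
  proof (cases "\<xi> = 0")
    case False
    let ?y = "(1 / norm \<xi>) *\<^sub>R \<xi>"
    have "?c \<le> psi ?y"
      using False by (intro cINF_lower bdd_belowI2[where m=0] psi_nonneg) auto
    moreover have "psi \<xi> = norm \<xi> powr \<alpha> * psi ?y"
      using psi_scaleR[of "norm \<xi>" ?y] False by simp
    ultimately show ?thesis by (simp add: mult.commute mult_left_mono)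
  qed (use \<alpha> in \<open>simp add: psi_nonneg\<close>)
qed

lemma psi_pos: "\<xi> \<noteq> 0 \<Longrightarrow> 0 < psi \<xi>"
  by (rule psi_lower) (metis less_le_trans mult_pos_pos norm_eq_zero powr_gt_zero)

text \<open>The multiplier of P_t; for t > 0 it is the characteristic function of X scaled by
  t^(1/\<alpha>).\<close>

definition phi :: "real \<Rightarrow> 'a \<Rightarrow> real" where
  "phi t \<xi> = exp (- (t * psi \<xi>))"

lemma measurable_phi [measurable]: "phi t \<in> borel_measurable borel"
  unfolding phi_def by measurable

lemma phi_pos: "0 < phi t \<xi>"
  by (simp add: phi_def)

lemma phi_uminus: "phi t (- \<xi>) = phi t \<xi>"
  using psi_scaleR[of "- 1" \<xi>] by (simp add: phi_def)

lemma phi_add: "phi (s + t) \<xi> = phi s \<xi> * phi t \<xi>"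
  by (simp add: phi_def exp_add[symmetric] algebra_simps)

lemma phi_scale: "0 < t \<Longrightarrow> phi 1 (t powr (1 / \<alpha>) *\<^sub>R \<xi>) = phi t \<xi>"
  using \<alpha> by (simp add: phi_def psi_scaleR powr_powr)

text \<open>The weight is quadratic because differentiating a Fourier integral uses second moments.
  Since \<alpha> > 1, the decay beats an ordinary exponential, and half of its rate absorbs the
  weight.\<close>

lemma phi_weighted_le:
  assumes t: "0 < t"
  obtains C c where "0 < c" "\<And>\<xi>. (1 + (norm \<xi>)\<^sup>2) * phi t \<xi> \<le> C * exp (- c * norm \<xi>)"
proof (rule psi_lower)
  fix c assume c: "0 < c" and psi: "\<And>\<xi>. c * norm \<xi> powr \<alpha> \<le> psi \<xi>"
  \<comment> \<open>The factor exp (t c) comes from r <= 1 + r^\<alpha>, the bracket from 1 + r^2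
    together with x^2/2 <= exp x at x = t c r/2.\<close>
  let ?d = "t * c" and ?C = "exp (t * c) * (1 + 2 / (t * c / 2)\<^sup>2)"
  have d: "0 < ?d" using t c by simp
  have "(1 + (norm \<xi>)\<^sup>2) * phi t \<xi> \<le> ?C * exp (- (?d / 2) * norm \<xi>)" for \<xi>
  proof -
    let ?r = "norm \<xi>"
    have "?r \<le> 1 + ?r powr \<alpha>"
    proof (cases "1 \<le> ?r")
      case True
      then have "?r powr 1 \<le> ?r powr \<alpha>" using \<alpha> by (intro powr_mono) auto
      then show ?thesis using True by simp
    next
      case False
      then show ?thesis using powr_ge_zero[of ?r \<alpha>] by linarith
    qed
    then have "?d * ?r \<le> ?d * (1 + ?r powr \<alpha>)" using d by (intro mult_left_mono) auto
    also have "\<dots> \<le> ?d + t * psi \<xi>" using psi[of \<xi>] t by (simp add: distrib_left)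
    finally have 1: "phi t \<xi> \<le> exp ?d * exp (- ?d * ?r)"
      by (simp add: phi_def exp_add[symmetric])
    have x: "0 \<le> ?d / 2 * ?r" using d by (intro mult_nonneg_nonneg) auto
    then have "(?d / 2 * ?r)\<^sup>2 / 2 \<le> exp (?d / 2 * ?r)"
      using exp_lower_Taylor_quadratic[OF x] by linarith
    moreover have "a\<^sup>2 \<le> 2 / k\<^sup>2 * X" if "(k * a)\<^sup>2 / 2 \<le> X" "0 < k" for a k X :: real
      using that by (simp add: power_mult_distrib field_simps)
    ultimately have 2: "?r\<^sup>2 \<le> 2 / (?d / 2)\<^sup>2 * exp (?d / 2 * ?r)"
      using d by simp
    have 3: "1 \<le> exp (?d / 2 * ?r)" using d by simp
    then have "1 + ?r\<^sup>2 \<le> (1 + 2 / (?d / 2)\<^sup>2) * exp (?d / 2 * ?r)"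
      unfolding distrib_right mult_1_left using 2 by (rule add_mono)
    then have "(1 + ?r\<^sup>2) * phi t \<xi> \<le> ((1 + 2 / (?d / 2)\<^sup>2) * exp (?d / 2 * ?r)) * (exp ?d * exp (- ?d * ?r))"
      using 1 by (intro mult_mono) (auto simp: phi_def intro!: mult_nonneg_nonneg add_nonneg_nonneg)
    also have "\<dots> = ?C * (exp (?d / 2 * ?r) * exp (- ?d * ?r))" by (simp add: mult_ac)
    also have "exp (?d / 2 * ?r) * exp (- ?d * ?r) = exp (- (?d / 2) * ?r)"
      unfolding exp_add[symmetric] by (simp add: field_simps)
    finally show ?thesis .
  qed
  then show ?thesis using d by (intro that[of "?d / 2" ?C]) auto
qed

lemma integrable_phi_weighted:
  assumes t: "0 < t"
  shows "integrable lborel (\<lambda>\<xi>. (1 + (norm \<xi>)\<^sup>2) * phi t \<xi>)"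
proof (rule phi_weighted_le[OF t])
  fix C c assume c: "0 < c" and le: "\<And>\<xi>. (1 + (norm \<xi>)\<^sup>2) * phi t \<xi> \<le> C * exp (- c * norm \<xi>)"
  show ?thesis
  proof (rule Bochner_Integration.integrable_bound)
    show "integrable lborel (\<lambda>\<xi>::'a. C * exp (- c * norm \<xi>))"
      using c by (intro integrable_mult_right integrable_exp_norm)
    show "AE \<xi> in lborel. norm ((1 + (norm \<xi>)\<^sup>2) * phi t \<xi>) \<le> norm (C * exp (- c * norm (\<xi>::'a)))"
    proof (rule AE_I2)
      fix \<xi> :: 'a
      have "0 \<le> (1 + (norm \<xi>)\<^sup>2) * phi t \<xi>"
        using phi_pos[of t \<xi>] by (intro mult_nonneg_nonneg add_nonneg_nonneg) auto
      with le[of \<xi>] show "norm ((1 + (norm \<xi>)\<^sup>2) * phi t \<xi>) \<le> norm (C * exp (- c * norm \<xi>))"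
        unfolding real_norm_def by linarith
    qed
  qed measurable
qed

lemma integrable_phi_mult:
  assumes t: "0 < t" and [measurable]: "g \<in> borel_measurable borel"
    and g: "\<And>\<xi>. norm (g \<xi> :: complex) \<le> C * (1 + (norm \<xi>)\<^sup>2)"
  shows "integrable lborel (\<lambda>\<xi>. g \<xi> * complex_of_real (phi t \<xi>))"
proof (rule Bochner_Integration.integrable_bound)
  show "integrable lborel (\<lambda>\<xi>. C * ((1 + (norm \<xi>)\<^sup>2) * phi t \<xi>))"
    using integrable_phi_weighted[OF t] by auto
  show "AE \<xi> in lborel. norm (g \<xi> * complex_of_real (phi t \<xi>)) \<le> norm (C * ((1 + (norm \<xi>)\<^sup>2) * phi t \<xi>))"
  proof (rule AE_I2)
    fix \<xi> :: 'a
    have "norm (g \<xi>) * phi t \<xi> \<le> C * (1 + (norm \<xi>)\<^sup>2) * phi t \<xi>"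
      using g phi_pos[of t \<xi>] by (intro mult_right_mono) auto
    then show "norm (g \<xi> * complex_of_real (phi t \<xi>)) \<le> norm (C * ((1 + (norm \<xi>)\<^sup>2) * phi t \<xi>))"
      using phi_pos[of t \<xi>] unfolding real_norm_def
      by (intro order_trans[OF _ abs_ge_self]) (simp add: norm_mult abs_of_pos mult.assoc)
  qed
qed measurable

definition cst :: complex where
  "cst = 1 / (2 * pi) ^ DIM('a)"

lemma integrable_phi: "0 < t \<Longrightarrow> integrable lborel (\<lambda>\<xi>. complex_of_real (phi t \<xi>))"
  using integrable_phi_mult[of t "\<lambda>_. 1" 1] by simp

text \<open>The characteristic function is integrable, so the continuous density can be recovered by
  inversion; evenness of \<open>phi\<close> removes the reflected argument. Boundedness makes the
  real-valued \<open>SUP\<close> in the constants a genuine upper bound.\<close>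

lemma bdd_p: "bdd_above (range p)"
  and p_eq: "p y = Re (fourier (\<lambda>\<xi>. cst * complex_of_real (phi 1 \<xi>)) y)"
proof -
  have f: "fourier (\<lambda>y. complex_of_real (p y)) = (\<lambda>\<xi>. complex_of_real (phi 1 \<xi>))"
    by (rule ext) (simp add: fourier_p phi_def)
  have i: "integrable lborel (fourier (\<lambda>y. complex_of_real (p y)))"
    unfolding f by (rule integrable_phi) simp
  note inv = fourier_inversion_density[OF integrable_p i cont_p p_nonneg]
  show "bdd_above (range p)" by (rule inv)
  have "fourier (\<lambda>\<xi>. complex_of_real (phi 1 \<xi>)) (- y) = fourier (\<lambda>\<xi>. complex_of_real (phi 1 \<xi>)) y"
    unfolding fourier_def
    by (subst integral_lborel_affine[of _ "-1" 0]) (auto simp: phi_uminus)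
  then have "complex_of_real (p y) = cst * fourier (\<lambda>\<xi>. complex_of_real (phi 1 \<xi>)) y"
    using inv(1)[of y] by (simp add: f cst_def)
  also have "\<dots> = fourier (\<lambda>\<xi>. cst * complex_of_real (phi 1 \<xi>)) y"
    unfolding fourier_def integral_mult_right_zero[symmetric]
    by (intro Bochner_Integration.integral_cong) auto
  finally show "p y = Re (fourier (\<lambda>\<xi>. cst * complex_of_real (phi 1 \<xi>)) y)"
    by (metis Re_complex_of_real)
qed

lemma p_uminus: "p (- y) = p y"
  unfolding p_eq fourier_def
  by (subst integral_lborel_affine[of _ "-1" 0]) (auto simp: phi_uminus)

lemma fourier_scaled_p:
  "0 < s \<Longrightarrow> fourier (\<lambda>y. complex_of_real (p y)) (s powr (1 / \<alpha>) *\<^sub>R \<xi>) = complex_of_real (phi s \<xi>)"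
  unfolding fourier_p phi_scale[symmetric] by (simp add: phi_def)

text \<open>The semigroup law in Fourier form: averaging along the scaled law multiplies any
  integrable multiplier by \<open>phi s\<close>, whatever vector symbol it already contains.\<close>

lemma average_fourier:
  assumes "integrable lborel m" and "0 < s"
  shows "(\<integral>y. Re (fourier m (x + s powr (1 / \<alpha>) *\<^sub>R y)) \<partial>\<mu>) = Re (fourier (\<lambda>\<xi>. m \<xi> * complex_of_real (phi s \<xi>)) x)"
    and "integrable \<mu> (\<lambda>y. Re (fourier m (x + s powr (1 / \<alpha>) *\<^sub>R y)))"
proof -
  have [measurable]: "m \<in> borel_measurable borel" using assms by auto
  note C = fourier_convolution(1,3)[OF integrable_p assms(1), of x "s powr (1 / \<alpha>)"]
  have [measurable]: "(\<lambda>y. Re (fourier m (x + s powr (1 / \<alpha>) *\<^sub>R y))) \<in> borel_measurable borel"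
    by measurable
  show "(\<integral>y. Re (fourier m (x + s powr (1 / \<alpha>) *\<^sub>R y)) \<partial>\<mu>) = Re (fourier (\<lambda>\<xi>. m \<xi> * complex_of_real (phi s \<xi>)) x)"
    using C(2) unfolding fourier_scaled_p[OF assms(2)] by (subst integral_\<mu>) simp_all
  show "integrable \<mu> (\<lambda>y. Re (fourier m (x + s powr (1 / \<alpha>) *\<^sub>R y)))"
    unfolding density by (subst integrable_real_density) (use C(1) in \<open>simp_all add: p_nonneg\<close>)
qed

end

subsection \<open>The semigroup acting on an indicator function\<close>

text \<open>Continuity of translations in measure. Choose a compact K inside E and an open U around
  K, both with small error. For small h, x + h in K forces x in U, so the overlap is at least the
  measure of K minus that of U - K.\<close>

lemma tendsto_measure_overlap:
  fixes E :: "'a::euclidean_space set"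
  assumes [measurable]: "E \<in> sets borel" and fin: "emeasure lborel E < \<infinity>"
  shows "((\<lambda>h. \<integral>x. indicator E x * indicator E (x + h) \<partial>lborel) \<longlongrightarrow> measure lborel E) (at 0)"
    (is "(?o \<longlongrightarrow> _) _")
proof (rule tendstoI)
  fix e :: real assume e: "0 < e"
  have iE: "integrable lborel (indicator E :: 'a \<Rightarrow> real)"
    using fin by (simp add: integrable_indicator_iff)
  have io: "integrable lborel (\<lambda>x. indicator E x * indicator E (x + h) :: real)" for h
    by (rule Bochner_Integration.integrable_bound[OF iE]) (auto simp: indicator_def)
  have up: "?o h \<le> measure lborel E" for h
  proof -
    have "?o h \<le> (\<integral>x. indicator E x \<partial>lborel)"
      by (intro integral_mono io iE) (auto simp: indicator_def)
    then show ?thesis by simp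
  qed
  \<comment> \<open>Restricting Lebesgue measure to \<open>E\<close> makes it finite, as inner
    regularity by compact sets demands.\<close>
  let ?M = "density lborel (indicator E)"
  have M: "emeasure ?M K = emeasure lborel K" if "K \<subseteq> E" "K \<in> sets borel" for K
    using that by (subst emeasure_density) (auto intro!: nn_integral_cong simp: indicator_def nn_integral_indicator[symmetric] simp del: nn_integral_indicator)
  have "finite_measure ?M"
    by (rule finite_measureI) (use fin in \<open>simp add: emeasure_density\<close>)
  then interpret M: finite_measure ?M .
  have reg: "emeasure ?M E = (SUP K\<in>{K. K \<subseteq> E \<and> compact K}. emeasure ?M K)"
    by (rule inner_regular) (use fin in \<open>auto simp: emeasure_density\<close>)
  obtain K where K: "K \<subseteq> E" "compact K" "measure lborel E - e / 3 < measure lborel K"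
  proof (cases "measure lborel E < e / 3")
    \<comment> \<open>The lower bound is negative here and the empty set will do; otherwise it is
      nonnegative and can be compared within \<open>ennreal\<close>.\<close>
    case True
    then show ?thesis using that[of "{}"] by simp
  next
    case False
    have mE: "emeasure lborel E = ennreal (measure lborel E)"
      using fin by (intro emeasure_eq_ennreal_measure) auto
    have "ennreal (measure lborel E - e / 3) < emeasure lborel E"
      unfolding mE using e False by (subst ennreal_less_iff) auto
    also have "\<dots> = (SUP K\<in>{K. K \<subseteq> E \<and> compact K}. emeasure ?M K)"
      using reg M[of E] by simp
    finally obtain K where K: "K \<subseteq> E" "compact K" "ennreal (measure lborel E - e / 3) < emeasure ?M K"
      by (auto simp: less_SUP_iff)
    then have Kb: "K \<in> sets borel" by (auto intro: borel_compact)
    have "emeasure lborel K < \<infinity>" using emeasure_mono[OF K(1), of lborel] fin by auto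
    then have "emeasure lborel K = ennreal (measure lborel K)"
      by (intro emeasure_eq_ennreal_measure) auto
    with K(3) M[OF K(1) Kb] False have "measure lborel E - e / 3 < measure lborel K"
      by (simp add: ennreal_less_iff)
    with K show ?thesis using that by blast
  qed
  have Kb [measurable]: "K \<in> sets borel" using K(2) by (rule borel_compact)
  obtain U where U: "open U" "K \<subseteq> U" "emeasure lborel (U - K) < ennreal (e / 3)"
    using outer_regular_lborel[OF Kb, of "e / 3"] e by auto
  obtain \<delta> where \<delta>: "0 < \<delta>" "(\<Union>x\<in>K. ball x \<delta>) \<subseteq> U"
    using compact_subset_open_imp_ball_epsilon_subset[OF K(2) U(1,2)] by blast
  have Ub [measurable]: "U \<in> sets borel" using U(1) by simp
  have Kfin: "emeasure lborel K < \<infinity>" using emeasure_mono[OF K(1), of lborel] fin by auto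
  have iK: "integrable lborel (indicator K :: 'a \<Rightarrow> real)"
    using Kfin by (simp add: integrable_indicator_iff)
  have iD: "integrable lborel (indicator (U - K) :: 'a \<Rightarrow> real)"
    using U(3) by (subst integrable_indicator_iff) (auto intro: less_trans)
  have D: "measure lborel (U - K) \<le> e / 3"
    unfolding measure_def by (rule enn2real_leI) (use U(3) e in auto)
  have low: "measure lborel E - e < ?o h" if h: "norm h < \<delta>" for h
  proof -
    have iKh: "integrable lborel (\<lambda>x. indicator K (x + h) :: real)"
      by (rule integrable_lborel_translate[OF iK])
    have "(\<integral>x. indicator K (x + h) - indicator (U - K) x \<partial>lborel) \<le> ?o h"
    proof (rule integral_mono)
      fix x :: 'a
      have "x \<in> U" if "x + h \<in> K"
        using \<delta>(2) that h by (auto simp: dist_norm subset_eq intro: bexI[of _ "x + h"])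
      then show "indicator K (x + h) - indicator (U - K) x \<le> (indicator E x * indicator E (x + h) :: real)"
        using K(1) by (auto simp: indicator_def)
    qed (intro Bochner_Integration.integrable_diff iKh iD io)+
    also have "(\<integral>x. indicator K (x + h) - indicator (U - K) x \<partial>lborel) = measure lborel K - measure lborel (U - K)"
      using iKh iD by (simp add: integral_lborel_translate)
    finally show ?thesis using D K(3) e by linarith
  qed
  have "\<forall>\<^sub>F h in at 0. norm (h::'a) < \<delta>"
    using \<delta>(1) by (auto simp: eventually_at intro!: exI[of _ \<delta>])
  then show "\<forall>\<^sub>F h in at 0. dist (?o h) (measure lborel E) < e"
  proof eventually_elim
    case (elim h)
    from low[OF elim] up[of h] e show ?case by (simp only: dist_real_def abs_less_iff) linarith
  qed
qed

text \<open>Measurability and at most linear growth are shared by the symbols of both gradients,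
  which are thus treated together.\<close>

definition (in stable_law) admissible :: "('a \<Rightarrow> 'a \<Rightarrow> complex) \<Rightarrow> bool" where
  "admissible L \<longleftrightarrow> (\<forall>b. L b \<in> borel_measurable borel \<and> (\<exists>C. \<forall>\<xi>. norm (L b \<xi>) \<le> C * (1 + norm \<xi>)))"

text \<open>Jensen's inequality under \<mu> is taken as the property itself instead of convexity,
  because for the stable norm it can be verified directly.\<close>

definition (in stable_law) jensen :: "('a \<Rightarrow> real) \<Rightarrow> bool" where
  "jensen G \<longleftrightarrow> G \<in> borel_measurable borel \<and> (\<forall>v. 0 \<le> G v) \<and>
    (\<forall>w. integrable \<mu> w \<longrightarrow> ennreal (G (\<integral>y. w y \<partial>\<mu>)) \<le> (\<integral>\<^sup>+y. ennreal (G (w y)) \<partial>\<mu>))"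

locale stable_law_set = stable_law +
  fixes E :: "'a set"
  assumes E [measurable]: "E \<in> sets borel" and E_finite: "emeasure lborel E < \<infinity>"
begin

lemma integrable_E: "integrable lborel (indicator E :: 'a \<Rightarrow> real)"
  using E_finite by (simp add: integrable_indicator_iff)

section \<open>P_t 1_E and its gradients as Fourier integrals\<close>

definition Ehat :: "'a \<Rightarrow> complex" where
  "Ehat \<xi> = fourier (\<lambda>z. complex_of_real (indicator E z)) (- \<xi>)"

lemma continuous_Ehat: "continuous_on UNIV Ehat"
proof -
  have "continuous_on UNIV (fourier (\<lambda>z. complex_of_real (indicator E z)))"
    using integrable_E by (intro continuous_fourier integrable_of_real)
  then show ?thesis unfolding Ehat_def
    by (rule continuous_on_compose2) (auto intro!: continuous_intros)
qed

lemma measurable_Ehat [measurable]: "Ehat \<in> borel_measurable borel"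
  by (rule borel_measurable_continuous_onI) (rule continuous_Ehat)

lemma norm_Ehat_le: "norm (Ehat \<xi>) \<le> measure lborel E"
proof -
  have "integrable lborel (\<lambda>z. complex_of_real (indicator E z))"
    using integrable_E by (rule integrable_of_real)
  from norm_fourier_le[OF this, of "- \<xi>"] show ?thesis by (simp add: Ehat_def)
qed

definition symb :: "real \<Rightarrow> 'a \<Rightarrow> complex" where
  "symb t \<xi> = cst * Ehat \<xi> * complex_of_real (phi t \<xi>)"

lemma measurable_symb [measurable]: "symb t \<in> borel_measurable borel"
  unfolding symb_def by measurable

lemma symb_add: "symb (t + s) \<xi> = symb t \<xi> * complex_of_real (phi s \<xi>)"
  by (simp add: symb_def phi_add)

lemma integrable_symb_mult:
  assumes "0 < t" and [measurable]: "g \<in> borel_measurable borel"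
    and g: "\<And>\<xi>. norm (g \<xi>) \<le> C * (1 + (norm \<xi>)\<^sup>2)"
  shows "integrable lborel (\<lambda>\<xi>. g \<xi> * symb t \<xi>)"
proof -
  have C: "0 \<le> C" using order_trans[OF norm_ge_zero g[of 0]] by simp
  have "integrable lborel (\<lambda>\<xi>. (g \<xi> * (cst * Ehat \<xi>)) * complex_of_real (phi t \<xi>))"
  proof (rule integrable_phi_mult[OF assms(1)])
    fix \<xi>
    have "norm (g \<xi>) * (norm cst * norm (Ehat \<xi>)) \<le> (C * (1 + (norm \<xi>)\<^sup>2)) * (norm cst * measure lborel E)"
      using C by (intro mult_mono g norm_Ehat_le) auto
    then show "norm (g \<xi> * (cst * Ehat \<xi>)) \<le> C * norm cst * measure lborel E * (1 + (norm \<xi>)\<^sup>2)"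
      by (simp add: norm_mult mult_ac)
  qed measurable
  then show ?thesis by (simp add: symb_def mult_ac)
qed

lemma integrable_symb: "0 < t \<Longrightarrow> integrable lborel (symb t)"
  using integrable_symb_mult[of t "\<lambda>_. 1" 1] by simp

lemma integrable_symb_norm2: "0 < t \<Longrightarrow> integrable lborel (\<lambda>\<xi>. (norm \<xi>)\<^sup>2 * norm (symb t \<xi>))"
  using integrable_norm[OF integrable_symb_mult[of t "\<lambda>\<xi>. complex_of_real ((norm \<xi>)\<^sup>2)" 1]]
  by (simp add: norm_mult norm_power)

lemma integrable_symb_norm: "0 < t \<Longrightarrow> integrable lborel (\<lambda>\<xi>. norm \<xi> * norm (symb t \<xi>))"
  using integrable_norm[OF integrable_symb_mult[of t "\<lambda>\<xi>. complex_of_real (norm \<xi>)" 1]] le_1_square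
  by (simp add: norm_mult)

lemma admissible_bound:
  assumes "admissible L" obtains C where "\<And>\<xi>. norm (L b \<xi>) \<le> C * (1 + (norm \<xi>)\<^sup>2)"
proof -
  obtain C where C: "\<And>\<xi>. norm (L b \<xi>) \<le> C * (1 + norm \<xi>)" using assms by (auto simp: admissible_def)
  have "0 \<le> C" using order_trans[OF norm_ge_zero C[of 0]] by simp
  have "norm (L b \<xi>) \<le> 2 * C * (1 + (norm \<xi>)\<^sup>2)" for \<xi>
  proof -
    have "1 + norm \<xi> \<le> 2 * (1 + (norm \<xi>)\<^sup>2)"
      unfolding distrib_left using le_1_square[of "norm \<xi>"] zero_le_power2[of "norm \<xi>"] by linarith
    then have "C * (1 + norm \<xi>) \<le> C * (2 * (1 + (norm \<xi>)\<^sup>2))"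
      using \<open>0 \<le> C\<close> by (rule mult_left_mono)
    with C[of \<xi>] show ?thesis by (simp add: mult_ac)
  qed
  then show ?thesis using that by blast
qed

lemma integrable_admissible:
  assumes L: "admissible L" and "0 < t"
  shows "integrable lborel (\<lambda>\<xi>. L b \<xi> * symb t \<xi>)"
proof -
  obtain C where "\<And>\<xi>. norm (L b \<xi>) \<le> C * (1 + (norm \<xi>)\<^sup>2)" using admissible_bound[OF L] by blast
  with assms show ?thesis by (intro integrable_symb_mult) (auto simp: admissible_def)
qed

abbreviation P :: "real \<Rightarrow> 'a \<Rightarrow> real" where
  "P t \<equiv> stable_semigroup \<alpha> \<mu> t (indicator E)"

text \<open>A change of variables and the symmetry of \<open>p\<close> display P_t 1_E as the
  convolution of 1_E with the rescaled density, so the multipliers of the two are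
  multiplied.\<close>

lemma P_eq:
  assumes t: "0 < t"
  shows "P t = (\<lambda>x. Re (fourier (symb t) x))"
proof
  fix x
  define \<tau> where "\<tau> = t powr (1 / \<alpha>)"
  have \<tau>: "0 < \<tau>" using t by (simp add: \<tau>_def)
  let ?m = "\<lambda>\<xi>. cst * complex_of_real (phi t \<xi>)"
  have im: "integrable lborel ?m" using integrable_phi[OF t] by auto
  have scaled: "(1 / \<tau>) ^ DIM('a) * p ((1 / \<tau>) *\<^sub>R w) = Re (fourier ?m w)" for w
  proof -
    have "fourier (\<lambda>\<xi>. cst * complex_of_real (phi 1 \<xi>)) ((1 / \<tau>) *\<^sub>R w) = \<tau> ^ DIM('a) *\<^sub>R fourier ?m w"
      unfolding fourier_def using \<tau> phi_scale[OF t]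
      by (subst integral_lborel_affine[of _ \<tau> 0]) (auto simp: \<tau>_def)
    then show ?thesis using \<tau> by (simp add: p_eq power_one_over)
  qed
  have "P t x = (\<integral>y. p y * indicator E (x + \<tau> *\<^sub>R y) \<partial>lborel)"
    unfolding stable_semigroup_def \<tau>_def by (subst integral_\<mu>) auto
  also have "\<dots> = (1 / \<tau>) ^ DIM('a) * (\<integral>z. p ((1 / \<tau>) *\<^sub>R (z - x)) * indicator E z \<partial>lborel)"
    using \<tau> by (subst integral_lborel_affine[of _ "1 / \<tau>" "- (1 / \<tau>) *\<^sub>R x"])
      (auto simp: algebra_simps power_one_over)
  also have "\<dots> = (\<integral>z. indicator E z * Re (fourier ?m (x + (- 1) *\<^sub>R z)) \<partial>lborel)"
    unfolding integral_mult_right_zero[symmetric]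
  proof (intro Bochner_Integration.integral_cong refl)
    fix z
    have "p ((1 / \<tau>) *\<^sub>R (z - x)) = p ((1 / \<tau>) *\<^sub>R (x + (- 1) *\<^sub>R z))"
      using p_uminus[of "(1 / \<tau>) *\<^sub>R (z - x)"] by (simp add: algebra_simps)
    then show "(1 / \<tau>) ^ DIM('a) * (p ((1 / \<tau>) *\<^sub>R (z - x)) * indicator E z) =
        indicator E z * Re (fourier ?m (x + (- 1) *\<^sub>R z))"
      unfolding scaled[symmetric] by (simp add: mult_ac)
  qed
  also have "\<dots> = Re (fourier (\<lambda>\<xi>. ?m \<xi> * fourier (\<lambda>y. complex_of_real (indicator E y)) ((- 1) *\<^sub>R \<xi>)) x)"
    by (rule fourier_convolution(3)[OF integrable_E im])
  also have "(\<lambda>\<xi>. ?m \<xi> * fourier (\<lambda>y. complex_of_real (indicator E y)) ((- 1) *\<^sub>R \<xi>)) = symb t"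
    by (auto simp: symb_def Ehat_def)
  finally show "P t x = Re (fourier (symb t) x)" .
qed

text \<open>The vector field that the multiplier \<open>L\<close> produces from P_t 1_E; its
  instances are the gradient and D^(\<alpha>-1).\<close>

definition field :: "('a \<Rightarrow> 'a \<Rightarrow> complex) \<Rightarrow> real \<Rightarrow> 'a \<Rightarrow> 'a" where
  "field L t x = (\<Sum>b\<in>Basis. Re (fourier (\<lambda>\<xi>. L b \<xi> * symb t \<xi>) x) *\<^sub>R b)"

lemma field_inner: "b \<in> Basis \<Longrightarrow> field L t x \<bullet> b = Re (fourier (\<lambda>\<xi>. L b \<xi> * symb t \<xi>) x)"
  by (simp add: field_def)

lemma continuous_field:
  assumes "admissible L" "0 < t"
  shows "continuous_on UNIV (field L t)"
  unfolding field_def using assms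
  by (intro continuous_intros continuous_fourier integrable_admissible)

lemma measurable_field:
  assumes "admissible L" "0 < t"
  shows "field L t \<in> borel_measurable borel"
  by (rule borel_measurable_continuous_onI) (rule continuous_field[OF assms])

definition grad_symbol :: "'a \<Rightarrow> 'a \<Rightarrow> complex" where
  "grad_symbol b \<xi> = \<i> * complex_of_real (\<xi> \<bullet> b)"

lemma admissible_grad_symbol: "admissible grad_symbol"
  unfolding admissible_def
proof (intro allI conjI exI)
  fix b \<xi> :: 'a
  have "\<bar>\<xi> \<bullet> b\<bar> \<le> norm b * norm \<xi>" using Cauchy_Schwarz_ineq2[of \<xi> b] by (simp add: mult.commute)
  also have "\<dots> \<le> norm b * (1 + norm \<xi>)" by (intro mult_left_mono) auto
  finally show "norm (grad_symbol b \<xi>) \<le> norm b * (1 + norm \<xi>)"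
    by (simp add: grad_symbol_def norm_mult)
qed (simp add: grad_symbol_def[abs_def])

lemma admissible_levy_symbol: "admissible levy_symbol"
  unfolding admissible_def
proof (intro allI conjI exI)
  fix b \<xi> :: 'a
  show "norm (levy_symbol b \<xi>) \<le> (2 * norm b * (\<integral>z. weight (ray z) \<partial>polar)) * (1 + norm \<xi>)"
    using norm_levy_symbol_le[of b \<xi>] by (simp only: mult_ac)
qed measurable

lemma gradient_P: "0 < t \<Longrightarrow> GDERIV (P t) x :> field grad_symbol t x"
  unfolding P_eq field_def grad_symbol_def
  by (rule gderiv_fourier[OF integrable_symb integrable_symb_norm2])

lemma frac_gradient_P: "0 < t \<Longrightarrow> frac_gradient \<alpha> \<sigma> (P t) x = field levy_symbol t x"
  unfolding P_eq field_def
  by (rule frac_gradient_fourier[OF integrable_symb integrable_symb_norm])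

lemma field_average:
  assumes L: "admissible L" and t: "0 < t" and s: "0 < s"
  shows "field L (t + s) x = (\<integral>y. field L t (x + s powr (1 / \<alpha>) *\<^sub>R y) \<partial>\<mu>)"
    and "integrable \<mu> (\<lambda>y. field L t (x + s powr (1 / \<alpha>) *\<^sub>R y))"
proof -
  note A = average_fourier[OF integrable_admissible[OF L t] s]
  show "integrable \<mu> (\<lambda>y. field L t (x + s powr (1 / \<alpha>) *\<^sub>R y))"
    unfolding field_def by (intro Bochner_Integration.integrable_sum integrable_scaleR_left A(2))
  show "field L (t + s) x = (\<integral>y. field L t (x + s powr (1 / \<alpha>) *\<^sub>R y) \<partial>\<mu>)"
  proof -
    have "(\<integral>y. Re (fourier (\<lambda>\<xi>. L b \<xi> * symb t \<xi>) (x + s powr (1 / \<alpha>) *\<^sub>R y)) *\<^sub>R b \<partial>\<mu>)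
        = Re (fourier (\<lambda>\<xi>. L b \<xi> * symb (t + s) \<xi>) x) *\<^sub>R b" for b
      by (subst integral_scaleR_left[OF A(2)]) (simp add: A(1) symb_add mult.assoc)
    then show ?thesis
      unfolding field_def
      by (subst Bochner_Integration.integral_sum) (auto intro!: integrable_scaleR_left A(2))
  qed
qed

text \<open>Jensen is applied pointwise to the averaging formula; Tonelli and translation invariance
  then give every translate the same norm.\<close>

lemma L1_norm_field_antimono:
  assumes L: "admissible L" and G: "jensen G" and t: "0 < t" and s: "0 < s"
  shows "L1_norm (\<lambda>x. G (field L (t + s) x)) \<le> L1_norm (\<lambda>x. G (field L t x))"
proof -
  have [measurable]: "G \<in> borel_measurable borel" "field L t \<in> borel_measurable borel"
    using G measurable_field[OF L t] by (auto simp: jensen_def)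
  have G0: "0 \<le> G v" for v using G by (simp add: jensen_def)
  interpret PM: pair_sigma_finite \<mu> "lborel :: 'a measure" ..
  have "L1_norm (\<lambda>x. G (field L (t + s) x)) \<le> (\<integral>\<^sup>+x. \<integral>\<^sup>+y. ennreal (G (field L t (x + s powr (1 / \<alpha>) *\<^sub>R y))) \<partial>\<mu> \<partial>lborel)"
    unfolding L1_norm_def
  proof (intro nn_integral_mono)
    fix x
    show "ennreal (norm (G (field L (t + s) x))) \<le> (\<integral>\<^sup>+y. ennreal (G (field L t (x + s powr (1 / \<alpha>) *\<^sub>R y))) \<partial>\<mu>)"
      using G field_average[OF L t s, of x] by (simp add: jensen_def)
  qed
  also have "\<dots> = (\<integral>\<^sup>+y. \<integral>\<^sup>+x. ennreal (G (field L t (x + s powr (1 / \<alpha>) *\<^sub>R y))) \<partial>lborel \<partial>\<mu>)"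
    by (rule PM.Fubini') measurable
  also have "\<dots> = (\<integral>\<^sup>+y. L1_norm (\<lambda>x. G (field L t x)) \<partial>\<mu>)"
  proof (intro nn_integral_cong)
    fix y
    have "(\<integral>\<^sup>+x. ennreal (G (field L t (x + s powr (1 / \<alpha>) *\<^sub>R y))) \<partial>lborel) = (\<integral>\<^sup>+x. ennreal (G (field L t x)) \<partial>lborel)"
      by (rule nn_integral_lborel_translate[of "\<lambda>x. ennreal (G (field L t x))"]) measurable
    then show "(\<integral>\<^sup>+x. ennreal (G (field L t (x + s powr (1 / \<alpha>) *\<^sub>R y))) \<partial>lborel) = L1_norm (\<lambda>x. G (field L t x))"
      using G0 by (simp add: L1_norm_def)
  qed
  also have "\<dots> = L1_norm (\<lambda>x. G (field L t x))"
    using \<mu>.emeasure_space_1 by simp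
  finally show ?thesis .
qed

lemma jensen_norm: "jensen norm"
  unfolding jensen_def by (auto intro!: integral_norm_bound_ennreal)

lemma L1_norm_le_perimeter_frac:
  assumes "0 < \<epsilon>"
  shows "L1_norm (field levy_symbol \<epsilon>) \<le> perimeter_frac \<alpha> \<sigma> \<mu> E"
proof -
  let ?F = "\<lambda>t. L1_norm (frac_gradient \<alpha> \<sigma> (P t))"
  have eq: "?F t = L1_norm (\<lambda>x. norm (field levy_symbol t x))" if "0 < t" for t
    using frac_gradient_P[OF that] by (simp add: L1_norm_def)
  have "?F \<epsilon> \<le> Lim (at_right 0) ?F"
    by (rule le_Lim_at_right_antimono)
       (use L1_norm_field_antimono[OF admissible_levy_symbol jensen_norm] eq assms in auto)
  then show ?thesis
    using eq[OF assms] by (simp add: perimeter_frac_def L1_norm_def)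
qed

lemma L1_norm_le_perimeter_cl:
  assumes "0 < \<epsilon>" and G: "jensen (stable_norm \<alpha> \<sigma>)"
  shows "L1_norm (\<lambda>x. stable_norm \<alpha> \<sigma> (field grad_symbol \<epsilon> x)) \<le> perimeter_cl \<alpha> \<sigma> \<mu> E"
proof -
  let ?F = "\<lambda>t. L1_norm (\<lambda>x. stable_norm \<alpha> \<sigma> (gradient (P t) x))"
  have eq: "?F t = L1_norm (\<lambda>x. stable_norm \<alpha> \<sigma> (field grad_symbol t x))" if "0 < t" for t
    using gradient_eqI[OF gradient_P[OF that]] by simp
  have "?F \<epsilon> \<le> Lim (at_right 0) ?F"
    by (rule le_Lim_at_right_antimono)
       (use L1_norm_field_antimono[OF admissible_grad_symbol G] eq assms in auto)
  then show ?thesis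
    using eq[OF assms(1)] by (simp add: perimeter_cl_def)
qed

lemma measurable_P [measurable]: "0 < t \<Longrightarrow> P t \<in> borel_measurable borel"
  unfolding P_eq by measurable

lemma P_nonneg: "0 \<le> P t x"
  unfolding stable_semigroup_def by (intro integral_nonneg_AE) auto

lemma P_le: 
  assumes "0 < t"
  shows "P t x \<le> (SUP x. \<bar>p x\<bar>) * measure lborel E * t powr (- (real DIM('a) / \<alpha>))"
proof -
  define \<tau> where "\<tau> = t powr (1 / \<alpha>)"
  have \<tau>: "0 < \<tau>" using assms by (simp add: \<tau>_def)
  let ?M = "SUP x. \<bar>p x\<bar>"
  have "bdd_above (range (\<lambda>x. \<bar>p x\<bar>))" using bdd_p by (simp add: abs_of_pos p_pos)
  then have pM: "p y \<le> ?M" for y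
    using cSUP_upper[of y UNIV "\<lambda>x. \<bar>p x\<bar>"] p_pos[of y] by simp
  have M0: "0 \<le> ?M" using pM[of 0] p_nonneg[of 0] by linarith
  have iE: "integrable lborel (\<lambda>y. indicator E (x + \<tau> *\<^sub>R y) :: real)"
    using \<tau> by (intro integrable_lborel_affine integrable_E) auto
  have "P t x = (\<integral>y. p y * indicator E (x + \<tau> *\<^sub>R y) \<partial>lborel)"
    unfolding stable_semigroup_def \<tau>_def by (subst integral_\<mu>) auto
  also have "\<dots> \<le> (\<integral>y. ?M * indicator E (x + \<tau> *\<^sub>R y) \<partial>lborel)"
    using pM iE M0
    by (intro integral_mono_AE' AE_I2 mult_right_mono integrable_mult_right mult_nonneg_nonneg) auto
  also have "\<dots> = ?M * (\<integral>y. indicator E (x + \<tau> *\<^sub>R y) \<partial>lborel)" by simp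
  also have "(\<integral>y. indicator E (x + \<tau> *\<^sub>R y) \<partial>lborel) = measure lborel E / \<tau> ^ DIM('a)"
    using integral_lborel_affine[of "indicator E :: 'a \<Rightarrow> real" \<tau> x] \<tau> by (simp add: field_simps)
  also have "\<tau> ^ DIM('a) = t powr (real DIM('a) / \<alpha>)"
    using assms by (simp add: \<tau>_def powr_realpow[symmetric] powr_powr)
  finally show ?thesis by (simp add: powr_minus_divide)
qed

lemma nn_integral_P:
  assumes "0 < t"
  shows "(\<integral>\<^sup>+x. ennreal (P t x) \<partial>lborel) = emeasure lborel E"
proof -
  interpret PM: pair_sigma_finite \<mu> "lborel :: 'a measure" ..
  have "(\<integral>\<^sup>+x. ennreal (P t x) \<partial>lborel) = (\<integral>\<^sup>+x. \<integral>\<^sup>+y. indicator E (x + t powr (1 / \<alpha>) *\<^sub>R y) \<partial>\<mu> \<partial>lborel)"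
  proof (intro nn_integral_cong)
    fix x
    have "integrable \<mu> (\<lambda>y. indicator E (x + t powr (1 / \<alpha>) *\<^sub>R y) :: real)"
      by (rule \<mu>.integrable_const_bound[where B=1]) (auto simp: indicator_def)
    from nn_integral_eq_integral[OF this]
    show "ennreal (P t x) = (\<integral>\<^sup>+y. indicator E (x + t powr (1 / \<alpha>) *\<^sub>R y) \<partial>\<mu>)"
      by (simp add: stable_semigroup_def ennreal_indicator)
  qed
  also have "\<dots> = (\<integral>\<^sup>+y. \<integral>\<^sup>+x. indicator E (x + t powr (1 / \<alpha>) *\<^sub>R y) \<partial>lborel \<partial>\<mu>)"
    by (rule PM.Fubini') measurable
  also have "\<dots> = (\<integral>\<^sup>+y. emeasure lborel E \<partial>\<mu>)"
    by (intro nn_integral_cong) (subst nn_integral_lborel_translate[of "indicator E"], auto)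
  also have "\<dots> = emeasure lborel E"
    using \<mu>.emeasure_space_1 by simp
  finally show ?thesis .
qed

lemma integrable_P: "0 < t \<Longrightarrow> integrable lborel (P t)"
  using E_finite by (intro integrableI_nonneg) (auto simp: nn_integral_P P_nonneg)

lemma integral_P: "0 < t \<Longrightarrow> (\<integral>x. P t x \<partial>lborel) = measure lborel E"
  by (subst integral_eq_nn_integral) (auto simp: nn_integral_P P_nonneg measure_def)

lemma integrable_E_P: "0 < t \<Longrightarrow> integrable lborel (\<lambda>x. indicator E x * P t x)"
  by (rule Bochner_Integration.integrable_bound[OF integrable_P]) (auto simp: indicator_def)

lemma integral_E_P_le:
  assumes "0 < t"
  shows "(\<integral>x. indicator E x * P t x \<partial>lborel) \<le> (SUP x. \<bar>p x\<bar>) * (measure lborel E)\<^sup>2 * t powr (- (real DIM('a) / \<alpha>))"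
proof -
  let ?B = "(SUP x. \<bar>p x\<bar>) * measure lborel E * t powr (- (real DIM('a) / \<alpha>))"
  have "(\<integral>x. indicator E x * P t x \<partial>lborel) \<le> (\<integral>x. indicator E x * ?B \<partial>lborel)"
    using assms integrable_E
    by (intro integral_mono integrable_E_P integrable_mult_left mult_left_mono P_le) auto
  then show ?thesis by (simp add: power2_eq_square mult_ac)
qed

text \<open>Fubini turns the integral into the mean over y of the overlap of E with its translate by
  \<open>?\<tau> n *\<^sub>R y\<close>; the shifts tend to 0, and the measure of E is the
  majorant.\<close>

lemma integral_E_P_tendsto: "(\<lambda>n. \<integral>x. indicator E x * P (1 / Suc n) x \<partial>lborel) \<longlonglongrightarrow> measure lborel E"
proof -
  interpret PM: pair_sigma_finite "lborel :: 'a measure" \<mu> ..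
  let ?o = "\<lambda>h. \<integral>x. indicator E x * indicator E (x + h) \<partial>lborel :: real"
  let ?\<tau> = "\<lambda>n. (1 / real (Suc n)) powr (1 / \<alpha>)"
  have eq: "(\<integral>x. indicator E x * P (1 / Suc n) x \<partial>lborel) = (\<integral>y. ?o (?\<tau> n *\<^sub>R y) \<partial>\<mu>)" for n
  proof -
    have I: "integrable (lborel \<Otimes>\<^sub>M \<mu>) (\<lambda>(x, y). indicator E x * indicator E (x + ?\<tau> n *\<^sub>R y) :: real)"
      by (rule Bochner_Integration.integrable_bound[OF PM.integrable_pair_mult[OF integrable_E, of "\<lambda>_. 1"]])
         (auto simp: indicator_def)
    have "(\<integral>x. indicator E x * P (1 / Suc n) x \<partial>lborel) =
       (\<integral>x. \<integral>y. indicator E x * indicator E (x + ?\<tau> n *\<^sub>R y) \<partial>\<mu> \<partial>lborel)"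
      unfolding stable_semigroup_def by simp
    also have "\<dots> = (\<integral>y. ?o (?\<tau> n *\<^sub>R y) \<partial>\<mu>)"
      by (rule PM.Fubini_integral[OF I, symmetric])
    finally show ?thesis .
  qed
  have "(\<lambda>n. \<integral>y. ?o (?\<tau> n *\<^sub>R y) \<partial>\<mu>) \<longlonglongrightarrow> (\<integral>y. measure lborel E \<partial>\<mu>)"
  proof (rule integral_dominated_convergence[where w="\<lambda>_. measure lborel E"])
    show "AE y in \<mu>. (\<lambda>n. ?o (?\<tau> n *\<^sub>R y)) \<longlonglongrightarrow> measure lborel E"
    proof (rule AE_I2)
      fix y :: 'a
      have "indicator E x * indicator E (x + 0) = (indicator E x :: real)" for x
        by (simp add: indicator_def)
      then have o0: "?o 0 = measure lborel E" by (simp only:) simp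
      \<comment> \<open>The full neighbourhood filter is required instead of the punctured one: for
        y = 0 all the shifts are equal to 0.\<close>
      have "((\<lambda>h. ?o h) \<longlongrightarrow> measure lborel E) (nhds 0)"
        unfolding tendsto_nhds_iff using tendsto_measure_overlap[OF E E_finite] o0 by (rule conjI)
      moreover have "(\<lambda>n. ?\<tau> n *\<^sub>R y) \<longlonglongrightarrow> 0"
      proof -
        have "?\<tau> \<longlonglongrightarrow> 0"
          using \<alpha> by (intro tendsto_zero_powrI[OF LIMSEQ_Suc[OF lim_1_over_n] tendsto_const]) (auto intro!: always_eventually)
        from tendsto_scaleR[OF this tendsto_const, of y] show ?thesis by simp
      qed
      ultimately show "(\<lambda>n. ?o (?\<tau> n *\<^sub>R y)) \<longlonglongrightarrow> measure lborel E"
        by (rule filterlim_compose)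
    qed
    show "AE y in \<mu>. norm (?o (?\<tau> n *\<^sub>R y)) \<le> measure lborel E" for n
    proof (rule AE_I2)
      fix y :: 'a
      have "norm (?o (?\<tau> n *\<^sub>R y)) \<le> (\<integral>x. indicator E x \<partial>lborel)"
        by (rule order_trans[OF integral_norm_bound integral_mono_AE'])
           (auto intro!: integrable_E mult_left_le indicator_le_1 simp: abs_mult)
      then show "norm (?o (?\<tau> n *\<^sub>R y)) \<le> measure lborel E" by simp
    qed
  qed measurable
  then show ?thesis unfolding eq using \<mu>.prob_space by simp
qed

text \<open>The test function 2 1_E - 1 has modulus one, and its constant term drops out because P_s
  1_E and P_t 1_E have the same mass.\<close>

lemma two_integral_E_P_le:
  assumes "0 < s" "0 < t"
  shows "ennreal (2 * ((\<integral>x. indicator E x * P s x \<partial>lborel) - (\<integral>x. indicator E x * P t x \<partial>lborel)))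
    \<le> (\<integral>\<^sup>+x. ennreal \<bar>P t x - P s x\<bar> \<partial>lborel)"
proof -
  have "2 * ((\<integral>x. indicator E x * P s x \<partial>lborel) - (\<integral>x. indicator E x * P t x \<partial>lborel))
      = (\<integral>x. (2 * indicator E x - 1) * (P s x - P t x) \<partial>lborel)"
  proof -
    note int = integrable_P[OF assms(1)] integrable_P[OF assms(2)] integrable_E_P[OF assms(1)] integrable_E_P[OF assms(2)]
    have "(\<integral>x. (2 * indicator E x - 1) * (P s x - P t x) \<partial>lborel) =
        (\<integral>x. 2 * (indicator E x * P s x) - 2 * (indicator E x * P t x) - (P s x - P t x) \<partial>lborel)"
      by (intro Bochner_Integration.integral_cong) (auto simp: algebra_simps)
    also have "\<dots> = 2 * (\<integral>x. indicator E x * P s x \<partial>lborel) - 2 * (\<integral>x. indicator E x * P t x \<partial>lborel)"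
      using int by (simp add: integral_P assms)
    finally show ?thesis by simp
  qed
  also have "\<dots> \<le> (\<integral>x. \<bar>P t x - P s x\<bar> \<partial>lborel)"
    using integrable_P[OF assms(1)] integrable_P[OF assms(2)]
    by (intro integral_mono_AE' AE_I2) (auto simp: indicator_def)
  finally have "ennreal (2 * ((\<integral>x. indicator E x * P s x \<partial>lborel) - (\<integral>x. indicator E x * P t x \<partial>lborel)))
      \<le> ennreal (\<integral>x. \<bar>P t x - P s x\<bar> \<partial>lborel)"
    by (rule ennreal_leI)
  also have "\<dots> = (\<integral>\<^sup>+x. ennreal \<bar>P t x - P s x\<bar> \<partial>lborel)"
    using integrable_P[OF assms(1)] integrable_P[OF assms(2)] by (subst nn_integral_eq_integral) auto
  finally show ?thesis .
qed

end

section \<open>The gradient of the density and the law of <X, v>\<close>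

context stable_law begin

definition grad_p :: "'a \<Rightarrow> 'a" where
  "grad_p y = (\<Sum>b\<in>Basis. Re (fourier (\<lambda>\<xi>. \<i> * complex_of_real (\<xi> \<bullet> b) * (cst * complex_of_real (phi 1 \<xi>))) y) *\<^sub>R b)"

lemma
  shows gderiv_p: "GDERIV p y :> grad_p y" and continuous_grad_p: "continuous_on UNIV grad_p"
proof -
  have i: "integrable lborel (\<lambda>\<xi>. cst * complex_of_real (phi 1 \<xi>))"
    using integrable_phi[of 1] by auto
  have "integrable lborel (\<lambda>\<xi>. complex_of_real ((norm \<xi>)\<^sup>2) * complex_of_real (phi 1 \<xi>))"
    by (rule integrable_phi_mult[where C=1]) (auto simp: norm_power)
  from integrable_mult_right[OF integrable_norm[OF this], of "norm cst"]
  have i2: "integrable lborel (\<lambda>\<xi>. (norm \<xi>)\<^sup>2 * norm (cst * complex_of_real (phi 1 \<xi>)))"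
    by (simp add: norm_mult norm_power mult_ac)
  have "p = (\<lambda>y. Re (fourier (\<lambda>\<xi>. cst * complex_of_real (phi 1 \<xi>)) y))"
    by (rule ext) (rule p_eq)
  then show "GDERIV p y :> grad_p y"
    using gderiv_fourier[OF i i2] by (simp add: grad_p_def)
  show "continuous_on UNIV grad_p"
    unfolding grad_p_def by (intro continuous_intros continuous_fourier integrable_fourier_gradient i i2)
qed

lemma measurable_grad_p [measurable]: "grad_p \<in> borel_measurable borel"
  by (rule borel_measurable_continuous_onI) (rule continuous_grad_p)

lemma gradient_p: "gradient p = grad_p"
  by (rule ext) (rule gradient_eqI[OF gderiv_p])

lemma integrable_grad_p:
  assumes "L1_norm grad_p < \<infinity>" shows "integrable lborel grad_p"
  using assms by (simp add: integrable_iff_bounded L1_norm_def)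

text \<open>Integration by parts against \<open>iexp (\<xi> \<bullet> y)\<close>: \<open>?h'\<close>
  is the derivative of the product in direction b, and its integral vanishes.\<close>

lemma fourier_grad_p:
  assumes fin: "L1_norm grad_p < \<infinity>"
  shows "fourier (\<lambda>y. complex_of_real (grad_p y \<bullet> b)) \<xi> = - \<i> * complex_of_real (\<xi> \<bullet> b) * complex_of_real (phi 1 \<xi>)"
proof -
  let ?h = "\<lambda>y. iexp (\<xi> \<bullet> y) * complex_of_real (p y)"
  let ?g = "\<lambda>y. iexp (\<xi> \<bullet> y) * complex_of_real (grad_p y \<bullet> b)"
  let ?h' = "\<lambda>y. ?g y + (\<i> * complex_of_real (\<xi> \<bullet> b)) * ?h y"
  have ih: "integrable lborel ?h" by (intro integrable_iexp_mult integrable_of_real integrable_p) simp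
  have ig: "integrable lborel ?g"
    by (intro integrable_iexp_mult integrable_of_real integrable_inner_left integrable_grad_p fin) simp
  have "(CLINT y|lborel. ?h' y) = 0"
  proof (rule integral_directional_derivative[OF ih, where b=b])
    show "integrable lborel ?h'" using ih ig by (intro Bochner_Integration.integrable_add integrable_mult_right)
    show "continuous_on UNIV ?h'" by (intro continuous_intros cont_p continuous_grad_p)
    fix y
    have line: "((\<lambda>s. y + s *\<^sub>R b) has_derivative (\<lambda>s. s *\<^sub>R b)) (at 0)"
      by (auto intro!: derivative_eq_intros)
    have "FDERIV p (y + 0 *\<^sub>R b) :> (\<lambda>h. h \<bullet> grad_p y)"
      using gderiv_p[of y] by (simp add: gderiv_def)
    from diff_chain_at[OF line this]
    have "((\<lambda>s. p (y + s *\<^sub>R b)) has_derivative (\<lambda>s. s * (b \<bullet> grad_p y))) (at 0)"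
      by (simp add: comp_def)
    then have dp: "((\<lambda>s. p (y + s *\<^sub>R b)) has_vector_derivative (grad_p y \<bullet> b)) (at 0)"
      by (simp add: has_vector_derivative_def inner_commute)
    have dp': "((\<lambda>s. complex_of_real (p (y + s *\<^sub>R b))) has_vector_derivative complex_of_real (grad_p y \<bullet> b)) (at 0)"
      using has_vector_derivative_of_real[OF dp[folded has_real_derivative_iff_has_vector_derivative]] .
    have de: "((\<lambda>s. iexp (\<xi> \<bullet> (y + s *\<^sub>R b))) has_vector_derivative (\<i> * complex_of_real (\<xi> \<bullet> b)) * iexp (\<xi> \<bullet> y)) (at 0)"
    proof -
      have "((\<lambda>s. iexp (\<xi> \<bullet> y) * exp (s *\<^sub>R (\<i> * complex_of_real (\<xi> \<bullet> b)))) has_vector_derivative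
          iexp (\<xi> \<bullet> y) * ((\<i> * complex_of_real (\<xi> \<bullet> b)) * exp (0 *\<^sub>R (\<i> * complex_of_real (\<xi> \<bullet> b))))) (at 0)"
        by (intro has_vector_derivative_mult_right exp_scaleR_has_vector_derivative_left)
      then show ?thesis
        by (simp add: inner_add_right distrib_left exp_add scaleR_conv_of_real mult_ac)
    qed
    show "((\<lambda>s. ?h (y + s *\<^sub>R b)) has_vector_derivative ?h' y) (at 0)"
      using has_vector_derivative_mult[OF de dp'] by (simp add: mult_ac)
  qed
  then have "(CLINT y|lborel. ?g y) = - ((\<i> * complex_of_real (\<xi> \<bullet> b)) * (CLINT y|lborel. ?h y))"
    using ih ig by (subst (asm) Bochner_Integration.integral_add) (auto simp: add_eq_0_iff2)
  also have "(CLINT y|lborel. ?h y) = complex_of_real (phi 1 \<xi>)"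
    using fourier_p[of \<xi>] by (simp add: fourier_def phi_def)
  finally show ?thesis by (simp add: fourier_def)
qed

text \<open>The characteristic function of <X, v> at t is that of X at t v; by homogeneity of \<psi>
  it is that of Y scaled by the stable norm of v, and Levy's uniqueness theorem identifies the
  laws.\<close>

lemma stable_projection:
  assumes N: "prob_space N" and Y [measurable]: "Y \<in> borel_measurable N"
    and char: "\<And>t. char (distr N borel Y) t = complex_of_real (exp (- (\<bar>t\<bar> powr \<alpha>)))"
  shows "(\<integral>\<^sup>+y. ennreal \<bar>y \<bullet> v\<bar> \<partial>\<mu>) = ennreal (stable_norm \<alpha> \<sigma> v * prob_space.expectation N (\<lambda>\<omega>. \<bar>Y \<omega>\<bar>))"
proof -
  interpret N: prob_space N by fact
  let ?s = "stable_norm \<alpha> \<sigma> v"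
  have s0: "0 \<le> ?s" by (simp add: stable_norm_def)
  have "distr \<mu> borel (\<lambda>y. y \<bullet> v) = distr N borel (\<lambda>\<omega>. ?s * Y \<omega>)"
  proof (rule Levy_uniqueness)
    show "real_distribution (distr \<mu> borel (\<lambda>y. y \<bullet> v))"
      by (rule \<mu>.real_distribution_distr) simp
    show "real_distribution (distr N borel (\<lambda>\<omega>. ?s * Y \<omega>))"
      by (rule N.real_distribution_distr) simp
    show "Characteristic_Functions.char (distr \<mu> borel (\<lambda>y. y \<bullet> v)) = Characteristic_Functions.char (distr N borel (\<lambda>\<omega>. ?s * Y \<omega>))"
    proof
      fix t :: real
      have "Characteristic_Functions.char (distr \<mu> borel (\<lambda>y. y \<bullet> v)) t = (CLINT y|\<mu>. iexp (t * (y \<bullet> v)))"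
        unfolding char_def by (rule integral_distr) auto
      also have "\<dots> = fourier (\<lambda>y. complex_of_real (p y)) (t *\<^sub>R v)"
        unfolding fourier_def
        by (subst integral_\<mu>) (auto simp: scaleR_conv_of_real inner_commute mult_ac)
      also have "\<dots> = complex_of_real (exp (- (\<bar>t * ?s\<bar> powr \<alpha>)))"
        using s0 by (simp add: fourier_p psi_scaleR abs_mult powr_mult stable_norm_powr)
      also have "\<dots> = (CLINT \<omega>|N. iexp ((t * ?s) * Y \<omega>))"
        unfolding char[symmetric] char_def by (rule integral_distr) auto
      also have "\<dots> = Characteristic_Functions.char (distr N borel (\<lambda>\<omega>. ?s * Y \<omega>)) t"
        unfolding char_def by (subst integral_distr) (auto simp: mult_ac)
      finally show "Characteristic_Functions.char (distr \<mu> borel (\<lambda>y. y \<bullet> v)) t = Characteristic_Functions.char (distr N borel (\<lambda>\<omega>. ?s * Y \<omega>)) t" .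
    qed
  qed
  then have "(\<integral>\<^sup>+x. ennreal \<bar>x\<bar> \<partial>(distr \<mu> borel (\<lambda>y. y \<bullet> v))) = (\<integral>\<^sup>+x. ennreal \<bar>x\<bar> \<partial>(distr N borel (\<lambda>\<omega>. ?s * Y \<omega>)))"
    by simp
  then have "(\<integral>\<^sup>+y. ennreal \<bar>y \<bullet> v\<bar> \<partial>\<mu>) = (\<integral>\<^sup>+\<omega>. ennreal \<bar>?s * Y \<omega>\<bar> \<partial>N)"
    by (simp add: nn_integral_distr)
  also have "\<dots> = ennreal (\<integral>\<omega>. \<bar>?s * Y \<omega>\<bar> \<partial>N)"
    using stable_1d_integrable(1)[OF N Y char \<alpha>] by (intro nn_integral_eq_integral) auto
  also have "(\<integral>\<omega>. \<bar>?s * Y \<omega>\<bar> \<partial>N) = ?s * (\<integral>\<omega>. \<bar>Y \<omega>\<bar> \<partial>N)"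
    using s0 by (simp add: abs_mult)
  finally show ?thesis .
qed

text \<open>Dividing by \<open>c\<close> writes the stable norm as a mixture of moduli of linear
  forms. Measurability follows at once, and Jensen from the triangle inequality for integrals and
  Tonelli.\<close>

lemma jensen_stable_norm:
  assumes proj: "\<And>v. (\<integral>\<^sup>+y. ennreal \<bar>y \<bullet> v\<bar> \<partial>\<mu>) = ennreal (stable_norm \<alpha> \<sigma> v * c)" and c: "0 < c"
  shows "jensen (stable_norm \<alpha> \<sigma>)"
proof -
  have s0: "0 \<le> stable_norm \<alpha> \<sigma> v" for v by (simp add: stable_norm_def)
  have eq: "ennreal (stable_norm \<alpha> \<sigma> v) = ennreal (1 / c) * (\<integral>\<^sup>+y. ennreal \<bar>y \<bullet> v\<bar> \<partial>\<mu>)" for v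
    unfolding proj using c s0[of v] by (subst ennreal_mult[symmetric]) auto
  have "(\<lambda>v. ennreal (stable_norm \<alpha> \<sigma> v)) \<in> borel_measurable borel"
    unfolding eq by measurable
  then have "(\<lambda>v. enn2real (ennreal (stable_norm \<alpha> \<sigma> v))) \<in> borel_measurable borel"
    by measurable
  then have m [measurable]: "stable_norm \<alpha> \<sigma> \<in> borel_measurable borel" using s0 by simp
  interpret MM: pair_sigma_finite \<mu> \<mu> ..
  have "ennreal (stable_norm \<alpha> \<sigma> (\<integral>y. w y \<partial>\<mu>)) \<le> (\<integral>\<^sup>+y. ennreal (stable_norm \<alpha> \<sigma> (w y)) \<partial>\<mu>)" if w: "integrable \<mu> w" for w
  proof -
    have [measurable]: "w \<in> borel_measurable borel" using w by auto
    have "(\<integral>\<^sup>+z. ennreal \<bar>z \<bullet> (\<integral>y. w y \<partial>\<mu>)\<bar> \<partial>\<mu>) \<le> (\<integral>\<^sup>+z. \<integral>\<^sup>+y. ennreal \<bar>z \<bullet> w y\<bar> \<partial>\<mu> \<partial>\<mu>)"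
    proof (intro nn_integral_mono)
      fix z
      have "z \<bullet> (\<integral>y. w y \<partial>\<mu>) = (\<integral>y. z \<bullet> w y \<partial>\<mu>)"
        using w by (intro integral_inner_right[symmetric]) simp
      then show "ennreal \<bar>z \<bullet> (\<integral>y. w y \<partial>\<mu>)\<bar> \<le> (\<integral>\<^sup>+y. ennreal \<bar>z \<bullet> w y\<bar> \<partial>\<mu>)"
        using integral_norm_bound_ennreal[OF integrable_inner_right[of z \<mu> w]] w by simp
    qed
    also have "\<dots> = (\<integral>\<^sup>+y. \<integral>\<^sup>+z. ennreal \<bar>z \<bullet> w y\<bar> \<partial>\<mu> \<partial>\<mu>)"
      by (rule MM.Fubini'[symmetric]) measurable
    finally have "ennreal (1 / c) * (\<integral>\<^sup>+z. ennreal \<bar>z \<bullet> (\<integral>y. w y \<partial>\<mu>)\<bar> \<partial>\<mu>) \<le>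
        ennreal (1 / c) * (\<integral>\<^sup>+y. \<integral>\<^sup>+z. ennreal \<bar>z \<bullet> w y\<bar> \<partial>\<mu> \<partial>\<mu>)"
      by (rule mult_left_mono) simp
    also have "\<dots> = (\<integral>\<^sup>+y. ennreal (1 / c) * (\<integral>\<^sup>+z. ennreal \<bar>z \<bullet> w y\<bar> \<partial>\<mu>) \<partial>\<mu>)"
      by (rule nn_integral_cmult[symmetric]) measurable
    finally show ?thesis by (simp only: eq)
  qed
  then show ?thesis using s0 m by (simp add: jensen_def)
qed

end

subsection \<open>Increments of the semigroup\<close>

context stable_law_set begin

lemma P_segment:
  assumes t: "0 < t"
  shows "ennreal \<bar>P t (x + u) - P t x\<bar> \<le>
    (\<integral>\<^sup>+s. ennreal (indicator {0..1} s * \<bar>u \<bullet> field grad_symbol t (x + s *\<^sub>R u)\<bar>) \<partial>lborel)"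
proof -
  let ?V = "field grad_symbol t"
  have c: "continuous_on {0..1} (\<lambda>s. u \<bullet> ?V (x + s *\<^sub>R u))"
    by (intro continuous_intros continuous_on_compose2[OF continuous_field[OF admissible_grad_symbol t]]) auto
  have d: "((\<lambda>s. P t (x + s *\<^sub>R u)) has_vector_derivative (u \<bullet> ?V (x + s *\<^sub>R u))) (at s within {0..1})" for s
  proof -
    have line: "((\<lambda>s. x + s *\<^sub>R u) has_derivative (\<lambda>s. s *\<^sub>R u)) (at s)"
      by (auto intro!: derivative_eq_intros)
    have "FDERIV (P t) (x + s *\<^sub>R u) :> (\<lambda>h. h \<bullet> ?V (x + s *\<^sub>R u))"
      using gradient_P[OF t, of "x + s *\<^sub>R u"] by (simp add: gderiv_def)
    from diff_chain_at[OF line this]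
    have "((\<lambda>s. P t (x + s *\<^sub>R u)) has_derivative (\<lambda>r. r * (u \<bullet> ?V (x + s *\<^sub>R u)))) (at s)"
      by (simp add: comp_def)
    then show ?thesis
      unfolding has_vector_derivative_def real_scaleR_def by (rule has_derivative_at_withinI)
  qed
  have "(\<integral>s. indicator {0..1} s *\<^sub>R (u \<bullet> ?V (x + s *\<^sub>R u)) \<partial>lborel) = P t (x + u) - P t x"
    using integral_FTC_Icc[OF zero_le_one d c] by simp
  moreover have "integrable lborel (\<lambda>s. indicator {0..1} s *\<^sub>R (u \<bullet> ?V (x + s *\<^sub>R u)))"
    using has_bochner_integral_FTC_Icc[OF zero_le_one d c] by (simp add: has_bochner_integral_iff)
  ultimately show ?thesis
    using integral_norm_bound_ennreal[of lborel "\<lambda>s. indicator {0..1} s *\<^sub>R (u \<bullet> ?V (x + s *\<^sub>R u))"]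
    by (simp add: abs_mult)
qed

text \<open>The directional derivative is kept and not split by Cauchy-Schwarz: averaged over the
  stable law it becomes exactly a multiple of the stable norm of the gradient.\<close>

lemma nn_integral_P_translate_le:
  assumes t: "0 < t"
  shows "(\<integral>\<^sup>+x. ennreal \<bar>P t (x + u) - P t x\<bar> \<partial>lborel) \<le> (\<integral>\<^sup>+x. ennreal \<bar>u \<bullet> field grad_symbol t x\<bar> \<partial>lborel)"
proof -
  let ?V = "field grad_symbol t"
  have [measurable]: "?V \<in> borel_measurable borel" by (rule measurable_field[OF admissible_grad_symbol t])
  have "(\<integral>\<^sup>+x. ennreal \<bar>P t (x + u) - P t x\<bar> \<partial>lborel) \<le>
      (\<integral>\<^sup>+x. \<integral>\<^sup>+s. ennreal (indicator {0..1} s * \<bar>u \<bullet> ?V (x + s *\<^sub>R u)\<bar>) \<partial>lborel \<partial>lborel)"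
    by (intro nn_integral_mono P_segment t)
  also have "\<dots> = (\<integral>\<^sup>+s. \<integral>\<^sup>+x. ennreal (indicator {0..1} s * \<bar>u \<bullet> ?V (x + s *\<^sub>R u)\<bar>) \<partial>lborel \<partial>lborel)"
    by (rule lborel_pair.Fubini') measurable
  also have "\<dots> = (\<integral>\<^sup>+s. (\<integral>\<^sup>+x. ennreal \<bar>u \<bullet> ?V x\<bar> \<partial>lborel) * indicator {0..1::real} s \<partial>lborel)"
  proof (intro nn_integral_cong)
    fix s :: real
    have "(\<integral>\<^sup>+x. ennreal \<bar>u \<bullet> ?V (x + s *\<^sub>R u)\<bar> \<partial>lborel) = (\<integral>\<^sup>+x. ennreal \<bar>u \<bullet> ?V x\<bar> \<partial>lborel)"
      by (rule nn_integral_lborel_translate[of "\<lambda>x. ennreal \<bar>u \<bullet> ?V x\<bar>"]) measurable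
    then show "(\<integral>\<^sup>+x. ennreal (indicator {0..1} s * \<bar>u \<bullet> ?V (x + s *\<^sub>R u)\<bar>) \<partial>lborel) =
        (\<integral>\<^sup>+x. ennreal \<bar>u \<bullet> ?V x\<bar> \<partial>lborel) * indicator {0..1::real} s"
      by (simp add: indicator_def)
  qed
  also have "\<dots> = (\<integral>\<^sup>+x. ennreal \<bar>u \<bullet> ?V x\<bar> \<partial>lborel)"
    by (subst nn_integral_cmult_indicator) simp_all
  finally show ?thesis .
qed

text \<open>Tonelli allows the average over y to be taken for fixed x, where \<open>proj\<close>
  evaluates it exactly.\<close>

lemma L1_increment_cl:
  assumes \<epsilon>: "0 < \<epsilon>" and t: "0 < t" and c: "0 < c"
    and proj: "\<And>v. (\<integral>\<^sup>+y. ennreal \<bar>y \<bullet> v\<bar> \<partial>\<mu>) = ennreal (stable_norm \<alpha> \<sigma> v * c)"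
  shows "(\<integral>\<^sup>+x. ennreal \<bar>P (\<epsilon> + t) x - P \<epsilon> x\<bar> \<partial>lborel) \<le>
    ennreal (t powr (1 / \<alpha>) * c) * L1_norm (\<lambda>x. stable_norm \<alpha> \<sigma> (field grad_symbol \<epsilon> x))"
proof -
  let ?V = "field grad_symbol \<epsilon>" and ?\<tau> = "t powr (1 / \<alpha>)"
  have \<tau>: "0 \<le> ?\<tau>" by simp
  have s0: "0 \<le> stable_norm \<alpha> \<sigma> v" for v by (simp add: stable_norm_def)
  have [measurable]: "?V \<in> borel_measurable borel" by (rule measurable_field[OF admissible_grad_symbol \<epsilon>])
  have [measurable]: "P \<epsilon> \<in> borel_measurable borel" by (rule measurable_P[OF \<epsilon>])
  have [measurable]: "stable_norm \<alpha> \<sigma> \<in> borel_measurable borel"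
    using jensen_stable_norm[OF proj c] by (simp add: jensen_def)
  interpret PM: pair_sigma_finite \<mu> "lborel :: 'a measure" ..
  have "(\<integral>\<^sup>+x. ennreal \<bar>P (\<epsilon> + t) x - P \<epsilon> x\<bar> \<partial>lborel) \<le> (\<integral>\<^sup>+x. \<integral>\<^sup>+y. ennreal \<bar>P \<epsilon> (x + ?\<tau> *\<^sub>R y) - P \<epsilon> x\<bar> \<partial>\<mu> \<partial>lborel)"
  proof (intro nn_integral_mono)
    fix x
    note A = average_fourier[OF integrable_symb[OF \<epsilon>] t, of x]
    have "P (\<epsilon> + t) x = Re (fourier (symb (\<epsilon> + t)) x)"
      using \<epsilon> t by (subst P_eq) auto
    also have "\<dots> = Re (fourier (\<lambda>\<xi>. symb \<epsilon> \<xi> * complex_of_real (phi t \<xi>)) x)"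
      by (simp add: symb_add[abs_def])
    also have "\<dots> = (\<integral>y. P \<epsilon> (x + ?\<tau> *\<^sub>R y) \<partial>\<mu>)"
      using A(1) by (simp add: P_eq[OF \<epsilon>])
    finally have 1: "P (\<epsilon> + t) x = (\<integral>y. P \<epsilon> (x + ?\<tau> *\<^sub>R y) \<partial>\<mu>)" .
    have i: "integrable \<mu> (\<lambda>y. P \<epsilon> (x + ?\<tau> *\<^sub>R y))"
      using A(2) by (simp add: P_eq[OF \<epsilon>])
    have "P (\<epsilon> + t) x - P \<epsilon> x = (\<integral>y. P \<epsilon> (x + ?\<tau> *\<^sub>R y) - P \<epsilon> x \<partial>\<mu>)"
      unfolding 1 using i \<mu>.prob_space by (subst Bochner_Integration.integral_diff) auto
    then show "ennreal \<bar>P (\<epsilon> + t) x - P \<epsilon> x\<bar> \<le> (\<integral>\<^sup>+y. ennreal \<bar>P \<epsilon> (x + ?\<tau> *\<^sub>R y) - P \<epsilon> x\<bar> \<partial>\<mu>)"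
      using integral_norm_bound_ennreal[of \<mu> "\<lambda>y. P \<epsilon> (x + ?\<tau> *\<^sub>R y) - P \<epsilon> x"] i by simp
  qed
  also have "\<dots> = (\<integral>\<^sup>+y. \<integral>\<^sup>+x. ennreal \<bar>P \<epsilon> (x + ?\<tau> *\<^sub>R y) - P \<epsilon> x\<bar> \<partial>lborel \<partial>\<mu>)"
    by (rule PM.Fubini') measurable
  also have "\<dots> \<le> (\<integral>\<^sup>+y. \<integral>\<^sup>+x. ennreal \<bar>(?\<tau> *\<^sub>R y) \<bullet> ?V x\<bar> \<partial>lborel \<partial>\<mu>)"
    by (intro nn_integral_mono nn_integral_P_translate_le \<epsilon>)
  also have "\<dots> = (\<integral>\<^sup>+x. \<integral>\<^sup>+y. ennreal \<bar>(?\<tau> *\<^sub>R y) \<bullet> ?V x\<bar> \<partial>\<mu> \<partial>lborel)"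
    by (rule PM.Fubini'[symmetric]) measurable
  also have "\<dots> = (\<integral>\<^sup>+x. ennreal (?\<tau> * c) * ennreal (norm (stable_norm \<alpha> \<sigma> (?V x))) \<partial>lborel)"
  proof (intro nn_integral_cong)
    fix x
    have "(\<integral>\<^sup>+y. ennreal \<bar>(?\<tau> *\<^sub>R y) \<bullet> ?V x\<bar> \<partial>\<mu>) = (\<integral>\<^sup>+y. ennreal ?\<tau> * ennreal \<bar>y \<bullet> ?V x\<bar> \<partial>\<mu>)"
      using \<tau> by (intro nn_integral_cong) (simp add: abs_mult ennreal_mult)
    also have "\<dots> = ennreal ?\<tau> * ennreal (stable_norm \<alpha> \<sigma> (?V x) * c)"
      unfolding proj[symmetric] by (rule nn_integral_cmult) measurable
    also have "\<dots> = ennreal (?\<tau> * c) * ennreal (norm (stable_norm \<alpha> \<sigma> (?V x)))"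
      using \<tau> c s0[of "?V x"] by (simp add: ennreal_mult[symmetric] mult_ac)
    finally show "(\<integral>\<^sup>+y. ennreal \<bar>(?\<tau> *\<^sub>R y) \<bullet> ?V x\<bar> \<partial>\<mu>) = \<dots>" .
  qed
  also have "\<dots> = ennreal (?\<tau> * c) * L1_norm (\<lambda>x. stable_norm \<alpha> \<sigma> (?V x))"
    unfolding L1_norm_def by (rule nn_integral_cmult) measurable
  finally show ?thesis .
qed

text \<open>Half of the time \<epsilon> pays for the factor \<psi>, by s <= exp s at s = \<epsilon>
  \<psi>/2.\<close>

lemma psi_symb_le:
  assumes "0 < \<epsilon>"
  shows "psi \<xi> * norm (symb \<epsilon> \<xi>) \<le> 2 / \<epsilon> * norm (symb (\<epsilon> / 2) \<xi>)"
proof -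
  have "\<epsilon> / 2 * psi \<xi> \<le> exp (\<epsilon> / 2 * psi \<xi>)"
    using exp_ge_add_one_self[of "\<epsilon> / 2 * psi \<xi>"] by linarith
  then have 1: "psi \<xi> \<le> 2 / \<epsilon> * exp (\<epsilon> / 2 * psi \<xi>)" using assms by (simp add: field_simps)
  have "psi \<xi> * phi \<epsilon> \<xi> \<le> (2 / \<epsilon> * exp (\<epsilon> / 2 * psi \<xi>)) * phi \<epsilon> \<xi>"
    using 1 less_imp_le[OF phi_pos] by (rule mult_right_mono)
  also have "\<dots> = 2 / \<epsilon> * phi (\<epsilon> / 2) \<xi>"
    by (simp add: phi_def exp_add[symmetric])
  finally have "norm (cst * Ehat \<xi>) * (psi \<xi> * phi \<epsilon> \<xi>) \<le> norm (cst * Ehat \<xi>) * (2 / \<epsilon> * phi (\<epsilon> / 2) \<xi>)"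
    by (rule mult_left_mono) simp
  then show ?thesis
    by (simp add: symb_def norm_mult abs_of_pos phi_pos mult_ac)
qed

lemma integrable_psi_symb:
  assumes "0 < \<epsilon>" shows "integrable lborel (\<lambda>\<xi>. psi \<xi> * norm (symb \<epsilon> \<xi>))"
proof (rule Bochner_Integration.integrable_bound)
  show "integrable lborel (\<lambda>\<xi>. 2 / \<epsilon> * norm (symb (\<epsilon> / 2) \<xi>))"
    using assms by (intro integrable_mult_right integrable_norm integrable_symb) simp
  show "AE \<xi> in lborel. norm (psi \<xi> * norm (symb \<epsilon> \<xi>)) \<le> norm (2 / \<epsilon> * norm (symb (\<epsilon> / 2) \<xi>))"
    using psi_symb_le[OF assms] assms psi_nonneg by (intro AE_I2) (simp add: abs_mult)
qed measurable

text \<open>The derivative of exp (-s \<psi>) in s is integrated inside the Fourier integral. The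
  increment is oriented as earlier minus later, so that the symbol \<psi> carries no sign.\<close>

lemma P_time_integral:
  assumes \<epsilon>: "0 < \<epsilon>" and t: "0 < t"
  shows "P \<epsilon> x - P (\<epsilon> + t) x =
      (\<integral>s. indicator {0..t} s * Re (fourier (\<lambda>\<xi>. complex_of_real (psi \<xi>) * symb (\<epsilon> + s) \<xi>) x) \<partial>lborel)"
    and "integrable lborel (\<lambda>s. indicator {0..t} s * Re (fourier (\<lambda>\<xi>. complex_of_real (psi \<xi>) * symb (\<epsilon> + s) \<xi>) x))"
proof -
  let ?K = "\<lambda>s \<xi>. complex_of_real (indicator {0..t} s) * (complex_of_real (psi \<xi>) * symb (\<epsilon> + s) \<xi>)"
  have I: "integrable (lborel \<Otimes>\<^sub>M lborel) (\<lambda>(s, \<xi>). ?K s \<xi>)"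
  proof (rule Bochner_Integration.integrable_bound)
    show "integrable (lborel \<Otimes>\<^sub>M lborel) (\<lambda>(s::real, \<xi>). indicator {0..t} s * (psi \<xi> * norm (symb \<epsilon> \<xi>)))"
      using integrable_psi_symb[OF \<epsilon>] by (intro lborel_pair.integrable_pair_mult) (auto simp: integrable_indicator_iff emeasure_lborel_Icc_eq)
    show "(\<lambda>(s, \<xi>). ?K s \<xi>) \<in> borel_measurable (lborel \<Otimes>\<^sub>M lborel)"
      unfolding symb_def phi_def by measurable
    have "norm (?K s \<xi>) \<le> indicator {0..t} s * (psi \<xi> * norm (symb \<epsilon> \<xi>))" for s \<xi>
    proof (cases "s \<in> {0..t}")
      case True
      have "norm (symb (\<epsilon> + s) \<xi>) \<le> norm (symb \<epsilon> \<xi>)"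
        unfolding symb_add norm_mult using True psi_nonneg[of \<xi>]
        by (intro mult_left_le) (auto simp: phi_def)
      then have "psi \<xi> * norm (symb (\<epsilon> + s) \<xi>) \<le> psi \<xi> * norm (symb \<epsilon> \<xi>)"
        using psi_nonneg by (rule mult_left_mono)
      then show ?thesis using True psi_nonneg[of \<xi>] by (simp add: norm_mult)
    qed simp
    then show "AE z in lborel \<Otimes>\<^sub>M lborel. norm (case z of (s, \<xi>) \<Rightarrow> ?K s \<xi>) \<le>
        norm (case z of (s, \<xi>) \<Rightarrow> indicator {0..t} s * (psi \<xi> * norm (symb \<epsilon> \<xi>)))"
      by (intro AE_I2) (auto intro: order_trans[OF _ abs_ge_self])
  qed
  have 1: "Re (fourier (?K s) x) = indicator {0..t} s * Re (fourier (\<lambda>\<xi>. complex_of_real (psi \<xi>) * symb (\<epsilon> + s) \<xi>) x)" for s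
    by (cases "s \<in> {0..t}") (simp_all add: fourier_def)
  have 2: "(CLINT s|lborel. ?K s \<xi>) = symb \<epsilon> \<xi> - symb (\<epsilon> + t) \<xi>" for \<xi>
  proof -
    have d: "((\<lambda>s. - phi s \<xi>) has_vector_derivative (psi \<xi> * phi s \<xi>)) (at s within {0..t})" for s
      unfolding phi_def has_real_derivative_iff_has_vector_derivative[symmetric]
      by (auto intro!: derivative_eq_intros)
    have "continuous_on {0..t} (\<lambda>s. psi \<xi> * phi s \<xi>)"
      unfolding phi_def by (intro continuous_intros)
    from integral_FTC_Icc[OF less_imp_le[OF t] d this]
    have e: "(\<integral>s. indicator {0..t} s * (psi \<xi> * phi s \<xi>) \<partial>lborel) = 1 - phi t \<xi>"
      by (simp add: phi_def)
    have "(CLINT s|lborel. ?K s \<xi>) = (CLINT s|lborel. symb \<epsilon> \<xi> * complex_of_real (indicator {0..t} s * (psi \<xi> * phi s \<xi>)))"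
      by (intro Bochner_Integration.integral_cong) (auto simp: symb_add mult_ac)
    also have "\<dots> = symb \<epsilon> \<xi> * complex_of_real (1 - phi t \<xi>)"
      unfolding integral_mult_right_zero integral_complex_of_real e ..
    finally show ?thesis by (simp add: symb_add algebra_simps)
  qed
  note F = lborel.fourier_Fubini(1)[OF I, where x=x, unfolded 1] lborel.fourier_Fubini(3)[OF I, where x=x, unfolded 1 2]
  show "integrable lborel (\<lambda>s. indicator {0..t} s * Re (fourier (\<lambda>\<xi>. complex_of_real (psi \<xi>) * symb (\<epsilon> + s) \<xi>) x))"
    by (rule F(1))
  have "fourier (\<lambda>\<xi>. symb \<epsilon> \<xi> - symb (\<epsilon> + t) \<xi>) x = fourier (symb \<epsilon>) x - fourier (symb (\<epsilon> + t)) x"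
    using \<epsilon> t unfolding fourier_def right_diff_distrib
    by (intro Bochner_Integration.integral_diff integrable_iexp_mult integrable_symb) auto
  then show "P \<epsilon> x - P (\<epsilon> + t) x =
      (\<integral>s. indicator {0..t} s * Re (fourier (\<lambda>\<xi>. complex_of_real (psi \<xi>) * symb (\<epsilon> + s) \<xi>) x) \<partial>lborel)"
    using \<epsilon> t F(2) by (simp add: P_eq)
qed

text \<open>The generator is \<open>1 / \<alpha>\<close> times the divergence of \<open>D\<^sup>\<alpha>\<^sup>-\<^sup>1\<close>; moving the divergence onto the
  density produces \<open>\<nabla>p\<close>.\<close>

lemma generator_divergence:
  assumes fin: "L1_norm grad_p < \<infinity>" and \<epsilon>: "0 < \<epsilon>" and s: "0 < s"
  shows "(\<integral>y. grad_p y \<bullet> field levy_symbol \<epsilon> (x + s powr (1 / \<alpha>) *\<^sub>R y) \<partial>lborel) =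
      \<alpha> * s powr (1 / \<alpha>) * Re (fourier (\<lambda>\<xi>. complex_of_real (psi \<xi>) * symb (\<epsilon> + s) \<xi>) x)"
    and "integrable lborel (\<lambda>y. grad_p y \<bullet> field levy_symbol \<epsilon> (x + s powr (1 / \<alpha>) *\<^sub>R y))"
proof -
  let ?\<tau> = "s powr (1 / \<alpha>)"
  let ?M = "\<lambda>b \<xi>. (levy_symbol b \<xi> * symb \<epsilon> \<xi>) * fourier (\<lambda>y. complex_of_real (grad_p y \<bullet> b)) (?\<tau> *\<^sub>R \<xi>)"
  have k: "integrable lborel (\<lambda>y. grad_p y \<bullet> b)" for b
    by (intro integrable_inner_left integrable_grad_p fin)
  note C = fourier_convolution[OF k integrable_admissible[OF admissible_levy_symbol \<epsilon>]]
  have inner: "grad_p y \<bullet> field levy_symbol \<epsilon> (x + ?\<tau> *\<^sub>R y) =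
      (\<Sum>b\<in>Basis. (grad_p y \<bullet> b) * Re (fourier (\<lambda>\<xi>. levy_symbol b \<xi> * symb \<epsilon> \<xi>) (x + ?\<tau> *\<^sub>R y)))" for y
    by (subst euclidean_inner) (simp add: field_inner)
  show "integrable lborel (\<lambda>y. grad_p y \<bullet> field levy_symbol \<epsilon> (x + ?\<tau> *\<^sub>R y))"
    unfolding inner by (intro Bochner_Integration.integrable_sum C(1))
  have "(\<integral>y. grad_p y \<bullet> field levy_symbol \<epsilon> (x + ?\<tau> *\<^sub>R y) \<partial>lborel) = (\<Sum>b\<in>Basis. Re (fourier (?M b) x))"
    unfolding inner by (subst Bochner_Integration.integral_sum) (auto intro!: C(1) simp: C(3))
  also have "\<dots> = Re (fourier (\<lambda>\<xi>. \<Sum>b\<in>Basis. ?M b \<xi>) x)"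
    by (simp only: fourier_sum[OF C(2)] Re_sum)
  also have "(\<lambda>\<xi>. \<Sum>b\<in>Basis. ?M b \<xi>) = (\<lambda>\<xi>. complex_of_real (\<alpha> * ?\<tau>) * (complex_of_real (psi \<xi>) * symb (\<epsilon> + s) \<xi>))"
  proof
    fix \<xi>
    \<comment> \<open>Evaluating the transform of \<nabla>p at \<tau> \<xi> supplies both the factor
      \<tau> and the multiplier \<open>phi s\<close> that advances \<open>symb \<epsilon>\<close> to
      \<open>symb (\<epsilon> + s)\<close>; its -i cancels against the i of the Levy symbol.\<close>
    have "?M b \<xi> = (- \<i> * complex_of_real ?\<tau> * symb (\<epsilon> + s) \<xi>) * (complex_of_real (\<xi> \<bullet> b) * levy_symbol b \<xi>)" for b
      unfolding fourier_grad_p[OF fin] phi_scale[OF s] by (simp add: symb_add mult_ac)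
    then have "(\<Sum>b\<in>Basis. ?M b \<xi>) = (- \<i> * complex_of_real ?\<tau> * symb (\<epsilon> + s) \<xi>) * (\<i> * complex_of_real (\<alpha> * psi \<xi>))"
      by (simp only: sum_distrib_left[symmetric] levy_symbol_inner)
    then show "(\<Sum>b\<in>Basis. ?M b \<xi>) = complex_of_real (\<alpha> * ?\<tau>) * (complex_of_real (psi \<xi>) * symb (\<epsilon> + s) \<xi>)"
      by (simp add: mult_ac)
  qed
  also have "fourier (\<lambda>\<xi>. complex_of_real (\<alpha> * ?\<tau>) * (complex_of_real (psi \<xi>) * symb (\<epsilon> + s) \<xi>)) x
      = complex_of_real (\<alpha> * ?\<tau>) * fourier (\<lambda>\<xi>. complex_of_real (psi \<xi>) * symb (\<epsilon> + s) \<xi>) x"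
    unfolding fourier_def integral_mult_right_zero[symmetric]
    by (intro Bochner_Integration.integral_cong) (auto simp: mult_ac)
  finally show "(\<integral>y. grad_p y \<bullet> field levy_symbol \<epsilon> (x + ?\<tau> *\<^sub>R y) \<partial>lborel) =
      \<alpha> * ?\<tau> * Re (fourier (\<lambda>\<xi>. complex_of_real (psi \<xi>) * symb (\<epsilon> + s) \<xi>) x)"
    by simp
qed

text \<open>Young's inequality with kernel \<nabla>p, by Tonelli in three variables: translation
  invariance decouples x from y, and at each time s the two L^1 norms remain with weight
  s^(-1/\<alpha>)/\<alpha>.\<close>

lemma L1_increment_frac:
  assumes fin: "L1_norm grad_p < \<infinity>" and \<epsilon>: "0 < \<epsilon>" and t: "0 < t"
  shows "(\<integral>\<^sup>+x. ennreal \<bar>P (\<epsilon> + t) x - P \<epsilon> x\<bar> \<partial>lborel) \<le>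
    ennreal (t powr ((\<alpha> - 1) / \<alpha>) / (\<alpha> - 1)) * (L1_norm grad_p * L1_norm (field levy_symbol \<epsilon>))"
proof -
  let ?V = "field levy_symbol \<epsilon>"
  let ?c = "\<lambda>s::real. ennreal (indicator {0..t} s * (s powr (- 1 / \<alpha>) / \<alpha>))"
  let ?k = "\<lambda>x s y. ?c s * (ennreal (norm (grad_p y)) * ennreal (norm (?V (x + s powr (1 / \<alpha>) *\<^sub>R y))))"
  have [measurable]: "?V \<in> borel_measurable borel" by (rule measurable_field[OF admissible_levy_symbol \<epsilon>])
  have "(\<integral>\<^sup>+x. ennreal \<bar>P (\<epsilon> + t) x - P \<epsilon> x\<bar> \<partial>lborel) \<le> (\<integral>\<^sup>+x. \<integral>\<^sup>+s. \<integral>\<^sup>+y. ?k x s y \<partial>lborel \<partial>lborel \<partial>lborel)"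
  proof (intro nn_integral_mono)
    fix x
    let ?r = "\<lambda>s. Re (fourier (\<lambda>\<xi>. complex_of_real (psi \<xi>) * symb (\<epsilon> + s) \<xi>) x)"
    have "ennreal \<bar>P (\<epsilon> + t) x - P \<epsilon> x\<bar> = ennreal \<bar>P \<epsilon> x - P (\<epsilon> + t) x\<bar>"
      by (simp add: abs_minus_commute)
    also have "\<dots> \<le> (\<integral>\<^sup>+s. ennreal (norm (indicator {0..t} s * ?r s)) \<partial>lborel)"
      unfolding P_time_integral(1)[OF \<epsilon> t] real_norm_def[symmetric]
      by (rule integral_norm_bound_ennreal[OF P_time_integral(2)[OF \<epsilon> t]])
    also have "\<dots> \<le> (\<integral>\<^sup>+s. \<integral>\<^sup>+y. ?k x s y \<partial>lborel \<partial>lborel)"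
    proof (rule nn_integral_mono_AE)
      \<comment> \<open>The divergence formula holds at positive times only, so the endpoint s = 0
        is discarded as a null set.\<close>
      have "AE s in lborel. s \<noteq> (0::real)" by (rule AE_lborel_singleton)
      then show "AE s in lborel. ennreal (norm (indicator {0..t} s * ?r s)) \<le> (\<integral>\<^sup>+y. ?k x s y \<partial>lborel)"
      proof eventually_elim
        case (elim s)
        show ?case
        proof (cases "s \<in> {0..t}")
          case True
          with elim have s: "0 < s" by simp
          let ?\<tau> = "s powr (1 / \<alpha>)"
          have "s powr (- 1 / \<alpha>) * ?\<tau> = 1" using s by (subst powr_add[symmetric]) simp
          then have r: "?r s = (s powr (- 1 / \<alpha>) / \<alpha>) * (\<integral>y. grad_p y \<bullet> ?V (x + ?\<tau> *\<^sub>R y) \<partial>lborel)"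
            unfolding generator_divergence(1)[OF fin \<epsilon> s] using \<alpha> by simp
          have "ennreal (norm (indicator {0..t} s * ?r s)) = ?c s * ennreal (norm (\<integral>y. grad_p y \<bullet> ?V (x + ?\<tau> *\<^sub>R y) \<partial>lborel))"
            unfolding r using True \<alpha> by (subst ennreal_mult[symmetric]) (auto simp: abs_mult)
          also have "\<dots> \<le> ?c s * (\<integral>\<^sup>+y. ennreal (norm (grad_p y)) * ennreal (norm (?V (x + ?\<tau> *\<^sub>R y))) \<partial>lborel)"
          proof (rule mult_left_mono)
            have "ennreal (norm (\<integral>y. grad_p y \<bullet> ?V (x + ?\<tau> *\<^sub>R y) \<partial>lborel)) \<le>
                (\<integral>\<^sup>+y. ennreal (norm (grad_p y \<bullet> ?V (x + ?\<tau> *\<^sub>R y))) \<partial>lborel)"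
              by (rule integral_norm_bound_ennreal[OF generator_divergence(2)[OF fin \<epsilon> s]])
            also have "\<dots> \<le> (\<integral>\<^sup>+y. ennreal (norm (grad_p y)) * ennreal (norm (?V (x + ?\<tau> *\<^sub>R y))) \<partial>lborel)"
              by (intro nn_integral_mono) (auto simp: ennreal_mult[symmetric] intro!: ennreal_leI Cauchy_Schwarz_ineq2)
            finally show "ennreal (norm (\<integral>y. grad_p y \<bullet> ?V (x + ?\<tau> *\<^sub>R y) \<partial>lborel)) \<le> \<dots>" .
          qed simp
          also have "\<dots> = (\<integral>\<^sup>+y. ?k x s y \<partial>lborel)"
            by (rule nn_integral_cmult[symmetric]) measurable
          finally show ?thesis .
        qed simp
      qed
    qed
    finally show "ennreal \<bar>P (\<epsilon> + t) x - P \<epsilon> x\<bar> \<le> (\<integral>\<^sup>+s. \<integral>\<^sup>+y. ?k x s y \<partial>lborel \<partial>lborel)" .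
  qed
  also have "\<dots> = (\<integral>\<^sup>+s. \<integral>\<^sup>+x. \<integral>\<^sup>+y. ?k x s y \<partial>lborel \<partial>lborel \<partial>lborel)"
    by (rule lborel_pair.Fubini') measurable
  also have "\<dots> = (\<integral>\<^sup>+s. \<integral>\<^sup>+y. \<integral>\<^sup>+x. ?k x s y \<partial>lborel \<partial>lborel \<partial>lborel)"
    by (intro nn_integral_cong lborel_pair.Fubini') measurable
  also have "\<dots> = (\<integral>\<^sup>+s. \<integral>\<^sup>+y. ?c s * (ennreal (norm (grad_p y)) * L1_norm ?V) \<partial>lborel \<partial>lborel)"
  proof (intro nn_integral_cong)
    fix s :: real and y :: 'a
    have "(\<integral>\<^sup>+x. ennreal (norm (?V (x + s powr (1 / \<alpha>) *\<^sub>R y))) \<partial>lborel) = L1_norm ?V"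
      unfolding L1_norm_def by (rule nn_integral_lborel_translate) measurable
    then show "(\<integral>\<^sup>+x. ?k x s y \<partial>lborel) = ?c s * (ennreal (norm (grad_p y)) * L1_norm ?V)"
      by (simp add: nn_integral_cmult)
  qed
  also have "\<dots> = (\<integral>\<^sup>+s. ?c s * (L1_norm grad_p * L1_norm ?V) \<partial>lborel)"
    unfolding L1_norm_def[of grad_p] by (simp add: nn_integral_cmult nn_integral_multc)
  also have "\<dots> = (\<integral>\<^sup>+s. ?c s \<partial>lborel) * (L1_norm grad_p * L1_norm ?V)"
    by (rule nn_integral_multc) measurable
  \<comment> \<open>The singularity s^(-1/\<alpha>) is integrable because \<alpha> > 1; the exponent
    (\<alpha>-1)/\<alpha> times the factor \<alpha> gives the denominator \<alpha> - 1.\<close>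
  also have "(\<integral>\<^sup>+s. ?c s \<partial>lborel) = ennreal (t powr ((\<alpha> - 1) / \<alpha>) / (\<alpha> - 1))"
  proof -
    have "((\<lambda>s. s powr (- 1 / \<alpha>)) has_integral (t powr (- 1 / \<alpha> + 1) / (- 1 / \<alpha> + 1))) {0..t}"
      using \<alpha> t by (intro has_integral_powr_from_0) (auto simp: field_simps)
    then have "((\<lambda>s. s powr (- 1 / \<alpha>) / \<alpha>) has_integral (t powr (- 1 / \<alpha> + 1) / (- 1 / \<alpha> + 1) / \<alpha>)) {0..t}"
      by (rule has_integral_divide)
    from nn_integral_has_integral_lebesgue[OF _ this]
    have "(\<integral>\<^sup>+s. ?c s \<partial>lborel) = ennreal (t powr (- 1 / \<alpha> + 1) / (- 1 / \<alpha> + 1) / \<alpha>)"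
      using \<alpha> by simp
    moreover have "- 1 / \<alpha> + 1 = (\<alpha> - 1) / \<alpha>" using \<alpha> by (simp add: field_simps)
    ultimately show ?thesis using \<alpha> by simp
  qed
  finally show ?thesis .
qed

end

subsection \<open>The isoperimetric inequalities\<close>

context stable_law_set begin

lemma levy_symbol_uminus: "levy_symbol b (- \<xi>) = cnj (levy_symbol b \<xi>)"
proof -
  have "cnj (levy_symbol b \<xi>) = (CLINT z|polar. cnj ((iexp (ray z \<bullet> \<xi>) - 1) * complex_of_real (ray z \<bullet> b)))"
    unfolding levy_symbol_def by (rule Bochner_Integration.integral_cnj[symmetric])
  then show ?thesis by (simp add: levy_symbol_def exp_cnj)
qed

lemma symb_uminus: "symb t (- \<xi>) = cnj (symb t \<xi>)"
proof -
  have "cnj (Ehat \<xi>) = (CLINT z|lborel. cnj (iexp (- \<xi> \<bullet> z) * complex_of_real (indicator E z)))"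
    unfolding Ehat_def fourier_def
    by (rule Bochner_Integration.integral_cnj[symmetric])
  then have "Ehat (- \<xi>) = cnj (Ehat \<xi>)" by (simp add: Ehat_def fourier_def exp_cnj)
  then show ?thesis by (simp add: symb_def phi_uminus cst_def)
qed

text \<open>If \<open>D\<^sup>\<alpha>\<^sup>-\<^sup>1 P\<^sub>t 1\<^sub>E\<close> vanishes, Fourier inversion annihilates its symbol, hence the transform of
  \<open>1\<^sub>E\<close>, away from the origin.  This replaces a proof that \<open>\<nabla>p\<close> is integrable.\<close>

lemma L1_norm_frac_pos:
  assumes \<epsilon>: "0 < \<epsilon>" and E_pos: "0 < measure lborel E"
  shows "0 < L1_norm (field levy_symbol \<epsilon>)"
proof (rule ccontr)
  let ?V = "field levy_symbol \<epsilon>"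
  have [measurable]: "?V \<in> borel_measurable borel" by (rule measurable_field[OF admissible_levy_symbol \<epsilon>])
  assume "\<not> 0 < L1_norm ?V"
  then have "L1_norm ?V = 0" by simp
  then have "AE x in lborel. ennreal (norm (?V x)) = 0"
    unfolding L1_norm_def by (subst (asm) nn_integral_0_iff_AE) auto
  then have z: "AE x in lborel. ?V x = 0" by simp
  have m0: "levy_symbol b \<eta> * symb \<epsilon> \<eta> = 0" if b: "b \<in> Basis" for b \<eta>
  proof -
    let ?m = "\<lambda>\<xi>. levy_symbol b \<xi> * symb \<epsilon> \<xi>"
    have im: "integrable lborel ?m" by (rule integrable_admissible[OF admissible_levy_symbol \<epsilon>])
    \<comment> \<open>The field records real parts only; Hermitian symmetry of the multiplier shows
      that they are the whole transform.\<close>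
    have "Im (fourier ?m x) = 0" for x
      by (rule fourier_hermitian_real[OF im]) (simp add: levy_symbol_uminus symb_uminus)
    then have "fourier ?m x = complex_of_real (?V x \<bullet> b)" for x
      using b by (simp add: field_inner complex_eq_iff)
    then have f0: "AE x in lborel. fourier ?m x = 0" using z by (auto elim!: eventually_mono)
    have f_int: "integrable lborel (fourier ?m)"
      by (rule integrable_cong_AE_imp[of lborel "\<lambda>_. 0"]) (use f0 in \<open>auto elim!: eventually_mono\<close>)
    have ff: "fourier (fourier ?m) (- \<eta>) = (CLINT x|(lborel::'a measure). 0)"
      unfolding fourier_def[of "fourier ?m"]
      by (rule integral_cong_AE) (use f0 in \<open>auto elim!: eventually_mono\<close>)
    have cont: "isCont ?m \<eta>"
    proof -
      have "continuous_on UNIV ?m"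
        unfolding symb_def phi_def
        by (intro continuous_intros continuous_levy_symbol continuous_Ehat continuous_psi)
      then show ?thesis by (simp add: continuous_on_eq_continuous_at)
    qed
    obtain C where C: "\<And>\<xi>. norm (levy_symbol b \<xi>) \<le> C * (1 + (norm \<xi>)\<^sup>2)"
      using admissible_bound[OF admissible_levy_symbol] by blast
    have C0: "0 \<le> C" using order_trans[OF norm_ge_zero C[of 0]] by simp
    obtain K c where c: "0 < c" and K: "\<And>\<xi>. (1 + (norm \<xi>)\<^sup>2) * phi \<epsilon> \<xi> \<le> K * exp (- c * norm \<xi>)"
      using phi_weighted_le[OF \<epsilon>] by blast
    have "0 \<le> (1 + (norm (0::'a))\<^sup>2) * phi \<epsilon> 0" using phi_pos[of \<epsilon> 0] by simp
    also have "\<dots> \<le> K" using K[of 0] by simp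
    finally have K0: "0 \<le> K" .
    \<comment> \<open>Inversion requires a bounded multiplier: the polynomial growth of the symbol
      is absorbed by the decay of \<open>phi \<epsilon>\<close>.\<close>
    have "norm (?m \<xi>) \<le> C * K * (norm cst * measure lborel E)" for \<xi>
    proof -
      have "K * exp (- c * norm \<xi>) \<le> K" using K0 c by (intro mult_left_le) auto
      then have 1: "C * ((1 + (norm \<xi>)\<^sup>2) * phi \<epsilon> \<xi>) \<le> C * K"
        using K[of \<xi>] C0 by (intro mult_left_mono) auto
      have "norm (levy_symbol b \<xi>) * phi \<epsilon> \<xi> \<le> C * (1 + (norm \<xi>)\<^sup>2) * phi \<epsilon> \<xi>"
        using C phi_pos[of \<epsilon> \<xi>] by (intro mult_right_mono) auto
      then have "norm (levy_symbol b \<xi>) * phi \<epsilon> \<xi> \<le> C * K" using 1 by (simp add: mult.assoc)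
      then have "(norm (levy_symbol b \<xi>) * phi \<epsilon> \<xi>) * (norm cst * norm (Ehat \<xi>)) \<le> C * K * (norm cst * measure lborel E)"
        by (rule mult_mono) (use C0 K0 in \<open>auto intro!: mult_left_mono norm_Ehat_le\<close>)
      then show ?thesis
        by (simp add: symb_def norm_mult abs_of_pos phi_pos mult_ac)
    qed
    from fourier_inversion_bounded[OF im f_int cont this] show ?thesis using ff by simp
  qed
  have Eh: "Ehat \<eta> = 0" if "\<eta> \<noteq> 0" for \<eta>
  proof -
    have "0 = (\<Sum>b\<in>Basis. complex_of_real (\<eta> \<bullet> b) * (levy_symbol b \<eta> * symb \<epsilon> \<eta>))"
      by (simp add: m0)
    also have "\<dots> = (\<Sum>b\<in>Basis. complex_of_real (\<eta> \<bullet> b) * levy_symbol b \<eta>) * symb \<epsilon> \<eta>"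
      by (simp add: sum_distrib_right mult.assoc)
    also have "\<dots> = \<i> * complex_of_real (\<alpha> * psi \<eta>) * symb \<epsilon> \<eta>"
      by (simp only: levy_symbol_inner)
    finally have "symb \<epsilon> \<eta> = 0" using psi_pos[OF that] \<alpha> by auto
    then show ?thesis using phi_pos[of \<epsilon> \<eta>] by (auto simp: symb_def cst_def)
  qed
  \<comment> \<open>Vanishing off the origin extends to 0 by continuity, but the value there is the
    measure of E.\<close>
  have "isCont Ehat 0" using continuous_Ehat by (simp add: continuous_on_eq_continuous_at)
  then have "(Ehat \<longlongrightarrow> Ehat 0) (at 0)" by (simp add: isCont_def)
  moreover have "(Ehat \<longlongrightarrow> 0) (at 0)"
    by (rule tendsto_eventually) (auto simp: Eh eventually_at intro!: exI[of _ 1])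
  ultimately have "Ehat 0 = 0" using tendsto_unique[OF at_neq_bot] by blast
  moreover have "Ehat 0 = complex_of_real (measure lborel E)"
    by (simp add: Ehat_def fourier_def)
  ultimately show False using E_pos by simp
qed

lemma SUP_p_pos: "0 < (SUP x. \<bar>p x\<bar>)"
proof -
  have "bdd_above (range (\<lambda>x. \<bar>p x\<bar>))" using bdd_p by (simp add: abs_of_pos p_pos)
  then have "p 0 \<le> (SUP x. \<bar>p x\<bar>)"
    using cSUP_upper[of 0 UNIV "\<lambda>x. \<bar>p x\<bar>"] p_pos[of 0] by simp
  with p_pos[of 0] show ?thesis by linarith
qed

text \<open>\<open>B\<close> is independent of \<epsilon>, so \<epsilon> = 1 / Suc n may tend to 0.
  Then \<open>?Q\<close> at \<epsilon> tends to the measure of E, and at \<epsilon> + t it stays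
  below \<open>?R\<close>, since the decay bound decreases in time.\<close>

lemma measure_E_le_increment:
  assumes t: "0 < t"
    and incr: "\<And>\<epsilon>. 0 < \<epsilon> \<Longrightarrow> (\<integral>\<^sup>+x. ennreal \<bar>P (\<epsilon> + t) x - P \<epsilon> x\<bar> \<partial>lborel) \<le> B"
  shows "ennreal (2 * (measure lborel E - (SUP x. \<bar>p x\<bar>) * (measure lborel E)\<^sup>2 * t powr (- (real DIM('a) / \<alpha>)))) \<le> B"
proof -
  let ?Q = "\<lambda>s. \<integral>x. indicator E x * P s x \<partial>lborel"
  let ?R = "(SUP x. \<bar>p x\<bar>) * (measure lborel E)\<^sup>2 * t powr (- (real DIM('a) / \<alpha>))"
  have "ennreal (2 * (?Q (1 / Suc n) - ?R)) \<le> B" for n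
  proof -
    let ?\<epsilon> = "1 / real (Suc n)"
    have e: "0 < ?\<epsilon>" by simp
    have "?Q (?\<epsilon> + t) \<le> (SUP x. \<bar>p x\<bar>) * (measure lborel E)\<^sup>2 * (?\<epsilon> + t) powr (- (real DIM('a) / \<alpha>))"
      by (rule integral_E_P_le[OF add_pos_pos[OF e t]])
    also have "\<dots> \<le> ?R"
      using e t \<alpha> SUP_p_pos by (intro mult_left_mono powr_mono2') auto
    finally have "ennreal (2 * (?Q ?\<epsilon> - ?R)) \<le> ennreal (2 * (?Q ?\<epsilon> - ?Q (?\<epsilon> + t)))"
      by (intro ennreal_leI) simp
    also have "\<dots> \<le> (\<integral>\<^sup>+x. ennreal \<bar>P (?\<epsilon> + t) x - P ?\<epsilon> x\<bar> \<partial>lborel)"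
      by (rule two_integral_E_P_le[OF e add_pos_pos[OF e t]])
    also have "\<dots> \<le> B" by (rule incr[OF e])
    finally show ?thesis .
  qed
  moreover have "(\<lambda>n. ennreal (2 * (?Q (1 / Suc n) - ?R))) \<longlonglongrightarrow> ennreal (2 * (measure lborel E - ?R))"
    by (intro tendsto_ennrealI tendsto_intros integral_E_P_tendsto)
  ultimately show ?thesis by (intro LIMSEQ_le_const2) auto
qed

end

text \<open>The value of \<open>\<tau>\<close> used here minimises \<open>A / (2 \<beta>) \<tau>\<^sup>\<beta> + M V\<^sup>2 \<tau>\<^sup>-\<^sup>d\<close>.\<close>

lemma isoperimetric_optimisation:
  fixes V A M d \<beta> :: real
  assumes pos: "0 < V" "0 < M" "0 < d" "0 < \<beta>" "0 \<le> A"
    and le: "\<And>\<tau>. 0 < \<tau> \<Longrightarrow> V \<le> A / (2 * \<beta>) * \<tau> powr \<beta> + M * V\<^sup>2 * \<tau> powr (- d)"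
  shows "V powr ((d - \<beta>) / d) \<le>
    (1 / (2 * \<beta>) * (2 * d) powr (\<beta> / (d + \<beta>)) + (1 / (2 * d)) powr (d / (d + \<beta>))) powr ((d + \<beta>) / d)
      * M powr (\<beta> / d) * A"
proof (cases "A = 0")
  case True
  \<comment> \<open>With A = 0 the limit \<tau> to infinity gives V <= 0, contradicting positivity
    of V.\<close>
  have "((\<lambda>\<tau>. M * V\<^sup>2 * \<tau> powr (- d)) \<longlongrightarrow> M * V\<^sup>2 * 0) at_top"
    using pos by (intro tendsto_intros tendsto_neg_powr filterlim_ident) auto
  moreover have "\<forall>\<^sub>F \<tau> in at_top. V \<le> M * V\<^sup>2 * \<tau> powr (- d)"
    using eventually_gt_at_top[of 0] by eventually_elim (use le True in simp)
  ultimately have "V \<le> M * V\<^sup>2 * 0" by (rule tendsto_lowerbound) simp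
  then show ?thesis using pos by simp
next
  case False
  then have A: "0 < A" using pos by simp
  define B where "B = M * V\<^sup>2"
  have B: "0 < B" using pos by (simp add: B_def)
  define q where "q = d + \<beta>"
  have q: "0 < q" using pos by (simp add: q_def)
  let ?K = "1 / (2 * \<beta>) * (2 * d) powr (\<beta> / q) + (1 / (2 * d)) powr (d / q)"
  have K: "0 < ?K" using pos by (intro add_pos_pos mult_pos_pos) auto
  have bq: "\<beta> / q = 1 - d / q" using q by (simp add: q_def field_simps)
  define \<tau> where "\<tau> = (2 * d * B / A) powr (1 / q)"
  have \<tau>: "0 < \<tau>" using pos A B by (simp add: \<tau>_def)
  have "\<tau> powr \<beta> = (2 * d * B / A) powr (\<beta> / q)" by (simp add: \<tau>_def powr_powr)
  also have "\<dots> = (2 * d) powr (\<beta> / q) * B powr (\<beta> / q) / A powr (\<beta> / q)"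
    using pos A B by (simp add: powr_divide powr_mult)
  finally have "A * \<tau> powr \<beta> = (2 * d) powr (\<beta> / q) * B powr (\<beta> / q) * (A / A powr (\<beta> / q))"
    by simp
  also have "A / A powr (\<beta> / q) = A powr (d / q)"
    using A by (simp add: bq powr_diff)
  finally have 1: "A * \<tau> powr \<beta> = (2 * d) powr (\<beta> / q) * (A powr (d / q) * B powr (\<beta> / q))"
    by simp
  have "\<tau> powr (- d) = (2 * d * B / A) powr (- (d / q))" by (simp add: \<tau>_def powr_powr)
  also have "\<dots> = (1 / (2 * d)) powr (d / q) * A powr (d / q) / B powr (d / q)"
    using pos A B by (simp add: powr_minus_divide powr_divide powr_mult)
  finally have "B * \<tau> powr (- d) = (1 / (2 * d)) powr (d / q) * A powr (d / q) * (B / B powr (d / q))"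
    by simp
  also have "B / B powr (d / q) = B powr (\<beta> / q)"
    using B by (simp add: bq powr_diff)
  finally have 2: "B * \<tau> powr (- d) = (1 / (2 * d)) powr (d / q) * (A powr (d / q) * B powr (\<beta> / q))"
    by simp
  have "V \<le> 1 / (2 * \<beta>) * (A * \<tau> powr \<beta>) + B * \<tau> powr (- d)"
    using le[OF \<tau>] by (simp add: B_def)
  also have "\<dots> = ?K * (A powr (d / q) * B powr (\<beta> / q))"
    unfolding 1 2 by (simp add: distrib_right)
  \<comment> \<open>Raising to the power q/d makes the bound linear in A. The factor V^2 in B then
    contributes V^(2 \<beta>/d), which moves to the left, and q/d - 2 \<beta>/d = (d -
    \<beta>)/d.\<close>
  finally have "V powr (q / d) \<le> (?K * (A powr (d / q) * B powr (\<beta> / q))) powr (q / d)"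
    using pos q by (intro powr_mono2) auto
  also have "\<dots> = ?K powr (q / d) * (A * B powr (\<beta> / d))"
    using K A B pos q by (simp add: powr_mult powr_powr)
  also have "B powr (\<beta> / d) = M powr (\<beta> / d) * V powr (2 * (\<beta> / d))"
  proof -
    have "V\<^sup>2 = V powr 2" using pos by simp
    then have "(V\<^sup>2) powr (\<beta> / d) = V powr (2 * (\<beta> / d))" by (simp only: powr_powr)
    then show ?thesis using pos by (simp add: B_def powr_mult)
  qed
  finally have "V powr (q / d) / V powr (2 * (\<beta> / d)) \<le> ?K powr (q / d) * M powr (\<beta> / d) * A"
    using pos by (simp add: pos_divide_le_eq mult_ac)
  moreover have "V powr (q / d) / V powr (2 * (\<beta> / d)) = V powr ((d - \<beta>) / d)"
  proof -
    have "(d - \<beta>) / d = q / d - 2 * (\<beta> / d)" using pos by (simp add: q_def field_simps)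
    then show ?thesis by (simp only: powr_diff)
  qed
  ultimately show ?thesis by (simp add: q_def)
qed

text \<open>The common end of both proofs; \<beta> is the order of the gradient, \<alpha> - 1 for
  D^(\<alpha>-1) and 1 for \<nabla>. An infinite A is harmless because its coefficient is
  positive.\<close>

lemma (in stable_law_set) isoperimetric_from_increment:
  fixes A :: ennreal
  defines "d \<equiv> real DIM('a)"
  assumes \<beta>: "0 < \<beta>" and V: "0 < measure lborel E"
    and incr: "\<And>\<epsilon> t. 0 < \<epsilon> \<Longrightarrow> 0 < t \<Longrightarrow>
      (\<integral>\<^sup>+x. ennreal \<bar>P (\<epsilon> + t) x - P \<epsilon> x\<bar> \<partial>lborel) \<le> ennreal (t powr (\<beta> / \<alpha>) / \<beta>) * A"
  shows "ennreal (measure lborel E powr ((d - \<beta>) / d)) \<le>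
    ennreal ((1 / (2 * \<beta>) * (2 * d) powr (\<beta> / (d + \<beta>)) + (1 / (2 * d)) powr (d / (d + \<beta>))) powr ((d + \<beta>) / d)
      * 2 powr (\<beta> / \<alpha>) * (SUP x. \<bar>p x\<bar>) powr (\<beta> / d)) * A"
proof -
  let ?V = "measure lborel E" and ?M = "SUP x. \<bar>p x\<bar>"
  define K where "K = (1 / (2 * \<beta>) * (2 * d) powr (\<beta> / (d + \<beta>)) + (1 / (2 * d)) powr (d / (d + \<beta>))) powr ((d + \<beta>) / d)"
  have d: "0 < d" by (simp add: d_def)
  have "0 < 1 / (2 * \<beta>) * (2 * d) powr (\<beta> / (d + \<beta>)) + (1 / (2 * d)) powr (d / (d + \<beta>))"
    using d \<beta> by (intro add_pos_pos mult_pos_pos) auto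
  then have K: "0 < K" by (simp add: K_def)
  have c: "0 < K * 2 powr (\<beta> / \<alpha>) * ?M powr (\<beta> / d)"
    using K SUP_p_pos by (intro mult_pos_pos) auto
  have "ennreal (?V powr ((d - \<beta>) / d)) \<le> ennreal (K * 2 powr (\<beta> / \<alpha>) * ?M powr (\<beta> / d)) * A"
  proof (cases A)
    case top
    then show ?thesis using c K SUP_p_pos by (simp add: ennreal_mult_top)
  next
    case (real a)
    have "?V \<le> a / (2 * \<beta>) * \<tau> powr \<beta> + ?M * ?V\<^sup>2 * \<tau> powr (- d)" if \<tau>: "0 < \<tau>" for \<tau>
    proof -
      \<comment> \<open>With t = \<tau>^\<alpha> the exponents \<beta>/\<alpha> and -d/\<alpha>
        become \<beta> and -d, the form that is optimised.\<close>
      have t: "0 < \<tau> powr \<alpha>" using \<tau> by simp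
      have "ennreal (2 * (?V - ?M * ?V\<^sup>2 * (\<tau> powr \<alpha>) powr (- (real DIM('a) / \<alpha>)))) \<le> ennreal ((\<tau> powr \<alpha>) powr (\<beta> / \<alpha>) / \<beta>) * A"
        by (rule measure_E_le_increment[OF t incr[OF _ t]])
      also have "\<dots> = ennreal (\<tau> powr \<beta> / \<beta> * a)"
        using real \<beta> \<alpha> by (subst real(2), subst ennreal_mult[symmetric]) (auto simp: powr_powr)
      finally have "2 * (?V - ?M * ?V\<^sup>2 * \<tau> powr (- d)) \<le> \<tau> powr \<beta> / \<beta> * a"
        using real \<beta> \<alpha> by (subst (asm) ennreal_le_iff) (auto simp: powr_powr d_def)
      then show ?thesis by (simp add: field_simps)
    qed
    from isoperimetric_optimisation[OF V SUP_p_pos d \<beta> real(1) this]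
    have "?V powr ((d - \<beta>) / d) \<le> K * ?M powr (\<beta> / d) * a" by (simp add: K_def)
    also have "\<dots> \<le> (K * ?M powr (\<beta> / d) * a) * 2 powr (\<beta> / \<alpha>)"
    proof -
      have "1 \<le> 2 powr (\<beta> / \<alpha>)" using \<beta> \<alpha> by (intro ge_one_powr_ge_zero) auto
      moreover have "0 \<le> K * ?M powr (\<beta> / d) * a" using K real by (intro mult_nonneg_nonneg) auto
      ultimately show ?thesis using mult_left_mono by fastforce
    qed
    finally have "ennreal (?V powr ((d - \<beta>) / d)) \<le> ennreal (K * 2 powr (\<beta> / \<alpha>) * ?M powr (\<beta> / d) * a)"
      by (intro ennreal_leI) (simp add: mult_ac)
    then show ?thesis using real c by (simp add: ennreal_mult)
  qed
  then show ?thesis by (simp add: K_def)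
qed

theorem theorem1p2:
  fixes \<alpha> :: real
    and \<sigma> \<mu> :: "'a::euclidean_space measure"
    and p :: "'a \<Rightarrow> real"
    and N :: "'b measure" and Y :: "'b \<Rightarrow> real"
    and E :: "'a set"
  assumes "1 < \<alpha>" and "\<alpha> < 2"
    and "nondegenerate_stable_law \<alpha> \<sigma> \<mu>"
    and "\<mu> = density lborel (\<lambda>x. ennreal (p x))"
    and "continuous_on UNIV p" and "\<And>x. 0 < p x"
    and "prob_space N" and "Y \<in> borel_measurable N"
    and "\<And>\<xi>. char (distr N borel Y) \<xi> = complex_of_real (exp (- (\<bar>\<xi>\<bar> powr \<alpha>)))"
    and "E \<in> sets borel" and "emeasure lborel E < \<infinity>"
  shows "ennreal (measure lborel E powr ((real DIM('a) - (\<alpha> - 1)) / real DIM('a)))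
           \<le> const_frac \<alpha> p * perimeter_frac \<alpha> \<sigma> \<mu> E
       \<and> ennreal (measure lborel E powr ((real DIM('a) - 1) / real DIM('a)))
           \<le> const_cl \<alpha> p (prob_space.expectation N (\<lambda>\<omega>. \<bar>Y \<omega>\<bar>)) * perimeter_cl \<alpha> \<sigma> \<mu> E"
proof -
  interpret stable_law_set \<alpha> \<sigma> \<mu> p E
    by unfold_locales (use assms in \<open>auto simp: nondegenerate_stable_law_def\<close>)
  show ?thesis
  proof (cases "0 < measure lborel E")
    case False
    \<comment> \<open>\<open>0 powr a\<close> is 0 for every a, including the exponent 0 of the
      classical inequality in dimension one, so both left-hand sides vanish.\<close>
    then have "measure lborel E = 0" using measure_nonneg[of lborel E] by linarith
    then show ?thesis by simp
  next
    case V: True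
    let ?EY = "prob_space.expectation N (\<lambda>\<omega>. \<bar>Y \<omega>\<bar>)"
    note proj = stable_projection[OF assms(7,8,9)]
    have EY: "0 < ?EY" by (rule stable_1d_integrable(2)[OF assms(7,8,9) \<alpha>])
    have frac: "ennreal (measure lborel E powr ((real DIM('a) - (\<alpha> - 1)) / real DIM('a)))
        \<le> const_frac \<alpha> p * perimeter_frac \<alpha> \<sigma> \<mu> E"
    proof -
      have "(\<integral>\<^sup>+x. ennreal \<bar>P (\<epsilon> + t) x - P \<epsilon> x\<bar> \<partial>lborel) \<le>
          ennreal (t powr ((\<alpha> - 1) / \<alpha>) / (\<alpha> - 1)) * (L1_norm grad_p * perimeter_frac \<alpha> \<sigma> \<mu> E)"
        if \<epsilon>: "0 < \<epsilon>" and t: "0 < t" for \<epsilon> t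
      proof (cases "L1_norm grad_p < \<infinity>")
        case True
        show ?thesis
          by (rule order_trans[OF L1_increment_frac[OF True \<epsilon> t]])
             (intro mult_left_mono L1_norm_le_perimeter_frac \<epsilon>, auto)
      next
        case False
        \<comment> \<open>The bound is infinite only if the perimeter is not 0, since 0 times
          infinity is 0 in \<open>ennreal\<close>.\<close>
        have "perimeter_frac \<alpha> \<sigma> \<mu> E \<noteq> 0"
          using L1_norm_frac_pos[OF \<epsilon> V] L1_norm_le_perimeter_frac[OF \<epsilon>] by auto
        then show ?thesis using False \<alpha> t
          by (simp add: ennreal_top_mult ennreal_mult_top less_top[symmetric])
      qed
      from isoperimetric_from_increment[OF _ V this] \<alpha> show ?thesis
        by (simp add: const_frac_def gradient_p Let_def add_diff_eq mult.assoc)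
    qed
    have cl: "ennreal (measure lborel E powr ((real DIM('a) - 1) / real DIM('a)))
        \<le> const_cl \<alpha> p ?EY * perimeter_cl \<alpha> \<sigma> \<mu> E"
    proof -
      have "(\<integral>\<^sup>+x. ennreal \<bar>P (\<epsilon> + t) x - P \<epsilon> x\<bar> \<partial>lborel) \<le>
          ennreal (t powr (1 / \<alpha>) / 1) * (ennreal ?EY * perimeter_cl \<alpha> \<sigma> \<mu> E)"
        if \<epsilon>: "0 < \<epsilon>" and t: "0 < t" for \<epsilon> t
      proof -
        have "(\<integral>\<^sup>+x. ennreal \<bar>P (\<epsilon> + t) x - P \<epsilon> x\<bar> \<partial>lborel) \<le> ennreal (t powr (1 / \<alpha>) * ?EY) * perimeter_cl \<alpha> \<sigma> \<mu> E"
          by (rule order_trans[OF L1_increment_cl[OF \<epsilon> t EY proj]])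
             (intro mult_left_mono L1_norm_le_perimeter_cl \<epsilon> jensen_stable_norm[OF proj EY], auto)
        then show ?thesis using EY by (simp add: ennreal_mult mult.assoc)
      qed
      note * = isoperimetric_from_increment[OF zero_less_one V this]
      define k where "k = (1 / 2 * (2 * real DIM('a)) powr (1 / (real DIM('a) + 1)) + 1 / (2 * real DIM('a)) powr (real DIM('a) / (real DIM('a) + 1)))
          powr ((real DIM('a) + 1) / real DIM('a)) * 2 powr (1 / \<alpha>) * (SUP x. \<bar>p x\<bar>) powr (1 / real DIM('a))"
      have "0 \<le> k" unfolding k_def by (intro mult_nonneg_nonneg) auto
      then have "const_cl \<alpha> p ?EY = ennreal k * ennreal ?EY"
        unfolding const_cl_def Let_def k_def[symmetric] using EY by (simp add: ennreal_mult)
      then show ?thesis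
        using * by (simp add: k_def powr_divide mult.assoc)
    qed
    from frac cl show ?thesis ..
  qed
qed

end
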